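(* Let $p$ be a positive integer and let $R=P/Q$, where $P,Q$ are co-prime polynomials with constant coefficients. If the autonomous Schwarzian differential equation $$S(f,z)^p=R(f)=\frac{P(f)}{Q(f)}\qquad(\ast)$$ admits a transcendental entire solution $f$, then by some linear transformation $f=L_1(u)$, equation $(\ast)$ reduces into either $$S(u,z)=c\,\frac{(u-\sqrt2\, i)(u+\sqrt2\, i)}{(u-1)(u+1)},$$ and the entire solutions of $(\ast)$ are $f(z)=L_1(\sin(\alpha z+\beta))$, where $\alpha=\sqrt{2c}$ and $\beta$ is a constant; or $$S(u,z)=c,$$ and all entire solutions of $(\ast)$ are $f(z)=L_2(e^{\pm\alpha z})$, where $\alpha=\sqrt{-2c}$ and $L_2$ is any linear transformation.
   Context: The Schwarzian derivative of a meromorphic function $f$ is $S(f,z)=\left(\frac{f''}{f'}\right)'-\frac12\left(\frac{f''}{f'}\right)^2=\frac{f'''}{f'}-\frac32\left(\frac{f''}{f'}\right)^2$. "Transcendental entire" means entire on $\mathbb{C}$ and not a polynomial. A linear transformation is a map $L(w)=aw+b$ with constants $a\neq0$ and $b$. In the claim, $c$ denotes a complex constant, the one appearing in the reduced equation. The Schwarzian derivative is unchanged when $f$ is composed with a Möbius (in particular, linear) transformation, $S(\gamma\circ f,z)=S(f,z)$; "reduces" means that after the substitution $f=L_1(u)$ the equation takes the displayed form for $u$ (after a $p$-th root is extracted when $p>1$).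
   Formalization: For p > 1 the single value of α is corrected: the entire solutions have α = √(2ωc), resp. √(−2ωc), with ω any p-th root of unity, since (∗) fixes c only up to such a factor (S² = 1 is solved by both e^{√−2 z} and e^{√2 z}); p = 1 is unchanged. *)

theory Defs
  imports "HOL-Complex_Analysis.Complex_Analysis"
begin

definition schwarzian :: "(complex \<Rightarrow> complex) \<Rightarrow> complex \<Rightarrow> complex" where
  "schwarzian f z =
     deriv (\<lambda>w. deriv (deriv f) w / deriv f w) z - 1 / 2 * (deriv (deriv f) z / deriv f z) ^ 2"

lemma schwarzian_altdef:
  assumes "f analytic_on {z}" "deriv f z \<noteq> 0"
  shows "schwarzian f z =
           deriv (deriv (deriv f)) z / deriv f z - 3 / 2 * (deriv (deriv f) z / deriv f z) ^ 2"
proof -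
  have an: "deriv f analytic_on {z}" "deriv (deriv f) analytic_on {z}"
    using assms(1) by (auto intro: analytic_deriv)
  have "((\<lambda>w. deriv (deriv f) w / deriv f w) has_field_derivative
          (deriv (deriv (deriv f)) z * deriv f z - deriv (deriv f) z * deriv (deriv f) z)
            / (deriv f z * deriv f z)) (at z)"
    using an assms(2)
    by (intro DERIV_divide) (auto simp: DERIV_deriv_iff_field_differentiable
          intro: analytic_on_imp_differentiable_at)
  then show ?thesis
    using assms(2) by (simp add: schwarzian_def DERIV_imp_deriv field_simps power2_eq_square)
qed

text \<open>
  A meromorphic function is represented by a total function whose values on a sparse set (in
  particular at its poles) are irrelevant. Hence the equation $S(f,z)^p = R(f)$, an identity between
  meromorphic functions, is required off a sparse set only; at zeros of $f'$ and of $Q(f)$ both sides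
  may have poles. Constants (for which $S$ is undefined) are not solutions: this has to be
  said explicitly, because $x / 0 = 0$ would make their Schwarzian vanish.
\<close>

definition schwarzian_solution ::
    "nat \<Rightarrow> (complex \<Rightarrow> complex) \<Rightarrow> (complex \<Rightarrow> complex) \<Rightarrow> bool" where
  "schwarzian_solution p R f \<longleftrightarrow>
     f meromorphic_on UNIV \<and>
     \<not> (\<exists>k. eventually (\<lambda>z. f z = k) (cosparse UNIV)) \<and>
     eventually (\<lambda>z. schwarzian f z ^ p = R (f z)) (cosparse UNIV)"

definition transcendental_entire :: "(complex \<Rightarrow> complex) \<Rightarrow> bool" where
  "transcendental_entire f \<longleftrightarrow> f holomorphic_on UNIV \<and> \<not> (\<exists>q. f = poly q)"

definition linear_transformation :: "(complex \<Rightarrow> complex) \<Rightarrow> bool" where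
  "linear_transformation L \<longleftrightarrow> (\<exists>a b. a \<noteq> 0 \<and> L = (\<lambda>w. a * w + b))"

text \<open>
  The substitution $f = L(u)$ turns $S(f,z)^p = R(f)$ into $S(u,z) = T(u)$ up to extraction of a
  $p$-th root: $R \circ L$ and $T^p$ are the same rational function, and $L(u)$ solves the original
  equation iff $u$ solves one of the equations $S(u,z) = \omega T(u)$ with $\omega^p = 1$.
\<close>

definition schwarzian_reduces ::
    "nat \<Rightarrow> (complex \<Rightarrow> complex) \<Rightarrow> (complex \<Rightarrow> complex) \<Rightarrow> (complex \<Rightarrow> complex) \<Rightarrow> bool" where
  "schwarzian_reduces p R L T \<longleftrightarrow>
     eventually (\<lambda>w. R (L w) = T w ^ p) cofinite \<and>
     (\<forall>u. schwarzian_solution p R (\<lambda>z. L (u z)) \<longleftrightarrow>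
          (\<exists>\<omega>. \<omega> ^ p = 1 \<and> schwarzian_solution 1 (\<lambda>w. \<omega> * T w) u))"

end

theory Submission
  imports Defs "HOL-Computational_Algebra.Fundamental_Theorem_Algebra"
begin

text \<open>
  A critical point of an entire function \<open>f\<close> of multiplicity \<open>m\<close> is a double pole of the Schwarzian with leading
  coefficient \<open>(1 - m\<^sup>2) / 2\<close>, and \<open>S(f)\<close> is holomorphic everywhere else. Comparing poles in \<open>S(f)\<^sup>p = P(f) / Q(f)\<close>
  (lemma \<open>ramification\<close>) shows that every root of \<open>Q\<close> taken by \<open>f\<close> is always taken with the
  same multiplicity, at least two, and that \<open>f'\<close> does not vanish elsewhere. Totally ramified values are rare for entire
  functions, so \<open>Q\<close> should have very few roots. In value distribution theory one would use Nevanlinna's second main theorem and the lemma on the logarithmic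
  derivative; here both are replaced by elementary growth and rescaling arguments.

  The degree of \<open>P\<close> does not exceed that of \<open>Q\<close> (\<open>degree_le\<close>): at a point where \<open>\<bar>f\<bar>\<close> is maximal
  on a disc and grows slowly beyond it, Cauchy's estimates bound \<open>S(f)\<close> by a small power of \<open>\<bar>f\<bar>\<close>. So the right-hand
  side is bounded away from the roots of \<open>Q\<close>, and after a change of scale \<open>z = z0 + \<rho> \<zeta>\<close> with small \<open>\<rho>\<close> it is negligible there.

  If \<open>Q\<close> has two distinct roots \<open>a\<close>, \<open>b\<close>, the function \<open>G = f'\<^sup>2 / ((f - a) (f - b))\<close> is entire. Where \<open>G\<close> is large, rescaling
  produces functions for which \<open>G\<close> is almost constant, and then the equation forces \<open>f\<close> to be almost constant too, which
  contradicts the definition of \<open>G\<close>. Hence \<open>G\<close> is constant (\<open>two_root_first_order\<close>) and \<open>f\<close> is a linear image of a sine.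

  If \<open>Q\<close> has a single root \<open>a\<close>, then \<open>f = a + F\<^sup>m\<close> with \<open>m \<ge> 2\<close> and \<open>F'\<close> without zeros. A second
  rescaling argument shows that \<open>F\<close> has at most exponential growth, so \<open>F = A exp (\<alpha> z) + B\<close>. For these functions the equation is
  a polynomial identity that fails (\<open>one_root_impossible\<close>): the Schwarzian of \<open>F\<^sup>m\<close> is not a function of \<open>F\<^sup>m\<close>.

  If \<open>Q\<close> has no root, the right-hand side is constant, and \<open>f'' / f'\<close> is an entire solution of a Riccati equation with constant
  coefficients. Such solutions are constant, so \<open>f\<close> is a linear image of an exponential.
\<close>

section \<open>Entire functions and the local behaviour of the Schwarzian\<close>

lemma entire_DERIV:
  assumes "f holomorphic_on UNIV"
  shows "(f has_field_derivative deriv f z) (at z)"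
  using assms by (simp add: holomorphic_derivI)

lemma entire_DERIV':
  assumes "f holomorphic_on UNIV" "(g has_field_derivative d) (at z within A)"
  shows "((\<lambda>z. f (g z)) has_field_derivative deriv f (g z) * d) (at z within A)"
  using DERIV_chain2[OF entire_DERIV[OF assms(1)] assms(2)] .

lemma entire_deriv:
  assumes "f holomorphic_on UNIV"
  shows "deriv f holomorphic_on UNIV"
  using assms by (simp add: holomorphic_deriv)

lemma entire_isCont:
  assumes "f holomorphic_on UNIV"
  shows "isCont f z"
  using entire_DERIV[OF assms] DERIV_isCont by blast

lemma entire_mult_eq_0_cancel:
  fixes f g :: "complex \<Rightarrow> complex"
  assumes "f holomorphic_on UNIV" "g holomorphic_on UNIV" "\<And>z. f z * g z = 0" "g z1 \<noteq> 0"
  shows "f z = 0"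
proof -
  have "continuous_on UNIV g"
    using assms holomorphic_on_imp_continuous_on by blast
  then have "open {z. g z \<noteq> 0}"
    by (simp add: open_Collect_neq)
  moreover have "f w = 0" if "w \<in> {z. g z \<noteq> 0}" for w
    using assms(3)[of w] that by simp
  moreover have "{z. g z \<noteq> 0} \<noteq> {}"
    using assms(4) by blast
  ultimately show ?thesis
    using analytic_continuation_open[of "{z. g z \<noteq> 0}" UNIV f "\<lambda>_. 0" z] assms(1) connected_UNIV by simp
qed

lemma entire_deriv_nonzero:
  fixes f :: "complex \<Rightarrow> complex"
  assumes "f holomorphic_on UNIV" "\<not> f constant_on UNIV"
  obtains z where "deriv f z \<noteq> 0"
proof -
  have "\<exists>z. deriv f z \<noteq> 0"
  proof (rule ccontr)
    assume "\<not> ?thesis"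
    then have "\<And>z. (f has_field_derivative 0) (at z)"
      using entire_DERIV[OF assms(1)] by metis
    then obtain c where "\<And>z. f z = c"
      using has_field_derivative_zero_constant[of UNIV f] by auto
    then show False
      using assms(2) by (auto simp: constant_on_def)
  qed
  then show ?thesis using that by blast
qed

lemma schwarzian_entire:
  assumes "f holomorphic_on UNIV" "deriv f z \<noteq> 0"
  shows "schwarzian f z =
           deriv (deriv (deriv f)) z / deriv f z - 3 / 2 * (deriv (deriv f) z / deriv f z) ^ 2"
  using assms by (intro schwarzian_altdef)
    (meson UNIV_I analytic_on_analytic_at analytic_on_open open_UNIV, simp)

text \<open>
  Used to divide entire functions: it is enough that the quotient has a limit at every point, because
  the limit function then removes all singularities at once.
\<close>
lemma entire_quotient:
  fixes f g l :: "complex \<Rightarrow> complex"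
  assumes f: "f holomorphic_on UNIV" and g: "g holomorphic_on UNIV"
    and lim: "\<And>z. (\<lambda>w. f w / g w) \<midarrow>z\<rightarrow> l z" and nz: "g z1 \<noteq> 0"
  shows "l holomorphic_on UNIV" "f z = g z * l z"
proof -
  have ncg: "\<And>z. eventually (\<lambda>w. g w \<noteq> 0) (at z)"
  proof -
    fix z
    show "eventually (\<lambda>w. g w \<noteq> 0) (at z)"
      using non_zero_neighbour_alt[of g UNIV z z1] g nz by auto
  qed
  have an: "l analytic_on {z}" for z
  proof -
    from ncg[of z] obtain r where r: "r > 0" "\<And>w. w \<in> ball z r - {z} \<Longrightarrow> g w \<noteq> 0"
      unfolding eventually_at by (auto simp: dist_commute)
    have "(\<lambda>w. f w / g w) holomorphic_on ball z r - {z}"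
      using r by (intro holomorphic_intros holomorphic_on_subset[OF f] holomorphic_on_subset[OF g]) auto
    then have h: "(\<lambda>w. if w = z then l z else f w / g w) holomorphic_on ball z r"
      by (rule removable_singularity) (auto simp: lim)
    have eq: "l w = f w / g w" if "w \<in> ball z r - {z}" for w
    proof -
      have "(\<lambda>w. f w / g w) \<midarrow>w\<rightarrow> f w / g w"
        using r(2)[OF that] by (intro tendsto_intros isContD entire_isCont f g)
      then show ?thesis
        using LIM_unique[OF lim] by blast
    qed
    have "l holomorphic_on ball z r"
      by (rule holomorphic_transform[OF h]) (use eq in auto)
    then show ?thesis
      using r(1) by (auto simp: analytic_at intro: exI[of _ "ball z r"])
  qed
  then show l: "l holomorphic_on UNIV"
    using analytic_imp_holomorphic analytic_on_analytic_at by blast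
  have "(\<lambda>w. f w - g w * l w) \<midarrow>z\<rightarrow> f z - g z * l z"
    by (intro tendsto_intros isContD entire_isCont f g l)
  moreover have ev: "eventually (\<lambda>w. f w - g w * l w = 0) (at z)"
    using ncg[of z]
  proof eventually_elim
    case (elim w)
    have "(\<lambda>w. f w / g w) \<midarrow>w\<rightarrow> f w / g w"
      using elim by (intro tendsto_intros isContD entire_isCont f g)
    then have "l w = f w / g w"
      using LIM_unique[OF lim] by blast
    then show ?case using elim by simp
  qed
  ultimately have "f z - g z * l z = 0"
    using LIM_unique[OF tendsto_eventually[OF ev]] by metis
  then show "f z = g z * l z" by simp
qed

text \<open>
  The factorization of \<open>f - f z\<close> at a point, together with the induced one of the derivative; \<open>m\<close> is the
  multiplicity with which \<open>f\<close> takes the value \<open>f z\<close>.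
\<close>
definition local_power_form ::
    "(complex \<Rightarrow> complex) \<Rightarrow> complex \<Rightarrow> nat \<Rightarrow> (complex \<Rightarrow> complex) \<Rightarrow> (complex \<Rightarrow> complex) \<Rightarrow> real \<Rightarrow> bool" where
  "local_power_form f z m g h r \<longleftrightarrow>
     m > 0 \<and> r > 0 \<and> g holomorphic_on ball z r \<and> h holomorphic_on ball z r \<and>
     (\<forall>w\<in>ball z r. f w = f z + (w - z) ^ m * g w \<and> deriv f w = (w - z) ^ (m - 1) * h w \<and>
        g w \<noteq> 0 \<and> h w \<noteq> 0)"

lemma holomorphic_on_ball_isCont:
  assumes "g holomorphic_on ball z r" "r > 0"
  shows "isCont g z"
  using assms by (meson centre_in_ball continuous_on_eq_continuous_at holomorphic_on_imp_continuous_on open_ball)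

lemma local_power_formD:
  assumes "local_power_form f z m g h r"
  shows "m > 0" "r > 0" "g holomorphic_on ball z r" "h holomorphic_on ball z r"
    "\<And>w. w \<in> ball z r \<Longrightarrow> f w = f z + (w - z) ^ m * g w"
    "\<And>w. w \<in> ball z r \<Longrightarrow> deriv f w = (w - z) ^ (m - 1) * h w"
    "\<And>w. w \<in> ball z r \<Longrightarrow> g w \<noteq> 0" "\<And>w. w \<in> ball z r \<Longrightarrow> h w \<noteq> 0"
    "isCont g z" "isCont h z" "g z \<noteq> 0" "h z \<noteq> 0"
    "eventually (\<lambda>w. w \<in> ball z r - {z}) (at z)"
proof -
  show mr: "m > 0" "r > 0" and gh: "g holomorphic_on ball z r" "h holomorphic_on ball z r"
    using assms by (simp_all add: local_power_form_def)
  have ball: "\<forall>w\<in>ball z r. f w = f z + (w - z) ^ m * g w \<and> deriv f w = (w - z) ^ (m - 1) * h w \<and>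
      g w \<noteq> 0 \<and> h w \<noteq> 0"
    using assms unfolding local_power_form_def by blast
  show "f w = f z + (w - z) ^ m * g w" "deriv f w = (w - z) ^ (m - 1) * h w" "g w \<noteq> 0" "h w \<noteq> 0"
    if "w \<in> ball z r" for w
    using bspec[OF ball that] by blast+
  show "isCont g z" "isCont h z"
    using holomorphic_on_ball_isCont[OF gh(1) mr(2)] holomorphic_on_ball_isCont[OF gh(2) mr(2)] .
  show "g z \<noteq> 0" "h z \<noteq> 0" using ball mr(2) by simp_all
  show "eventually (\<lambda>w. w \<in> ball z r - {z}) (at z)" using mr(2) by (intro eventually_at_in_open) auto
qed

lemma entire_local_form:
  fixes f :: "complex \<Rightarrow> complex"
  assumes f: "f holomorphic_on UNIV" and nc: "\<not> f constant_on UNIV"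
  obtains m g h r where "local_power_form f z m g h r"
proof -
  have A: "(\<lambda>w. f w - f z) holomorphic_on UNIV"
    using f by (intro holomorphic_intros)
  have B: "\<not> (\<lambda>w. f w - f z) constant_on UNIV"
    using nc by (auto simp: constant_on_def) (metis diff_add_cancel)
  obtain g r m where m: "0 < m" "0 < r" and g: "g holomorphic_on ball z r"
    "\<And>w. w \<in> ball z r \<Longrightarrow> f w - f z = (w - z)^m * g w" "\<And>w. w \<in> ball z r \<Longrightarrow> g w \<noteq> 0"
    by (rule holomorphic_factor_zero_nonconstant[OF A open_UNIV connected_UNIV UNIV_I[of z] _ B])
      (simp, blast)
  have dg: "(g has_field_derivative deriv g w) (at w)" if "w \<in> ball z r" for w
    using g(1) that by (intro holomorphic_derivI) auto
  define h where "h = (\<lambda>w. of_nat m * g w + (w - z) * deriv g w)"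
  have h: "h holomorphic_on ball z r"
    unfolding h_def by (intro holomorphic_intros g) auto
  have df: "deriv f w = (w - z) ^ (m - 1) * h w" if w: "w \<in> ball z r" for w
  proof -
    have pw: "(w - z) ^ m = (w - z) * (w - z) ^ (m - 1)"
      using m(1) by (cases m) auto
    have "((\<lambda>w. (w - z)^m) has_field_derivative of_nat m * (w - z) ^ (m - 1)) (at w)"
      by (auto intro!: derivative_eq_intros)
    from DERIV_add[OF DERIV_const[of "f z"] DERIV_mult[OF this dg[OF w]]]
    have "((\<lambda>w. f z + (w - z)^m * g w) has_field_derivative (w - z)^(m-1) * h w) (at w)"
      by (simp add: h_def pw algebra_simps)
    then have "(f has_field_derivative (w - z)^(m-1) * h w) (at w)"
      by (rule has_field_derivative_transform_within_open[of _ _ _ "ball z r"]) (use w g(2) in \<open>auto simp: algebra_simps\<close>)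
    then show ?thesis by (rule DERIV_imp_deriv)
  qed
  have hz: "h z = of_nat m * g z" "h z \<noteq> 0"
    using m g(3)[of z] by (auto simp: h_def)
  have "isCont h z" using h m(2) by (rule holomorphic_on_ball_isCont)
  then obtain e where e: "e > 0" "\<And>w. dist z w < e \<Longrightarrow> h w \<noteq> 0"
    using continuous_at_avoid[of z h 0] hz(2) by blast
  have "local_power_form f z m g h (min r e)"
    unfolding local_power_form_def
  proof (intro conjI ballI)
    show "g holomorphic_on ball z (min r e)" "h holomorphic_on ball z (min r e)"
      using g(1) h by (auto elim: holomorphic_on_subset)
    show "f w = f z + (w - z) ^ m * g w" if "w \<in> ball z (min r e)" for w
      using g(2)[of w] that by (simp add: diff_eq_eq add.commute)
  qed (use m e g(3) df in auto)
  then show ?thesis by (rule that)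
qed

text \<open>
  With \<open>j = m - 1\<close> one has \<open>f'' / f' = j / (w - z) + L\<close> with \<open>L\<close> holomorphic, so the Schwarzian has the
  leading term \<open>(- j - j\<^sup>2 / 2) / (w - z)\<^sup>2\<close>. The coefficient vanishes only for \<open>m = 1\<close>: every
  critical point is a double pole.
\<close>
lemma schwarzian_double_pole:
  fixes f g h :: "complex \<Rightarrow> complex"
  assumes "local_power_form f z m g h r"
  shows "(\<lambda>w. (w - z)\<^sup>2 * schwarzian f w) \<midarrow>z\<rightarrow> (1 - of_nat m ^ 2) / 2"
proof -
  note lpf = local_power_formD[OF assms]
  note h = lpf(4) and df = lpf(6) and h0 = lpf(8)
  define j where "j = m - 1"
  define L where "L = (\<lambda>w. deriv h w / h w)"
  have L: "L holomorphic_on ball z r"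
    unfolding L_def by (intro holomorphic_intros h h0) auto
  have cont: "isCont L z" "isCont (deriv L) z"
    using L holomorphic_deriv[OF L] lpf(2) by (auto intro: holomorphic_on_ball_isCont)
  have dd: "deriv (deriv f) w / deriv f w = of_nat j / (w - z) + L w" if w: "w \<in> ball z r - {z}" for w
  proof -
    have dh: "(h has_field_derivative deriv h w) (at w)"
      using h w by (intro holomorphic_derivI) auto
    have pw: "of_nat j * (w - z) ^ (j - Suc 0) = of_nat j / (w - z) * (w - z) ^ j"
      using w by (cases j) auto
    have "((\<lambda>w. (w - z)^j) has_field_derivative of_nat j / (w - z) * (w - z) ^ j) (at w)"
      unfolding pw[symmetric] by (auto intro!: derivative_eq_intros)
    from DERIV_mult[OF this dh]
    have "((\<lambda>w. (w - z)^j * h w) has_field_derivative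
             (of_nat j / (w - z) * (w - z) ^ j * h w + (w - z)^j * deriv h w)) (at w)"
      by (simp add: algebra_simps)
    then have "(deriv f has_field_derivative
             (of_nat j / (w - z) * (w - z) ^ j * h w + (w - z)^j * deriv h w)) (at w)"
      by (rule has_field_derivative_transform_within_open[of _ _ _ "ball z r"]) (use w df in \<open>auto simp: j_def\<close>)
    then have "deriv (deriv f) w = of_nat j / (w - z) * (w - z) ^ j * h w + (w - z)^j * deriv h w"
      by (rule DERIV_imp_deriv)
    moreover have "(n / t * x * a + x * b) / (x * a) = n / t + b / a"
      if "x \<noteq> 0" "a \<noteq> 0" for n t x a b :: complex
      using that by (simp add: add_divide_distrib)
    ultimately show ?thesis
      using w h0[of w] df[of w] by (simp add: L_def j_def)
  qed
  have S: "schwarzian f w = - of_nat j / (w - z)^2 + deriv L w - 1/2 * (of_nat j / (w - z) + L w)^2"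
    if w: "w \<in> ball z r - {z}" for w
  proof -
    have dL: "(L has_field_derivative deriv L w) (at w)"
      using L w by (intro holomorphic_derivI) auto
    have "((\<lambda>w. of_nat j / (w - z) + L w) has_field_derivative - of_nat j / (w - z)^2 + deriv L w) (at w)"
      using w by (auto intro!: derivative_eq_intros dL simp: power2_eq_square)
    then have "((\<lambda>w. deriv (deriv f) w / deriv f w) has_field_derivative - of_nat j / (w - z)^2 + deriv L w) (at w)"
      by (rule has_field_derivative_transform_within_open[of _ _ _ "ball z r - {z}"]) (use w dd in auto)
    then show ?thesis
      unfolding schwarzian_def dd[OF w] by (simp add: DERIV_imp_deriv)
  qed
  have lim: "(\<lambda>w. - of_nat j + (w - z)^2 * deriv L w - 1/2 * (of_nat j + (w - z) * L w)^2) \<midarrow>z\<rightarrow>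
          - of_nat j + (z - z)^2 * deriv L z - 1/2 * (of_nat j + (z - z) * L z)^2"
    by (intro tendsto_intros isContD cont)
  note lpf(13)
  moreover have "- n + t^2 * d - 1/2 * (n + t * l)^2 = t^2 * (- n / t^2 + d - 1/2 * (n / t + l)^2)"
    if "t \<noteq> 0" for n t d l :: complex
    using that by (simp add: field_simps power2_eq_square)
  ultimately have ev: "eventually (\<lambda>w. - of_nat j + (w - z)^2 * deriv L w - 1/2 * (of_nat j + (w - z) * L w)^2
                   = (w - z)\<^sup>2 * schwarzian f w) (at z)"
    by (auto elim!: eventually_mono simp: S)
  have "- of_nat j + (z - z)^2 * deriv L z - 1/2 * (of_nat j + (z - z) * L z)^2 = (1 - of_nat m ^ 2) / (2::complex)"
    using lpf(1) by (simp add: j_def of_nat_diff field_simps power2_eq_square)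
  then show ?thesis
    using Lim_transform_eventually[OF lim ev] by (simp only:)
qed

section \<open>The equation at critical points, and bounds for rational functions\<close>

lemma schwarzian_tendsto:
  assumes f: "f holomorphic_on UNIV" and nz: "deriv f z \<noteq> 0"
  shows "(schwarzian f \<longlongrightarrow> schwarzian f z) (at z)"
proof -
  note h = f entire_deriv[OF f] entire_deriv[OF entire_deriv[OF f]]
    entire_deriv[OF entire_deriv[OF entire_deriv[OF f]]]
  have lim: "(\<lambda>w. deriv (deriv (deriv f)) w / deriv f w - 3 / 2 * (deriv (deriv f) w / deriv f w) ^ 2)
        \<midarrow>z\<rightarrow> schwarzian f z"
    unfolding schwarzian_entire[OF f nz]
    by (intro tendsto_intros isContD entire_isCont h nz)
  have "eventually (\<lambda>w. deriv f w \<noteq> 0) (at z)"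
    using tendsto_imp_eventually_ne[OF isContD[OF entire_isCont[OF h(2)]] nz] .
  then have "eventually (\<lambda>w. deriv (deriv (deriv f)) w / deriv f w
      - 3 / 2 * (deriv (deriv f) w / deriv f w) ^ 2 = schwarzian f w) (at z)"
    by eventually_elim (simp add: schwarzian_entire[OF f])
  with lim show ?thesis
    by (rule Lim_transform_eventually)
qed

text \<open>
  Compares two candidate pole orders of the same function: only one of them can have a nonzero
  finite limit.
\<close>
lemma tendsto_power_mult_compare:
  fixes X :: "complex \<Rightarrow> complex"
  assumes "(\<lambda>w. (w - z) ^ a * X w) \<midarrow>z\<rightarrow> A" "(\<lambda>w. (w - z) ^ b * X w) \<midarrow>z\<rightarrow> B" "a < b"
  shows "B = 0"
proof -
  have "(\<lambda>w. (w - z) ^ (b - a) * ((w - z) ^ a * X w)) \<midarrow>z\<rightarrow> (z - z) ^ (b - a) * A"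
    by (intro tendsto_intros assms)
  moreover have "(\<lambda>w. (w - z) ^ (b - a) * ((w - z) ^ a * X w)) = (\<lambda>w. (w - z) ^ b * X w)"
    using \<open>a < b\<close> by (simp add: mult.assoc[symmetric] power_add[symmetric])
  ultimately have "(\<lambda>w. (w - z) ^ b * X w) \<midarrow>z\<rightarrow> 0"
    using \<open>a < b\<close> by (simp add: power_0_left)
  then show ?thesis
    using assms(2) LIM_unique by blast
qed

locale autonomous_schwarzian =
  fixes p :: nat and P Q :: "complex poly"
  assumes p_pos: "p > 0" and coprime: "coprime P Q" and Q_nz: "Q \<noteq> 0"
begin

definition rhs :: "complex \<Rightarrow> complex" where
  "rhs w = poly P w / poly Q w"

text \<open>
  The sparse exceptional set is expressed locally: at every point the equation holds on a punctured
  neighbourhood.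
\<close>
definition entire_solution :: "(complex \<Rightarrow> complex) \<Rightarrow> bool" where
  "entire_solution f \<longleftrightarrow> f holomorphic_on UNIV \<and> \<not> f constant_on UNIV \<and>
     (\<forall>z. eventually (\<lambda>w. schwarzian f w ^ p = rhs (f w)) (at z))"

lemma no_common_root: "poly Q a = 0 \<Longrightarrow> poly P a \<noteq> 0"
  using coprime by (meson coprime_common_divisor dvd_refl is_unit_poly_iff poly_eq_0_iff_dvd
      dvd_trans coprime_poly_0)

lemma rhs_tendsto:
  assumes "f holomorphic_on UNIV" "poly Q (f z) \<noteq> 0"
  shows "((\<lambda>w. rhs (f w)) \<longlongrightarrow> rhs (f z)) (at z)"
  unfolding rhs_def using assms by (intro tendsto_intros isContD[OF entire_isCont])

text \<open>
  The equation is required off a sparse set only; where both sides are continuous it extends by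
  density.
\<close>
lemma solution_at_regular_point:
  assumes sol: "entire_solution f" and "deriv f z \<noteq> 0" "poly Q (f z) \<noteq> 0"
  shows "schwarzian f z ^ p = rhs (f z)"
proof -
  have f: "f holomorphic_on UNIV" and ev: "eventually (\<lambda>w. schwarzian f w ^ p = rhs (f w)) (at z)"
    using sol by (auto simp: entire_solution_def)
  have "((\<lambda>w. schwarzian f w ^ p) \<longlongrightarrow> schwarzian f z ^ p) (at z)"
    by (intro tendsto_intros schwarzian_tendsto f assms)
  from Lim_transform_eventually[OF this ev] show ?thesis
    using rhs_tendsto[OF f assms(3)] LIM_unique by blast
qed

text \<open>
  The pole of order \<open>2 * p\<close> of \<open>S(f)\<^sup>p\<close> at a critical point has to match the pole of the right-hand side,
  whose order is \<open>m\<close> times the order of the root of \<open>Q\<close>; and a root of \<open>Q\<close> taken with multiplicity one would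
  make the right-hand side infinite where the Schwarzian is finite.
\<close>
lemma ramification:
  assumes sol: "entire_solution f" and lpf: "local_power_form f z m g h r"
  shows "poly Q (f z) = 0 \<Longrightarrow> m \<ge> 2" "m \<ge> 2 \<Longrightarrow> m * order (f z) Q = 2 * p"
proof -
  note l = local_power_formD[OF lpf]
  define q where "q = order (f z) Q"
  obtain Q1 where Q1: "Q = [:- f z, 1:] ^ q * Q1" "\<not> [:- f z, 1:] dvd Q1"
    using order_decomp[OF Q_nz, of "f z"] by (auto simp: q_def)
  have Q1z: "poly Q1 (f z) \<noteq> 0"
    using Q1(2) by (simp add: poly_eq_0_iff_dvd)
  have f: "f holomorphic_on UNIV" and ev: "eventually (\<lambda>w. schwarzian f w ^ p = rhs (f w)) (at z)"
    using sol by (auto simp: entire_solution_def)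
  define A :: complex where "A = ((1 - of_nat m ^ 2) / 2) ^ p"
  have "(\<lambda>w. ((w - z)\<^sup>2 * schwarzian f w) ^ p) \<midarrow>z\<rightarrow> A"
    unfolding A_def by (intro tendsto_power schwarzian_double_pole[OF lpf])
  then have A: "(\<lambda>w. (w - z) ^ (2 * p) * schwarzian f w ^ p) \<midarrow>z\<rightarrow> A"
    by (simp add: power_mult_distrib power_mult)
  define \<kappa> where "\<kappa> = poly P (f z) / (g z ^ q * poly Q1 (f z))"
  have lim: "(\<lambda>w. poly P (f w) / (g w ^ q * poly Q1 (f w))) \<midarrow>z\<rightarrow> \<kappa>"
    unfolding \<kappa>_def using Q1z l(11)
    by (intro tendsto_intros isContD[OF entire_isCont[OF f]] isContD[OF l(9)]) auto
  from ev l(13) have "eventually (\<lambda>w. poly P (f w) / (g w ^ q * poly Q1 (f w)) =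
         (w - z) ^ (m * q) * schwarzian f w ^ p) (at z)"
  proof eventually_elim
    case (elim w)
    have "poly Q (f w) = (w - z) ^ (m * q) * (g w ^ q * poly Q1 (f w))"
      using l(5)[of w] elim by (subst Q1(1)) (simp add: power_mult power_mult_distrib)
    then show ?case
      using elim by (simp add: rhs_def)
  qed
  from Lim_transform_eventually[OF lim this]
  have B: "(\<lambda>w. (w - z) ^ (m * q) * schwarzian f w ^ p) \<midarrow>z\<rightarrow> \<kappa>" .
  have \<kappa>: "\<kappa> \<noteq> 0" if "q > 0"
  proof -
    have "poly Q (f z) = 0"
      using that Q1(1) by (metis order_root q_def neq0_conv)
    then show ?thesis
      using no_common_root Q1z l(11) by (simp add: \<kappa>_def)
  qed
  show "m \<ge> 2" if "poly Q (f z) = 0"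
  proof (rule ccontr)
    assume "\<not> m \<ge> 2"
    then have [simp]: "m = 1" using l(1) by simp
    have "q > 0" using that Q_nz by (simp add: q_def order_root)
    have "deriv f z \<noteq> 0" using l(2,12) l(6)[of z] by simp
    then have "(\<lambda>w. (w - z) ^ 0 * schwarzian f w ^ p) \<midarrow>z\<rightarrow> (z - z) ^ 0 * schwarzian f z ^ p"
      by (intro tendsto_intros schwarzian_tendsto f)
    from tendsto_power_mult_compare[OF this B] \<kappa> \<open>q > 0\<close> show False by simp
  qed
  show "m * order (f z) Q = 2 * p" if "m \<ge> 2"
  proof -
    have "(1 - of_nat m ^ 2 :: complex) \<noteq> 0"
    proof
      assume "(1 - of_nat m ^ 2 :: complex) = 0"
      then have "of_nat (m ^ 2) = (of_nat 1 :: complex)" by simp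
      then have "m ^ 2 = 1" unfolding of_nat_eq_iff .
      then show False using that by simp
    qed
    then have "A \<noteq> 0" by (simp add: A_def)
    have "\<not> 2 * p < m * q"
      using tendsto_power_mult_compare[OF A B] \<kappa> by (cases "q = 0") auto
    moreover have "\<not> m * q < 2 * p"
      using tendsto_power_mult_compare[OF B A] \<open>A \<noteq> 0\<close> by auto
    ultimately show ?thesis by (simp add: q_def)
  qed
qed

end

lemma poly_upper_bound:
  fixes P :: "complex poly"
  obtains C where "C > 0" "\<And>w. norm (poly P w) \<le> C * (1 + norm w) ^ degree P"
proof -
  define C where "C = (\<Sum>i\<le>degree P. norm (coeff P i)) + 1"
  have "norm (poly P w) \<le> C * (1 + norm w) ^ degree P" for w
  proof -
    have "norm (poly P w) \<le> (\<Sum>i\<le>degree P. norm (coeff P i * w ^ i))"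
      unfolding poly_altdef by (rule norm_sum)
    also have "\<dots> \<le> (\<Sum>i\<le>degree P. norm (coeff P i) * (1 + norm w) ^ degree P)"
    proof (rule sum_mono)
      fix i assume "i \<in> {..degree P}"
      then have "norm w ^ i \<le> (1 + norm w) ^ degree P"
        using power_mono[of "norm w" "1 + norm w" i] power_increasing[of i "degree P" "1 + norm w"] by simp
      then show "norm (coeff P i * w ^ i) \<le> norm (coeff P i) * (1 + norm w) ^ degree P"
        by (simp add: norm_mult norm_power mult_left_mono)
    qed
    also have "\<dots> \<le> C * (1 + norm w) ^ degree P"
      by (simp add: C_def sum_distrib_right[symmetric] distrib_right)
    finally show ?thesis .
  qed
  moreover have "C > 0" by (simp add: C_def sum_nonneg add_nonneg_pos)
  ultimately show ?thesis using that by blast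
qed

text \<open>
  Away from its roots a polynomial has at least the growth of its leading term, uniformly: each linear
  factor satisfies \<open>\<bar>w - a\<bar> \<ge> c (1 + \<bar>w\<bar>)\<close> once \<open>\<bar>w - a\<bar> \<ge> \<epsilon>\<close>.
\<close>
lemma poly_lower_bound:
  fixes Q :: "complex poly"
  assumes "Q \<noteq> 0" "\<epsilon> > 0"
  obtains c where "c > 0" "\<And>w. (\<And>a. poly Q a = 0 \<Longrightarrow> \<epsilon> \<le> dist w a) \<Longrightarrow>
     c * (1 + norm w) ^ degree Q \<le> norm (poly Q w)"
proof -
  obtain root where root: "smult (lead_coeff Q) (\<Prod>i<degree Q. [:-root i, 1:]) = Q"
    using complex_poly_decompose' by blast
  define c where "c = norm (lead_coeff Q) * (\<Prod>i<degree Q. 1 / ((1 + norm (root i)) / \<epsilon> + 1))"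
  have pos: "(1 + norm (root i)) / \<epsilon> + 1 > 0" for i
    using \<open>\<epsilon> > 0\<close> by (simp add: add_pos_nonneg)
  have "c > 0"
    unfolding c_def using assms pos by (intro mult_pos_pos prod_pos) auto
  moreover have "c * (1 + norm w) ^ degree Q \<le> norm (poly Q w)"
    if "\<And>a. poly Q a = 0 \<Longrightarrow> \<epsilon> \<le> dist w a" for w
  proof -
    have eq: "poly Q x = lead_coeff Q * (\<Prod>i<degree Q. x - root i)" for x
      by (subst root[symmetric]) (simp add: poly_prod)
    have le: "1 / ((1 + norm (root i)) / \<epsilon> + 1) * (1 + norm w) \<le> norm (w - root i)" if "i < degree Q" for i
    proof -
      have "poly Q (root i) = 0"
        unfolding eq using that by auto
      then have d: "\<epsilon> \<le> norm (w - root i)"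
        using \<open>\<And>a. poly Q a = 0 \<Longrightarrow> \<epsilon> \<le> dist w a\<close> by (simp add: dist_norm)
      then have "1 + norm (root i) \<le> (1 + norm (root i)) / \<epsilon> * norm (w - root i)"
        using \<open>\<epsilon> > 0\<close> mult_left_mono[OF d, of "1 + norm (root i)"] by (simp add: field_simps)
      moreover have "norm w \<le> norm (root i) + norm (w - root i)"
        by (metis add.commute norm_triangle_sub)
      ultimately have "1 + norm w \<le> ((1 + norm (root i)) / \<epsilon> + 1) * norm (w - root i)"
        by (simp add: algebra_simps)
      then show ?thesis
        using pos[of i] by (simp add: divide_le_eq mult.commute)
    qed
    have "c * (1 + norm w) ^ degree Q =
        norm (lead_coeff Q) * (\<Prod>i<degree Q. 1 / ((1 + norm (root i)) / \<epsilon> + 1) * (1 + norm w))"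
      by (simp only: c_def prod.distrib prod_constant card_lessThan mult.assoc)
    also have "\<dots> \<le> norm (lead_coeff Q) * (\<Prod>i<degree Q. norm (w - root i))"
      using pos by (intro mult_left_mono prod_mono conjI le) (auto intro!: mult_nonneg_nonneg simp: less_imp_le)
    also have "\<dots> = norm (poly Q w)"
      by (simp add: eq norm_mult prod_norm)
    finally show ?thesis .
  qed
  ultimately show ?thesis using that by blast
qed

lemma rational_bounded:
  fixes P Q :: "complex poly"
  assumes "Q \<noteq> 0" "degree P \<le> degree Q" "\<epsilon> > 0"
  obtains C where "C > 0" "\<And>w. (\<And>a. poly Q a = 0 \<Longrightarrow> \<epsilon> \<le> dist w a) \<Longrightarrow>
     norm (poly P w / poly Q w) \<le> C"
proof -
  obtain C where C: "C > 0" "\<And>w. norm (poly P w) \<le> C * (1 + norm w) ^ degree P"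
    using poly_upper_bound[of P] by blast
  obtain c where c: "c > 0" "\<And>w. (\<And>a. poly Q a = 0 \<Longrightarrow> \<epsilon> \<le> dist w a) \<Longrightarrow>
     c * (1 + norm w) ^ degree Q \<le> norm (poly Q w)"
    using poly_lower_bound[OF assms(1,3)] by blast
  have "norm (poly P w / poly Q w) \<le> C / c" if "\<And>a. poly Q a = 0 \<Longrightarrow> \<epsilon> \<le> dist w a" for w
  proof -
    have "norm (poly P w) \<le> C * (1 + norm w) ^ degree P" by (rule C)
    also have "\<dots> \<le> C * (1 + norm w) ^ degree Q"
      using C assms by (intro mult_left_mono power_increasing) auto
    finally have "norm (poly P w / poly Q w) \<le> (C * (1 + norm w) ^ degree Q) / (c * (1 + norm w) ^ degree Q)"
      unfolding norm_divide using c that C by (intro frac_le) (auto intro!: mult_pos_pos zero_less_power add_pos_nonneg)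
    also have "1 + norm w \<noteq> 0"
      using norm_ge_zero[of w] by linarith
    then have "(C * (1 + norm w) ^ degree Q) / (c * (1 + norm w) ^ degree Q) = C / c"
      using c(1) by simp
    finally show ?thesis .
  qed
  moreover have "C / c > 0" using C c by simp
  ultimately show ?thesis using that by blast
qed

section \<open>The degree of the numerator\<close>

text \<open>
  By the Schwarz lemma \<open>F (t z)\<close> has modulus at most \<open>t \<bar>F z\<bar>\<close> for \<open>0 < t < 1\<close>; letting \<open>t\<close> tend to one
  bounds the derivative at a maximum point from below. This lower bound for the denominator
  of \<open>f'' / f'\<close> is what makes Cauchy's estimates useful there.
\<close>
lemma radial_derivative_at_max:
  fixes F :: "complex \<Rightarrow> complex"
  assumes F: "F holomorphic_on UNIV" and F0: "F 0 = 0"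
    and max: "\<And>w. norm w \<le> norm z \<Longrightarrow> norm (F w) \<le> norm (F z)"
  shows "norm (F z) \<le> norm z * norm (deriv F z)"
proof -
  define M where "M = norm (F z)"
  have le: "norm (F (of_real t * z)) \<le> t * M" if t: "0 < t" "t < 1" for t
  proof (rule dense_le)
    fix y assume "y < norm (F (of_real t * z))"
    show "y \<le> t * M"
    proof (rule ccontr)
      assume "\<not> y \<le> t * M"
      then have yM: "M < y / t" using t by (simp add: field_simps)
      define M' where "M' = y / t"
      have M': "M' > 0" "M < M'" using yM by (auto simp: M'_def M_def intro: le_less_trans[OF norm_ge_zero])
      define G where "G = (\<lambda>\<zeta>. F (\<zeta> * z) / of_real M')"
      have "G holomorphic_on ball 0 1"
        unfolding G_def using M' by (intro holomorphic_intros holomorphic_on_compose_gen[OF _ F, unfolded o_def]) auto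
      moreover have "G 0 = 0" by (simp add: G_def F0)
      moreover have "norm (G \<zeta>) < 1" if "norm \<zeta> < 1" for \<zeta>
      proof -
        have "norm (F (\<zeta> * z)) \<le> M"
          unfolding M_def using that by (intro max) (simp add: norm_mult mult_left_le_one_le)
        then show ?thesis using M' by (simp add: G_def norm_divide divide_less_eq)
      qed
      ultimately have "norm (G (of_real t)) \<le> norm (of_real t :: complex)"
        using t by (intro Schwarz_Lemma(1)) auto
      then have "norm (F (of_real t * z)) \<le> t * M'"
        using M' t by (simp add: G_def norm_divide divide_le_eq)
      then show False
        using \<open>y < _\<close> t by (simp add: M'_def)
    qed
  qed
  have "((\<lambda>\<zeta>. F (\<zeta> * z)) has_field_derivative deriv F (1 * z) * z) (at 1)"
    by (rule entire_DERIV'[OF F]) (auto intro!: derivative_eq_intros)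
  then have "(\<lambda>\<zeta>. (F (\<zeta> * z) - F z) / (\<zeta> - 1)) \<midarrow>1\<rightarrow> deriv F z * z"
    by (simp add: has_field_derivative_iff)
  moreover have "filterlim complex_of_real (at 1) (at_left 1)"
    by (intro filterlim_atI tendsto_eq_intros) (auto simp: eventually_at_filter)
  ultimately have "((\<lambda>t. (F (of_real t * z) - F z) / (of_real t - 1)) \<longlongrightarrow> deriv F z * z) (at_left 1)"
    by (rule filterlim_compose)
  then have lim: "((\<lambda>t. norm ((F (of_real t * z) - F z) / (of_real t - 1))) \<longlongrightarrow> norm (deriv F z * z)) (at_left 1)"
    by (rule tendsto_norm)
  have "eventually (\<lambda>t. t \<in> {0<..<1}) (at_left (1::real))"
    by (rule eventually_at_left_real) auto
  then have ev: "eventually (\<lambda>t. M \<le> norm ((F (of_real t * z) - F z) / (of_real t - 1))) (at_left (1::real))"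
  proof eventually_elim
    case (elim t)
    have "norm (F z) - norm (F (of_real t * z)) \<le> norm (F (of_real t * z) - F z)"
      by (metis norm_minus_commute norm_triangle_ineq2)
    then have "(1 - t) * M \<le> norm (F (of_real t * z) - F z)"
      using le[of t] elim by (simp add: M_def algebra_simps)
    moreover have "norm (of_real t - 1 :: complex) = 1 - t"
      using elim by (metis (no_types) abs_of_nonneg diff_ge_0_iff_ge greaterThanLessThan_iff less_imp_le
          norm_minus_commute norm_of_real of_real_1 of_real_diff)
    ultimately show ?case
      using elim by (simp add: norm_divide le_divide_eq mult.commute)
  qed
  have "M \<le> norm (deriv F z * z)"
    by (rule tendsto_lowerbound[OF lim ev]) auto
  then show ?thesis by (simp add: M_def norm_mult mult.commute)
qed

text \<open>
  A growth lemma of Borel type. Maximizing \<open>\<bar>F\<bar>\<close> against the weight \<open>s\<^sup>\<kappa>\<close>, where \<open>s\<close> is the distance to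
  the boundary of a large disc (cut off at one), yields a point \<open>z\<close> at which \<open>\<bar>F\<bar>\<close> is maximal on its disc and grows
  by at most the factor \<open>2\<^sup>\<kappa>\<close> up to the distance \<open>s / 2\<close>, where \<open>1 / s\<close> is bounded by an arbitrarily small
  power of \<open>\<bar>F z\<bar>\<close>. Transcendence makes \<open>\<bar>z\<bar>\<close> small as well in comparison with \<open>\<bar>F z\<bar>\<close>.
\<close>
lemma transcendental_slow_growth_point:
  fixes F :: "complex \<Rightarrow> complex" and \<kappa> N :: nat and B :: real
  assumes F: "F holomorphic_on UNIV" and trans: "\<not> (\<exists>q. F = poly q)" and "\<kappa> > 0"
  obtains z s where "0 < s" "s \<le> 1" "B \<le> norm (F z)" "1 \<le> norm (F z)" "1 \<le> s ^ \<kappa> * norm (F z)"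
    "(1 + norm z) ^ N \<le> 3 ^ N * norm (F z)"
    "\<And>w. norm w \<le> norm z \<Longrightarrow> norm (F w) \<le> norm (F z)"
    "\<And>w. dist z w \<le> s / 2 \<Longrightarrow> norm (F w) \<le> 2 ^ \<kappa> * norm (F z)"
proof -
  have "\<exists>z. max 1 B \<le> norm z \<and> norm (F z) > norm z ^ (N + 1)"
  proof (rule ccontr)
    assume "\<not> ?thesis"
    then have "\<And>z. max 1 B \<le> norm z \<Longrightarrow> norm (F z) \<le> 1 * norm z ^ (N + 1)"
      by (auto simp: not_less)
    from Liouville_polynomial[OF F this]
    have "F \<xi> = (\<Sum>k\<le>N + 1. (deriv ^^ k) F 0 / fact k * \<xi> ^ k)" for \<xi> by blast
    then have "F = poly (\<Sum>k\<le>N + 1. monom ((deriv ^^ k) F 0 / fact k) k)"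
      by (simp add: fun_eq_iff poly_sum poly_monom)
    then show False using trans by blast
  qed
  then obtain z0 where z0: "1 \<le> norm z0" "B \<le> norm z0" "norm (F z0) > norm z0 ^ (N + 1)"
    by auto
  define r where "r = norm z0 + 1"
  define s where "s = (\<lambda>z::complex. min 1 (r - norm z))"
  define W where "W = (\<lambda>z. s z ^ \<kappa> * norm (F z))"
  have "continuous_on (cball 0 r) W"
    unfolding W_def s_def using F
    by (intro continuous_intros holomorphic_on_imp_continuous_on) (auto intro: holomorphic_on_subset)
  moreover have "cball 0 r \<noteq> ({} :: complex set)"
    by (simp add: r_def add_nonneg_nonneg not_less)
  ultimately obtain z where z: "z \<in> cball 0 r" "\<And>w. w \<in> cball 0 r \<Longrightarrow> W w \<le> W z"
    using continuous_attains_sup[OF compact_cball] by metis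
  have s0: "0 \<le> s w" "s w \<le> 1" if "w \<in> cball 0 r" for w
    using that by (auto simp: s_def)
  have Wz0: "W z0 = norm (F z0)"
    by (simp add: W_def s_def r_def)
  have W1: "norm (F z0) \<le> W z"
    using z(2)[of z0] by (simp add: Wz0) (simp add: r_def)
  have big: "norm z0 ^ N \<le> norm (F z0)" "norm z0 \<le> norm (F z0)" "1 \<le> norm (F z0)"
  proof -
    have "norm z0 ^ N \<le> norm z0 ^ (N + 1)" "norm z0 ^ 1 \<le> norm z0 ^ (N + 1)"
      by (intro power_increasing; use z0 in simp)+
    then show "norm z0 ^ N \<le> norm (F z0)" "norm z0 \<le> norm (F z0)" "1 \<le> norm (F z0)"
      using z0 by auto
  qed
  have spos: "0 < s z"
  proof (rule ccontr)
    assume "\<not> 0 < s z"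
    then have "s z = 0" using s0(1)[OF z(1)] by simp
    then have "W z = 0" using \<open>\<kappa> > 0\<close> by (simp add: W_def)
    then show False using W1 big by simp
  qed
  have Wz: "W z \<le> norm (F z)"
    unfolding W_def using s0[OF z(1)] by (simp add: mult_left_le_one_le power_le_one)
  have le_if: "norm (F w) \<le> c ^ \<kappa> * norm (F z)" if "w \<in> cball 0 r" "s z \<le> c * s w" "c > 0" for w c
  proof -
    have sw: "s w > 0" using that spos by (metis le_less_trans less_le_trans mult_pos_pos not_le zero_less_mult_pos)
    have "s w ^ \<kappa> * norm (F w) \<le> s z ^ \<kappa> * norm (F z)"
      using z(2)[OF that(1)] by (simp add: W_def)
    also have "\<dots> \<le> (c * s w) ^ \<kappa> * norm (F z)"
      using that spos by (intro mult_right_mono power_mono) auto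
    also have "\<dots> = s w ^ \<kappa> * (c ^ \<kappa> * norm (F z))"
      by (simp add: power_mult_distrib mult_ac)
    finally show ?thesis using sw by simp
  qed
  show ?thesis
  proof (rule that[of "s z" z])
    \<comment> \<open>The weight at \<open>z0\<close> is one, so the weighted maximum is at least \<open>\<bar>F z0\<bar>\<close>.\<close>
    show "B \<le> norm (F z)" "1 \<le> norm (F z)" "1 \<le> s z ^ \<kappa> * norm (F z)"
      using W1 Wz big z0(2) by (auto simp: W_def)
    have "(1 + norm z) ^ N \<le> (3 * norm z0) ^ N"
      using z(1) z0(1) by (intro power_mono) (auto simp: r_def)
    also have "\<dots> \<le> 3 ^ N * norm (F z)"
      using W1 Wz big by (simp add: power_mult_distrib)
    finally show "(1 + norm z) ^ N \<le> 3 ^ N * norm (F z)" .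
    show "norm (F w) \<le> norm (F z)" if "norm w \<le> norm z" for w
      using le_if[of w 1] that z(1) by (simp add: s_def)
    show "norm (F w) \<le> 2 ^ \<kappa> * norm (F z)" if "dist z w \<le> s z / 2" for w
    proof (rule le_if)
      have "norm w \<le> norm z + s z / 2"
        using that norm_triangle_sub[of w z] by (simp add: dist_norm norm_minus_commute)
      moreover have "s z \<le> r - norm z" "s z \<le> 1" by (simp_all add: s_def)
      ultimately have "s z / 2 \<le> r - norm w" "s z / 2 \<le> 1" using spos by linarith+
      then show "w \<in> cball 0 r" "s z \<le> 2 * s w"
        using spos fun_cong[OF s_def, of w] by (simp_all add: min_def)
    qed auto
  qed (use spos s0 z in auto)
qed

context autonomous_schwarzian
begin

lemma rhs_lower_bound:
  assumes "degree Q < degree P"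
  obtains c K where "c > 0" "\<And>w. K \<le> norm w \<Longrightarrow> poly Q w \<noteq> 0 \<and> c * norm w \<le> norm (rhs w)"
proof -
  have P: "P \<noteq> 0" using assms by auto
  obtain C where C: "C > 0" "\<And>w. norm (poly Q w) \<le> C * (1 + norm w) ^ degree Q"
    using poly_upper_bound[of Q] by blast
  obtain c where c: "c > 0" "\<And>w. (\<And>a. poly P a = 0 \<Longrightarrow> 1 \<le> dist w a) \<Longrightarrow>
     c * (1 + norm w) ^ degree P \<le> norm (poly P w)"
    using poly_lower_bound[OF P, of 1] by auto
  have "finite ({a. poly P a = 0} \<union> {a. poly Q a = 0})"
    using poly_roots_finite P Q_nz by blast
  then obtain K where K: "\<And>a. poly P a = 0 \<or> poly Q a = 0 \<Longrightarrow> norm a \<le> K"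
    using finite_imp_bounded bounded_iff by (metis (mono_tags, lifting) UnI1 UnI2 mem_Collect_eq)
  have "poly Q w \<noteq> 0 \<and> c / C * norm w \<le> norm (rhs w)" if w: "K + 1 \<le> norm w" for w
  proof -
    have Qw: "poly Q w \<noteq> 0" using K[of w] w by auto
    have "1 \<le> dist w a" if "poly P a = 0" for a
      using K[of a] that w norm_triangle_ineq2[of w a] by (simp add: dist_norm)
    then have "c * (1 + norm w) ^ degree P \<le> norm (poly P w)" by (rule c)
    moreover have "(1 + norm w) ^ (degree Q + 1) \<le> (1 + norm w) ^ degree P"
      using assms by (intro power_increasing) auto
    then have "c * (1 + norm w) ^ (degree Q + 1) \<le> c * (1 + norm w) ^ degree P"
      using c by (intro mult_left_mono) auto
    ultimately have "c * (1 + norm w) ^ (degree Q + 1) \<le> norm (poly P w)" by linarith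
    then have "(c * (1 + norm w) ^ (degree Q + 1)) / (C * (1 + norm w) ^ degree Q)
        \<le> norm (poly P w) / norm (poly Q w)"
      using C Qw c by (intro frac_le) auto
    also have "(c * (1 + norm w) ^ (degree Q + 1)) / (C * (1 + norm w) ^ degree Q) = c / C * (1 + norm w)"
    proof -
      have "1 + norm w \<noteq> 0" using norm_ge_zero[of w] by linarith
      then show ?thesis using C by simp
    qed
    finally have "c / C * (1 + norm w) \<le> norm (rhs w)"
      by (simp add: rhs_def norm_divide)
    moreover have "c / C * norm w \<le> c / C * (1 + norm w)"
      using c C by (intro mult_left_mono) auto
    ultimately show ?thesis using Qw by linarith
  qed
  moreover have "c / C > 0" using c C by simp
  ultimately show ?thesis using that by blast
qed

text \<open>
  This replaces the lemma on the logarithmic derivative. At a point of slow growth Cauchy's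
  estimates bound \<open>S(f)\<^sup>p\<close> by a small power of \<open>\<bar>f z\<bar>\<close>, whereas the right-hand side would be at least
  a constant multiple of \<open>\<bar>f z\<bar>\<close> if the numerator had the larger degree. The exponents \<open>\<kappa> = 16 p\<close> and \<open>8 p\<close> are chosen
  so that the fourth power of this bound is a multiple of \<open>\<bar>f z\<bar>\<^sup>2\<close>.
\<close>
theorem degree_le:
  assumes sol: "entire_solution f" and trans: "\<not> (\<exists>q. f = poly q)"
  shows "degree P \<le> degree Q"
proof (rule ccontr)
  assume "\<not> degree P \<le> degree Q"
  then have "degree Q < degree P" by simp
  then obtain c K where c: "c > 0" and K: "\<And>w. K \<le> norm w \<Longrightarrow> poly Q w \<noteq> 0 \<and> c * norm w \<le> norm (rhs w)"
    using rhs_lower_bound by blast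
  have f: "f holomorphic_on UNIV" using sol by (simp add: entire_solution_def)
  define F where "F = (\<lambda>z. f z - f 0)"
  have F: "F holomorphic_on UNIV" "F 0 = 0"
    unfolding F_def by (intro holomorphic_intros f) simp
  have dF: "deriv F = deriv f"
    unfolding F_def using entire_DERIV[OF f] by (auto intro!: ext DERIV_imp_deriv derivative_eq_intros)
  have transF: "\<not> (\<exists>q. F = poly q)"
  proof
    assume "\<exists>q. F = poly q"
    then obtain q where "F = poly q" by blast
    have "f z = poly (q + [:f 0:]) z" for z
      using fun_cong[OF \<open>F = poly q\<close>, of z] unfolding F_def poly_add by (simp add: diff_eq_eq)
    then have "f = poly (q + [:f 0:])" by (rule ext)
    then show False using trans by blast
  qed
  define \<kappa> where "\<kappa> = 16 * p"
  have "\<kappa> > 0" using p_pos by (simp add: \<kappa>_def)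
  \<comment> \<open>\<open>E * (r\<^sup>2 / s ^ 4)\<close> will bound the Schwarzian at \<open>z\<close>; \<open>B\<close> is the size of \<open>F z\<close> that contradicts this bound.\<close>
  define E where "E = (144 * (2 ^ \<kappa>)\<^sup>2 :: real)"
  define B where "B = norm (f 0) * 2 + \<bar>K\<bar> * 2 + (2 / c) ^ 4 * E ^ (4 * p) * 3 ^ (8 * p) + 1"
  obtain z s where zs: "0 < s" "s \<le> 1" "B \<le> norm (F z)" "1 \<le> norm (F z)" "1 \<le> s ^ \<kappa> * norm (F z)"
    "(1 + norm z) ^ (8 * p) \<le> 3 ^ (8 * p) * norm (F z)"
    "\<And>w. norm w \<le> norm z \<Longrightarrow> norm (F w) \<le> norm (F z)"
    "\<And>w. dist z w \<le> s / 2 \<Longrightarrow> norm (F w) \<le> 2 ^ \<kappa> * norm (F z)"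
    by (rule transcendental_slow_growth_point[OF F(1) transF \<open>\<kappa> > 0\<close>, where B = B and N = "8 * p"])
      (rule that; assumption)
  define M where "M = norm (F z)"
  define r where "r = 1 + norm z"
  have M1: "M \<ge> 1" and r1: "r \<ge> 1" using zs by (auto simp: M_def r_def)
  have "M \<le> norm z * norm (deriv f z)"
    using radial_derivative_at_max[OF F zs(7)] by (simp add: M_def dF)
  also have "\<dots> \<le> r * norm (deriv f z)"
    by (intro mult_right_mono) (auto simp: r_def)
  finally have d1: "M \<le> r * norm (deriv f z)" .
  then have nz: "deriv f z \<noteq> 0" using M1 by auto
  have cauchy: "norm ((deriv ^^ n) F z) \<le> fact n * (2 ^ \<kappa> * M) / (s / 2) ^ n" for n
    using zs(1) by (intro Cauchy_inequality holomorphic_on_imp_continuous_on holomorphic_on_subset[OF F(1)])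
      (auto simp: M_def dist_norm intro!: zs(8))
  have quot: "norm ((deriv ^^ n) F z) / norm (deriv f z) \<le> fact n * 2 ^ \<kappa> * 2 ^ n * (r / s ^ n)" for n
  proof -
    have "norm ((deriv ^^ n) F z) / norm (deriv f z) \<le> (fact n * (2 ^ \<kappa> * M) / (s / 2) ^ n) / (M / r)"
      using nz d1 M1 r1 zs(1) by (intro frac_le cauchy) (auto simp: divide_le_eq mult.commute)
    also have "\<dots> = fact n * 2 ^ \<kappa> * 2 ^ n * (r / s ^ n)"
      using M1 r1 zs(1) by (simp add: field_simps power_divide)
    finally show ?thesis .
  qed
  have q2: "norm (deriv (deriv f) z / deriv f z) \<le> 8 * 2 ^ \<kappa> * (r / s ^ 2)"
    using quot[of 2] by (simp add: norm_divide eval_nat_numeral dF)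
  have q3: "norm (deriv (deriv (deriv f)) z / deriv f z) \<le> 48 * 2 ^ \<kappa> * (r / s ^ 3)"
    using quot[of 3] by (simp add: norm_divide eval_nat_numeral dF)
  have "norm (schwarzian f z) \<le> 48 * 2 ^ \<kappa> * (r / s ^ 3) + 3 / 2 * (8 * 2 ^ \<kappa> * (r / s ^ 2))\<^sup>2"
  proof -
    have "norm (schwarzian f z) \<le> norm (deriv (deriv (deriv f)) z / deriv f z)
       + 3 / 2 * (norm (deriv (deriv f) z / deriv f z))\<^sup>2"
      unfolding schwarzian_entire[OF f nz]
      by (rule order_trans[OF norm_triangle_ineq4]) (simp add: norm_mult norm_power)
    also have "\<dots> \<le> 48 * 2 ^ \<kappa> * (r / s ^ 3) + 3 / 2 * (8 * 2 ^ \<kappa> * (r / s ^ 2))\<^sup>2"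
      by (intro add_mono q3 mult_left_mono power_mono q2) auto
    finally show ?thesis .
  qed
  also have "\<dots> \<le> 48 * (2 ^ \<kappa>)\<^sup>2 * (r\<^sup>2 / s ^ 4) + 96 * (2 ^ \<kappa>)\<^sup>2 * (r\<^sup>2 / s ^ 4)"
  proof (rule add_mono)
    have "r / s ^ 3 \<le> r\<^sup>2 / s ^ 4"
    proof (rule frac_le)
      show "r \<le> r\<^sup>2" using r1 by (simp add: power2_eq_square)
      show "s ^ 4 \<le> s ^ 3" using zs(1,2) by (intro power_decreasing) auto
    qed (use r1 zs in auto)
    moreover have "(2 ^ \<kappa> :: real) \<le> (2 ^ \<kappa>)\<^sup>2"
      by (simp add: power2_eq_square)
    ultimately show "48 * 2 ^ \<kappa> * (r / s ^ 3) \<le> 48 * (2 ^ \<kappa>)\<^sup>2 * (r\<^sup>2 / s ^ 4)"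
      using r1 zs(1) by (intro mult_mono) auto
    show "3 / 2 * (8 * 2 ^ \<kappa> * (r / s ^ 2))\<^sup>2 \<le> 96 * (2 ^ \<kappa>)\<^sup>2 * (r\<^sup>2 / s ^ 4)"
      by (simp add: power_mult_distrib power_divide mult_ac)
  qed
  also have "\<dots> = E * (r\<^sup>2 / s ^ 4)"
    by (simp add: E_def)
  finally have S: "norm (schwarzian f z) \<le> E * (r\<^sup>2 / s ^ 4)" .
  have fz: "M / 2 \<le> norm (f z)" "K \<le> norm (f z)"
  proof -
    have "B \<ge> norm (f 0) * 2 + \<bar>K\<bar> * 2"
      unfolding B_def E_def using c by simp
    moreover have "M \<le> norm (f z) + norm (f 0)"
      unfolding M_def F_def by (rule norm_triangle_ineq4)
    ultimately show "M / 2 \<le> norm (f z)" "K \<le> norm (f z)"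
      using zs(3) norm_ge_zero[of "f 0"] unfolding M_def by linarith+
  qed
  have "c / 2 * M \<le> norm (rhs (f z))"
  proof -
    have "c * (M / 2) \<le> c * norm (f z)" using fz(1) c by (intro mult_left_mono) auto
    then show ?thesis using K[OF fz(2)] by simp
  qed
  also have "\<dots> = norm (schwarzian f z) ^ p"
    using solution_at_regular_point[OF sol nz] K[OF fz(2)] by (simp flip: norm_power)
  also have "\<dots> \<le> (E * (r\<^sup>2 / s ^ 4)) ^ p"
    by (intro power_mono S) auto
  finally have "(c / 2 * M) ^ 4 \<le> ((E * (r\<^sup>2 / s ^ 4)) ^ p) ^ 4"
    using c M1 by (intro power_mono) auto
  also have "\<dots> = E ^ (4 * p) * r ^ (8 * p) * (1 / s ^ \<kappa>)"
    by (simp add: power_mult_distrib power_divide \<kappa>_def flip: power_mult) (simp add: mult_ac)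
  also have "\<dots> \<le> E ^ (4 * p) * (3 ^ (8 * p) * M) * M"
  proof (intro mult_mono)
    show "r ^ (8 * p) \<le> 3 ^ (8 * p) * M" using zs(6) by (simp add: r_def M_def)
    show "1 / s ^ \<kappa> \<le> M" using zs(1,5) by (simp add: M_def divide_le_eq mult.commute)
  qed (use M1 r1 zs(1) in \<open>auto simp: E_def\<close>)
  finally have "(c / 2) ^ 4 * M ^ 4 \<le> E ^ (4 * p) * 3 ^ (8 * p) * M ^ 2"
    by (simp add: power_mult_distrib power_divide power2_eq_square mult_ac)
  also have "(c / 2) ^ 4 * M ^ 4 = (c / 2) ^ 4 * M ^ 2 * M ^ 2"
    using power_add[of M 2 2] by (simp only: mult.assoc) simp
  finally have "(c / 2) ^ 4 * M ^ 2 * M ^ 2 \<le> E ^ (4 * p) * 3 ^ (8 * p) * M ^ 2" .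
  then have "(c / 2) ^ 4 * M ^ 2 \<le> E ^ (4 * p) * 3 ^ (8 * p)"
    using M1 by (simp add: mult_le_cancel_right_pos)
  then have "M ^ 2 \<le> (2 / c) ^ 4 * E ^ (4 * p) * 3 ^ (8 * p)"
    using c by (simp add: power_divide field_simps)
  also have "\<dots> < B"
    unfolding B_def using norm_ge_zero[of "f 0"] abs_ge_zero[of K] by linarith
  also have "\<dots> \<le> M" using zs(3) by (simp add: M_def)
  also have "M \<le> M ^ 2" using M1 by (simp add: power2_eq_square)
  finally show False by simp
qed

end

section \<open>Rescaling, and functions with quadratic first-order equations\<close>

text \<open>
  The point selection behind rescaling (Zalcman, Hofer): around \<open>z0\<close> the function \<open>\<mu>\<close> at most doubles on
  a disc whose radius is large in the unit \<open>1 / \<mu> z0\<close>. One maximizes \<open>(1 - dist z1 z) * \<mu> z\<close> over the unit disc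
  around \<open>z1\<close>.
\<close>
lemma doubling_point:
  fixes \<mu> :: "complex \<Rightarrow> real"
  assumes cont: "continuous_on UNIV \<mu>" and nonneg: "\<And>z. \<mu> z \<ge> 0" and "V > 0" "V \<le> \<mu> z1"
  obtains z0 where "V \<le> \<mu> z0" "\<And>z. dist z0 z \<le> V / (2 * \<mu> z0) \<Longrightarrow> \<mu> z \<le> 2 * \<mu> z0"
proof -
  define W where "W = (\<lambda>z. (1 - dist z1 z) * \<mu> z)"
  have "continuous_on (cball z1 1) W"
    unfolding W_def by (intro continuous_intros continuous_on_subset[OF cont]) auto
  then obtain z0 where z0: "z0 \<in> cball z1 1" "\<And>w. w \<in> cball z1 1 \<Longrightarrow> W w \<le> W z0"
    using continuous_attains_sup[OF compact_cball, of z1 1 W] by auto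
  define s where "s = 1 - dist z1 z0"
  have W: "V \<le> s * \<mu> z0"
    using z0(2)[of z1] assms by (simp add: W_def s_def)
  have s: "0 < s" "s \<le> 1"
    using W \<open>V > 0\<close> z0(1) nonneg[of z0] by (auto simp: s_def not_less intro: ccontr)
  have V: "V \<le> \<mu> z0"
    using W mult_left_le_one_le[of "\<mu> z0" s] s nonneg[of z0] by linarith
  have "\<mu> z \<le> 2 * \<mu> z0" if "dist z0 z \<le> V / (2 * \<mu> z0)" for z
  proof -
    have "V / (2 * \<mu> z0) \<le> s / 2"
      using W V \<open>V > 0\<close> by (simp add: divide_le_eq field_simps)
    then have d: "dist z1 z \<le> 1 - s / 2"
      using order_trans[OF that \<open>V / (2 * \<mu> z0) \<le> s / 2\<close>] dist_triangle[of z1 z z0]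
      unfolding s_def by argo
    then have "s / 2 * \<mu> z \<le> W z"
      unfolding W_def by (intro mult_right_mono nonneg) auto
    also have "\<dots> \<le> s * \<mu> z0"
      using z0(2)[of z] d s by (simp add: W_def s_def)
    finally show ?thesis using s by simp
  qed
  with V show ?thesis using that by blast
qed

lemma deriv_rescale:
  assumes "f holomorphic_on UNIV"
  shows "deriv (\<lambda>\<zeta>. c * f (z0 + \<rho> * \<zeta>)) = (\<lambda>\<zeta>. (c * \<rho>) * deriv f (z0 + \<rho> * \<zeta>))"
proof
  fix \<zeta>
  have "((\<lambda>\<zeta>. f (z0 + \<rho> * \<zeta>)) has_field_derivative deriv f (z0 + \<rho> * \<zeta>) * \<rho>) (at \<zeta>)"
    by (rule entire_DERIV'[OF assms]) (auto intro!: derivative_eq_intros)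
  from DERIV_cmult[OF this, of c]
  show "deriv (\<lambda>\<zeta>. c * f (z0 + \<rho> * \<zeta>)) \<zeta> = (c * \<rho>) * deriv f (z0 + \<rho> * \<zeta>)"
    by (simp add: DERIV_imp_deriv mult_ac)
qed

lemma entire_rescale:
  assumes "f holomorphic_on UNIV"
  shows "(\<lambda>\<zeta>. c * f (z0 + \<rho> * \<zeta>)) holomorphic_on UNIV"
  by (intro holomorphic_intros holomorphic_on_compose_gen[OF _ assms, unfolded o_def]) auto

lemma schwarzian_rescale:
  assumes f: "f holomorphic_on UNIV" and nz: "deriv f (z0 + \<rho> * \<zeta>) \<noteq> 0" and "\<rho> \<noteq> 0"
  shows "schwarzian (\<lambda>\<zeta>. f (z0 + \<rho> * \<zeta>)) \<zeta> = \<rho>\<^sup>2 * schwarzian f (z0 + \<rho> * \<zeta>)"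
proof -
  note d = deriv_rescale[OF f, of 1, simplified] deriv_rescale[OF entire_deriv[OF f]]
    deriv_rescale[OF entire_deriv[OF entire_deriv[OF f]]]
  show ?thesis
    using assms entire_rescale[OF f, of 1 z0 \<rho>]
    by (simp add: schwarzian_entire d power2_eq_square) (simp add: algebra_simps)
qed

text \<open>
  Differentiate the equation, multiply by \<open>G\<close> and cancel \<open>f'\<close>, which does not vanish identically.
\<close>
lemma quadratic_second_derivative:
  fixes f G :: "complex \<Rightarrow> complex"
  assumes f: "f holomorphic_on UNIV" and G: "G holomorphic_on UNIV" and nc: "\<not> f constant_on UNIV"
    and eq: "\<And>z. (deriv f z)\<^sup>2 = G z * ((f z - a) * (f z - b))"
  shows "2 * G z * deriv (deriv f) z = deriv G z * deriv f z + (G z)\<^sup>2 * (2 * f z - a - b)"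
proof -
  note Df = entire_DERIV[OF f] and Df' = entire_DERIV[OF entire_deriv[OF f]] and DG = entire_DERIV[OF G]
  have d2: "2 * deriv f w * deriv (deriv f) w =
      deriv G w * ((f w - a) * (f w - b)) + G w * (2 * f w - a - b) * deriv f w" for w
  proof -
    have "((\<lambda>z. (deriv f z)\<^sup>2) has_field_derivative 2 * deriv f w * deriv (deriv f) w) (at w)"
      by (auto intro!: derivative_eq_intros Df' simp: mult_ac)
    moreover have "((\<lambda>z. G z * ((f z - a) * (f z - b))) has_field_derivative
      (deriv G w * ((f w - a) * (f w - b)) + G w * (2 * f w - a - b) * deriv f w)) (at w)"
      by (auto intro!: derivative_eq_intros Df DG simp: algebra_simps)
    ultimately show ?thesis
      unfolding eq using DERIV_unique by blast
  qed
  obtain z1 where z1: "deriv f z1 \<noteq> 0" using entire_deriv_nonzero[OF f nc] .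
  have "(2 * G w * deriv (deriv f) w - (deriv G w * deriv f w + (G w)\<^sup>2 * (2 * f w - a - b))) * deriv f w = 0" for w
  proof -
    have "G w * (2 * deriv f w * deriv (deriv f) w) =
        deriv G w * (deriv f w)\<^sup>2 + (G w)\<^sup>2 * (2 * f w - a - b) * deriv f w"
      unfolding d2 eq by (simp add: algebra_simps power2_eq_square)
    then show ?thesis by (simp add: algebra_simps power2_eq_square)
  qed
  note zero = this
  have hol: "(\<lambda>w. 2 * G w * deriv (deriv f) w - (deriv G w * deriv f w + (G w)\<^sup>2 * (2 * f w - a - b)))
      holomorphic_on UNIV"
    by (intro holomorphic_intros f G entire_deriv)
  have "2 * G z * deriv (deriv f) z - (deriv G z * deriv f z + (G z)\<^sup>2 * (2 * f z - a - b)) = 0"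
    by (rule entire_mult_eq_0_cancel[OF hol entire_deriv[OF f] zero z1])
  then show ?thesis by simp
qed

text \<open>
  The Schwarzian expressed by \<open>f\<close> and \<open>G\<close> alone. When \<open>G\<close> is nearly constant the last bracket is negligible and
  the Schwarzian is nearly a function of \<open>f z\<close>; when \<open>G\<close> is constant it is exactly one.
\<close>
lemma quadratic_schwarzian:
  fixes f G :: "complex \<Rightarrow> complex"
  assumes f: "f holomorphic_on UNIV" and G: "G holomorphic_on UNIV" and nc: "\<not> f constant_on UNIV"
    and eq: "\<And>z. (deriv f z)\<^sup>2 = G z * ((f z - a) * (f z - b))" and nz: "deriv f z \<noteq> 0"
  shows "schwarzian f z = - (G z / 2) * (1 + 3 * (a - b)\<^sup>2 / (4 * ((f z - a) * (f z - b))))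
           + (deriv (deriv G) z / (2 * G z) - 5 / 8 * (deriv G z / G z)\<^sup>2)"
proof -
  note Df = entire_DERIV[OF f] and DG = entire_DERIV[OF G]
    and Df' = entire_DERIV[OF entire_deriv[OF f]] and DG' = entire_DERIV[OF entire_deriv[OF G]]
    and Df'' = entire_DERIV[OF entire_deriv[OF entire_deriv[OF f]]]
  note e2 = quadratic_second_derivative[OF f G nc eq]
  define x where "x = deriv f z"
  define u where "u = 2 * f z - a - b"
  define q where "q = (f z - a) * (f z - b)"
  define t where "t = u / x"
  have "((\<lambda>z. 2 * G z * deriv (deriv f) z) has_field_derivative
      2 * deriv G z * deriv (deriv f) z + 2 * G z * deriv (deriv (deriv f)) z) (at z)"
    by (auto intro!: derivative_eq_intros DG Df'' simp: algebra_simps)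
  moreover have "((\<lambda>z. deriv G z * deriv f z + (G z)\<^sup>2 * (2 * f z - a - b)) has_field_derivative
      deriv (deriv G) z * x + deriv G z * deriv (deriv f) z + 2 * G z * deriv G z * u
      + 2 * (G z)\<^sup>2 * x) (at z)"
    unfolding x_def u_def
    by (auto intro!: derivative_eq_intros DG DG' Df Df' simp: algebra_simps power2_eq_square)
  ultimately have e3: "2 * deriv G z * deriv (deriv f) z + 2 * G z * deriv (deriv (deriv f)) z =
      deriv (deriv G) z * x + deriv G z * deriv (deriv f) z + 2 * G z * deriv G z * u + 2 * (G z)\<^sup>2 * x"
    unfolding e2 using DERIV_unique by blast
  have x0: "x \<noteq> 0" using nz by (simp add: x_def)
  have xq: "x\<^sup>2 = G z * q" using eq[of z] by (simp add: x_def q_def)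
  have nz': "G z \<noteq> 0" "q \<noteq> 0" using x0 xq by auto
  have u2: "u\<^sup>2 = 4 * q + (a - b)\<^sup>2"
    by (simp add: u_def q_def power2_eq_square algebra_simps)
  have A: "deriv (deriv f) z / x = deriv G z / (2 * G z) + G z / 2 * t"
    using e2[of z] nz' x0 unfolding t_def x_def[symmetric] u_def[symmetric]
    by (simp add: field_simps power2_eq_square)
  have B0: "2 * G z * deriv (deriv (deriv f)) z =
      deriv (deriv G) z * x - deriv G z * deriv (deriv f) z + 2 * G z * deriv G z * u + 2 * (G z)\<^sup>2 * x"
    using e3 by (simp add: algebra_simps)
  have "deriv (deriv (deriv f)) z / x = (2 * G z * deriv (deriv (deriv f)) z) / (2 * G z * x)"
    using nz' x0 by simp
  also have "\<dots> = deriv (deriv G) z / (2 * G z) - deriv G z / (2 * G z) * (deriv (deriv f) z / x)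
      + deriv G z * t + G z"
    unfolding B0 t_def using nz' x0 by (simp add: add_divide_distrib diff_divide_distrib power2_eq_square)
  finally have B: "deriv (deriv (deriv f)) z / x = deriv (deriv G) z / (2 * G z)
      - deriv G z / (2 * G z) * (deriv (deriv f) z / x) + deriv G z * t + G z" .
  have t2: "(G z)\<^sup>2 * t\<^sup>2 = G z * (4 + (a - b)\<^sup>2 / q)"
    unfolding t_def power_divide u2 xq using nz' by (simp add: field_simps power2_eq_square)
  have "schwarzian f z = deriv (deriv G) z / (2 * G z) - 5 / 8 * (deriv G z / G z)\<^sup>2 + G z - 3 / 8 * ((G z)\<^sup>2 * t\<^sup>2)"
    unfolding schwarzian_entire[OF f nz] x_def[symmetric] B A using nz'
    by (simp add: power2_eq_square algebra_simps)
  also have "\<dots> = - (G z / 2) * (1 + 3 * (a - b)\<^sup>2 / (4 * q))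
           + (deriv (deriv G) z / (2 * G z) - 5 / 8 * (deriv G z / G z)\<^sup>2)"
    unfolding t2 using nz' by (simp add: field_simps)
  finally show ?thesis by (simp add: q_def)
qed

context autonomous_schwarzian
begin

lemma ramified_quotient_tendsto:
  assumes sol: "entire_solution f" and a: "poly Q a = 0" and "a \<noteq> b" "f z = a"
  shows "\<exists>l. (\<lambda>w. (deriv f w)\<^sup>2 / ((f w - a) * (f w - b))) \<midarrow>z\<rightarrow> l"
proof -
  have f: "f holomorphic_on UNIV" "\<not> f constant_on UNIV" using sol by (auto simp: entire_solution_def)
  obtain m g h r where lpf: "local_power_form f z m g h r" using entire_local_form[OF f] .
  note loc = local_power_formD[OF lpf]
  have m2: "m \<ge> 2"
    using ramification(1)[OF sol lpf] a \<open>f z = a\<close> by simp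
  have lim: "(\<lambda>w. (w - z) ^ (m - 2) * (h w)\<^sup>2 / (g w * (f w - b))) \<midarrow>z\<rightarrow>
      (z - z) ^ (m - 2) * (h z)\<^sup>2 / (g z * (f z - b))"
    using loc(11) assms by (intro tendsto_intros isContD loc(9,10) isContD[OF entire_isCont[OF f(1)]]) auto
  from loc(13) have "eventually (\<lambda>w. (w - z) ^ (m - 2) * (h w)\<^sup>2 / (g w * (f w - b)) =
      (deriv f w)\<^sup>2 / ((f w - a) * (f w - b))) (at z)"
  proof eventually_elim
    case (elim w)
    have e1: "(deriv f w)\<^sup>2 = (w - z) ^ m * ((w - z) ^ (m - 2) * (h w)\<^sup>2)"
    proof -
      obtain k where "m = k + 2" using m2 by (metis le_add_diff_inverse2)
      then have "(x ^ (m - 1) * y)\<^sup>2 = x ^ m * (x ^ (m - 2) * y\<^sup>2)" for x y :: complex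
        by (simp add: power2_eq_square power_add algebra_simps)
      then show ?thesis
        using loc(6)[of w] elim by simp
    qed
    have e2: "(f w - a) * (f w - b) = (w - z) ^ m * (g w * (f w - b))"
      using loc(5)[of w] elim \<open>f z = a\<close> by simp
    show ?case unfolding e1 e2 using elim by simp
  qed
  from Lim_transform_eventually[OF lim this] show ?thesis by blast
qed

text \<open>
  At a root of \<open>Q\<close> of multiplicity \<open>m\<close> as a value of \<open>f\<close> the numerator vanishes to the order
  \<open>2 * (m - 1)\<close> and the denominator to the order \<open>m\<close>, and \<open>m \<le> 2 * (m - 1)\<close> because \<open>m \<ge> 2\<close>.
\<close>
lemma ramified_quotient:
  assumes sol: "entire_solution f" and ab: "poly Q a = 0" "poly Q b = 0" "a \<noteq> b"
  obtains G where "G holomorphic_on UNIV" "\<And>z. (deriv f z)\<^sup>2 = G z * ((f z - a) * (f z - b))"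
proof -
  have f: "f holomorphic_on UNIV" "\<not> f constant_on UNIV" using sol by (auto simp: entire_solution_def)
  have "\<exists>l. (\<lambda>w. (deriv f w)\<^sup>2 / ((f w - a) * (f w - b))) \<midarrow>z\<rightarrow> l" for z
  proof -
    consider "f z = a" | "f z = b" | "f z \<noteq> a" "f z \<noteq> b" by blast
    then show ?thesis
    proof cases
      case 1
      then show ?thesis using ramified_quotient_tendsto[OF sol ab(1,3)] by blast
    next
      case 2
      then show ?thesis using ramified_quotient_tendsto[OF sol ab(2) ab(3)[symmetric]] by (simp add: mult.commute)
    next
      case 3
      then have "(\<lambda>w. (deriv f w)\<^sup>2 / ((f w - a) * (f w - b))) \<midarrow>z\<rightarrow> (deriv f z)\<^sup>2 / ((f z - a) * (f z - b))"
        by (intro tendsto_intros isContD[OF entire_isCont] f entire_deriv) auto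
      then show ?thesis by blast
    qed
  qed
  then obtain l where l: "\<And>z. (\<lambda>w. (deriv f w)\<^sup>2 / ((f w - a) * (f w - b))) \<midarrow>z\<rightarrow> l z"
    by metis
  have "\<exists>z1. (f z1 - a) * (f z1 - b) \<noteq> 0"
  proof (rule ccontr)
    assume "\<not> ?thesis"
    then have "(f w - a) * (f w - b) = 0" for w by blast
    moreover obtain z1 where "f z1 \<noteq> b" using f(2) by (auto simp: constant_on_def)
    ultimately have "f w - a = 0" for w
      by (intro entire_mult_eq_0_cancel[of "\<lambda>w. f w - a" "\<lambda>w. f w - b" z1 w])
        (auto intro!: holomorphic_intros f)
    then show False using f(2) by (auto simp: constant_on_def)
  qed
  then obtain z1 where z1: "(f z1 - a) * (f z1 - b) \<noteq> 0" by blast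
  have "(\<lambda>z. (deriv f z)\<^sup>2) holomorphic_on UNIV" "(\<lambda>z. (f z - a) * (f z - b)) holomorphic_on UNIV"
    by (intro holomorphic_intros f entire_deriv)+
  from entire_quotient[OF this l z1] show ?thesis
    using that[of l] by (simp add: mult.commute)
qed

end

section \<open>Two roots in the denominator\<close>

lemma finite_separation:
  fixes S :: "complex set"
  assumes "finite S"
  obtains e where "e > 0" "\<And>x y. x \<in> S \<Longrightarrow> y \<in> S \<Longrightarrow> x \<noteq> y \<Longrightarrow> e \<le> dist x y"
proof -
  have "uniform_discrete S" using assms uniform_discrete_finite_iff by blast
  then obtain e where "e > 0" "\<forall>x\<in>S. \<forall>y\<in>S. dist x y < e \<longrightarrow> x = y"
    unfolding uniform_discrete_def by blast
  then show ?thesis using that[of e] by (meson not_le)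
qed

lemma connected_image_in_one_ball:
  fixes h :: "complex \<Rightarrow> complex"
  assumes "connected A" "continuous_on A h" "finite Z" "A \<noteq> {}"
    and sep: "\<And>x y. x \<in> Z \<Longrightarrow> y \<in> Z \<Longrightarrow> x \<noteq> y \<Longrightarrow> 2 * \<delta> \<le> dist x y"
    and cover: "\<And>\<zeta>. \<zeta> \<in> A \<Longrightarrow> \<exists>w\<in>Z. dist w (h \<zeta>) < \<delta>"
  obtains w0 where "w0 \<in> Z" "\<And>\<zeta>. \<zeta> \<in> A \<Longrightarrow> dist w0 (h \<zeta>) < \<delta>"
proof -
  obtain \<zeta>0 where \<zeta>0: "\<zeta>0 \<in> A" using assms(4) by blast
  then obtain w0 where w0: "w0 \<in> Z" "dist w0 (h \<zeta>0) < \<delta>" using cover by blast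
  define V where "V = (\<Union>w\<in>Z - {w0}. ball w \<delta>)"
  have "connected (h ` A)" using assms by (intro connected_continuous_image)
  moreover have "ball w0 \<delta> \<inter> V \<inter> h ` A = {}"
  proof -
    have False if x: "x \<in> ball w0 \<delta>" "x \<in> V" for x
    proof -
      obtain w where w: "w \<in> Z" "w \<noteq> w0" "dist w x < \<delta>" using x(2) by (auto simp: V_def)
      have "dist w0 w \<le> dist w0 x + dist w x" by (rule dist_triangle2)
      then show False using w w0(1) sep[of w0 w] x(1) by auto
    qed
    then show ?thesis by blast
  qed
  moreover have "h ` A \<subseteq> ball w0 \<delta> \<union> V"
    using cover by (fastforce simp: V_def)
  moreover have "open (ball w0 \<delta>)" "open V" by (auto simp: V_def)
  ultimately have "ball w0 \<delta> \<inter> h ` A = {} \<or> V \<inter> h ` A = {}"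
    using connectedD[of "h ` A" "ball w0 \<delta>" V] by blast
  then have "V \<inter> h ` A = {}" using \<zeta>0 w0 by auto
  then have "dist w0 (h \<zeta>) < \<delta>" if "\<zeta> \<in> A" for \<zeta>
  proof -
    have "h \<zeta> \<in> ball w0 \<delta>" using that \<open>h ` A \<subseteq> ball w0 \<delta> \<union> V\<close> \<open>V \<inter> h ` A = {}\<close> by blast
    then show ?thesis by simp
  qed
  with w0(1) show ?thesis using that by blast
qed

text \<open>
  Cauchy's estimates: a function bounded on a large disc is nearly constant on the unit disc.
\<close>
lemma slowly_varying:
  fixes \<Gamma> :: "complex \<Rightarrow> complex"
  assumes \<Gamma>: "\<Gamma> holomorphic_on UNIV" and N: "N \<ge> 2" and B: "B > 0"
    and bound: "\<And>\<zeta>. norm \<zeta> \<le> N \<Longrightarrow> norm (\<Gamma> \<zeta>) \<le> B" and \<zeta>: "norm \<zeta> \<le> 1"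
  shows "norm (deriv \<Gamma> \<zeta>) \<le> B / (N - 1)" "norm (deriv (deriv \<Gamma>) \<zeta>) \<le> 2 * B / (N - 1)"
    "norm (\<Gamma> \<zeta> - \<Gamma> 0) \<le> B / (N - 1)"
proof -
  have cauchy: "norm ((deriv ^^ n) \<Gamma> \<xi>) \<le> fact n * B / (N - 1) ^ n" if "norm \<xi> \<le> 1" for n \<xi>
  proof (rule Cauchy_inequality)
    show "norm (\<Gamma> x) \<le> B" if "norm (\<xi> - x) = N - 1" for x
      using that \<open>norm \<xi> \<le> 1\<close> norm_triangle_sub[of x \<xi>] by (intro bound) (simp add: norm_minus_commute)
  qed (use N in \<open>auto intro!: holomorphic_on_imp_continuous_on holomorphic_on_subset[OF \<Gamma>]\<close>)
  have d1: "norm (deriv \<Gamma> \<xi>) \<le> B / (N - 1)" if "norm \<xi> \<le> 1" for \<xi>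
    using cauchy[OF that, of 1] by simp
  then show "norm (deriv \<Gamma> \<zeta>) \<le> B / (N - 1)" using \<zeta> by blast
  have "norm (deriv (deriv \<Gamma>) \<zeta>) \<le> 2 * B / (N - 1) ^ 2"
    using cauchy[OF \<zeta>, of 2] by (simp add: eval_nat_numeral)
  also have "\<dots> \<le> 2 * B / (N - 1)"
    using N B self_le_power[of "N - 1" 2] by (intro divide_left_mono) auto
  finally show "norm (deriv (deriv \<Gamma>) \<zeta>) \<le> 2 * B / (N - 1)" .
  have "norm (\<Gamma> \<zeta> - \<Gamma> 0) \<le> B / (N - 1) * norm (\<zeta> - 0)"
    by (rule field_differentiable_bound[of "cball 0 1" _ "deriv \<Gamma>"])
      (use d1 \<zeta> in \<open>auto intro: has_field_derivative_at_within entire_DERIV[OF \<Gamma>]\<close>)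
  also have "\<dots> \<le> B / (N - 1)" using \<zeta> N B by (simp add: divide_right_mono mult_left_le)
  finally show "norm (\<Gamma> \<zeta> - \<Gamma> 0) \<le> B / (N - 1)" .
qed

context autonomous_schwarzian
begin

text \<open>
  What remains of a solution \<open>f\<close> and its quotient \<open>\<Gamma>\<close> after the substitution
  \<open>z = z0 + \<rho> \<zeta>\<close> at a doubling point of \<open>sqrt \<bar>f'\<^sup>2 / ((f - a) (f - b))\<bar>\<close>: the
  right-hand side of the equation acquires the factor
  \<open>\<rho> ^ (2 * p)\<close>, which is small.
\<close>
definition two_root_rescaling ::
    "complex \<Rightarrow> complex \<Rightarrow> real \<Rightarrow> real \<Rightarrow> (complex \<Rightarrow> complex) \<Rightarrow> (complex \<Rightarrow> complex) \<Rightarrow> bool" where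
  "two_root_rescaling a b N \<rho> f \<Gamma> \<longleftrightarrow>
     f holomorphic_on UNIV \<and> \<Gamma> holomorphic_on UNIV \<and> \<not> f constant_on UNIV \<and>
     (\<forall>z. (deriv f z)\<^sup>2 = \<Gamma> z * ((f z - a) * (f z - b))) \<and>
     norm (\<Gamma> 0) = 1 \<and> (\<forall>z. norm z \<le> N \<longrightarrow> norm (\<Gamma> z) \<le> 4) \<and>
     0 < \<rho> \<and> \<rho> * N \<le> 1 \<and>
     (\<forall>z. deriv f z \<noteq> 0 \<longrightarrow> poly Q (f z) \<noteq> 0 \<longrightarrow>
        norm (schwarzian f z) ^ p = \<rho> ^ (2 * p) * norm (rhs (f z)))"

text \<open>
  For large \<open>N\<close> the function \<open>\<Gamma>\<close> is almost constant of modulus one on the unit disc, and the formula for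
  the Schwarzian turns the equation into a condition on the value \<open>w = f \<zeta>\<close>: as the right-hand side is negligible away from
  the roots of \<open>Q\<close>, the value \<open>w\<close> must be near a root of \<open>Q\<close> or near a zero of
  \<open>4 (w - a) (w - b) + 3 (a - b)\<^sup>2\<close>. By connectedness it stays near a single such point, so \<open>f\<close> has
  small derivatives at \<open>0\<close>. But then \<open>(f - a) (f - b)\<close> and its derivative \<open>2 f - a - b\<close> are both small at \<open>0\<close>,
  and so is the discriminant \<open>(a - b)\<^sup>2\<close>.
\<close>
lemma two_root_rescaling_impossible:
  assumes deg: "degree P \<le> degree Q" and ab: "poly Q a = 0" "poly Q b = 0" "a \<noteq> b"
  obtains N where "N > 0" "\<And>\<rho> f \<Gamma>. \<not> two_root_rescaling a b N \<rho> f \<Gamma>"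
proof -
  define D where "D = (a - b)\<^sup>2"
  have D0: "D \<noteq> 0" using ab by (simp add: D_def)
  define q where "q = [:- a, 1:] * [:- b, 1:]"
  define q4 where "q4 = smult 4 q + [:3 * D:]"
  have deg_q: "degree q = 2" "degree q4 = 2" by (simp_all add: q_def q4_def)
  then have q4: "q4 \<noteq> 0" by auto
  have poly_q: "poly q w = (w - a) * (w - b)" for w by (simp add: q_def algebra_simps)
  have poly_q4: "poly q4 w = 4 * ((w - a) * (w - b)) + 3 * D" for w
    by (simp add: q4_def poly_q)
  define Z where "Z = {w. poly (Q * q4) w = 0}"
  have "finite Z" unfolding Z_def using Q_nz q4 by (intro poly_roots_finite) auto
  then obtain e where e: "e > 0" "\<And>x y. x \<in> Z \<Longrightarrow> y \<in> Z \<Longrightarrow> x \<noteq> y \<Longrightarrow> e \<le> dist x y"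
    using finite_separation by blast
  \<comment> \<open>The first bound keeps the discs of radius \<open>\<delta>\<close> around the points of \<open>Z\<close> disjoint, the second contradicts \<open>\<bar>D\<bar> \<le> 592 \<delta>\<^sup>2\<close> below.\<close>
  define \<delta> where "\<delta> = min (e / 2) (sqrt (norm D / 600))"
  have \<delta>: "\<delta> > 0" "2 * \<delta> \<le> e" using e(1) D0 by (auto simp: \<delta>_def)
  have "\<delta>\<^sup>2 \<le> (sqrt (norm D / 600))\<^sup>2"
    using \<delta>(1) by (intro power_mono) (auto simp: \<delta>_def)
  then have \<delta>D: "600 * \<delta>\<^sup>2 \<le> norm D" by simp
  obtain C where C: "C > 0" "\<And>w. (\<And>x. poly Q x = 0 \<Longrightarrow> \<delta> \<le> dist w x) \<Longrightarrow> norm (rhs w) \<le> C"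
    using rational_bounded[OF Q_nz deg \<delta>(1)] unfolding rhs_def by metis
  obtain C2 where C2: "C2 > 0" "\<And>w. (\<And>x. poly q4 x = 0 \<Longrightarrow> \<delta> \<le> dist w x) \<Longrightarrow> norm (poly q w / poly q4 w) \<le> C2"
    using rational_bounded[OF q4 _ \<delta>(1), of q] deg_q by (metis order_refl)
  \<comment> \<open>The first term makes the error term \<open>E\<close> harmless, the second the right-hand side, the last keeps \<open>\<bar>\<Gamma>\<bar> \<ge> 1 / 2\<close>.\<close>
  define N where "N = 2560 * C2 + C * (32 * C2) ^ p + 12"
  have N12: "N \<ge> 12" using C C2 by (simp add: N_def)
  show ?thesis
  proof (rule that[of N])
    show "N > 0" using N12 by simp
    fix f \<Gamma> :: "complex \<Rightarrow> complex" and \<rho> :: real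
    show "\<not> two_root_rescaling a b N \<rho> f \<Gamma>"
    proof
      assume "two_root_rescaling a b N \<rho> f \<Gamma>"
      then have f: "f holomorphic_on UNIV" and \<Gamma>: "\<Gamma> holomorphic_on UNIV" and nc: "\<not> f constant_on UNIV"
        and eq: "\<And>z. (deriv f z)\<^sup>2 = \<Gamma> z * ((f z - a) * (f z - b))" and \<Gamma>0: "norm (\<Gamma> 0) = 1"
        and \<Gamma>4: "\<And>z. norm z \<le> N \<Longrightarrow> norm (\<Gamma> z) \<le> 4" and \<rho>: "0 < \<rho>" "\<rho> * N \<le> 1"
        and S: "\<And>z. deriv f z \<noteq> 0 \<Longrightarrow> poly Q (f z) \<noteq> 0 \<Longrightarrow>
            norm (schwarzian f z) ^ p = \<rho> ^ (2 * p) * norm (rhs (f z))"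
        unfolding two_root_rescaling_def by blast+
      have N2: "2 \<le> N" using N12 by simp
      note slow = slowly_varying[OF \<Gamma> N2 _ \<Gamma>4]
      have near: "\<exists>w\<in>Z. dist w (f \<zeta>) < \<delta>" if \<zeta>: "\<zeta> \<in> ball 0 1" for \<zeta>
      proof (rule ccontr)
        assume "\<not> ?thesis"
        then have far: "\<delta> \<le> dist (f \<zeta>) w" if "poly Q w = 0 \<or> poly q4 w = 0" for w
          using that by (auto simp: Z_def dist_commute not_less)
        have \<zeta>1: "norm \<zeta> \<le> 1" using \<zeta> by simp
        have Qf: "poly Q (f \<zeta>) \<noteq> 0" "poly q4 (f \<zeta>) \<noteq> 0" using far[of "f \<zeta>"] \<delta>(1) by auto
        then have qf: "poly q (f \<zeta>) \<noteq> 0" using ab by (auto simp: poly_q)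
        have b1: "norm (deriv \<Gamma> \<zeta>) \<le> 4 / (N - 1)" "norm (deriv (deriv \<Gamma>) \<zeta>) \<le> 8 / (N - 1)"
          "norm (\<Gamma> \<zeta> - \<Gamma> 0) \<le> 4 / (N - 1)"
          using slow[OF _ _ \<zeta>1] by auto
        have "4 / (N - 1) \<le> 4 / 8" using N12 by (intro divide_left_mono) auto
        then have half: "norm (\<Gamma> \<zeta>) \<ge> 1 / 2"
          using b1(3) \<Gamma>0 norm_triangle_ineq2[of "\<Gamma> 0" "\<Gamma> \<zeta>"] by (simp add: norm_minus_commute)
        then have G0: "\<Gamma> \<zeta> \<noteq> 0" by auto
        have "(deriv f \<zeta>)\<^sup>2 \<noteq> 0" using eq[of \<zeta>] G0 qf by (simp add: poly_q)
        then have nz: "deriv f \<zeta> \<noteq> 0" by simp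
        define E where "E = deriv (deriv \<Gamma>) \<zeta> / (2 * \<Gamma> \<zeta>) - 5 / 8 * (deriv \<Gamma> \<zeta> / \<Gamma> \<zeta>)\<^sup>2"
        have Seq: "schwarzian f \<zeta> = - (\<Gamma> \<zeta> / 8) * (poly q4 (f \<zeta>) / poly q (f \<zeta>)) + E"
          unfolding quadratic_schwarzian[OF f \<Gamma> nc eq nz] E_def poly_q4 D_def[symmetric] poly_q[symmetric]
          using qf by (simp add: field_simps)
        define t where "t = 1 / (N - 1)"
        have t: "0 \<le> t" "t \<le> 1" using N12 by (auto simp: t_def)
        have "norm E \<le> norm (deriv (deriv \<Gamma>) \<zeta> / (2 * \<Gamma> \<zeta>)) + 5 / 8 * (norm (deriv \<Gamma> \<zeta> / \<Gamma> \<zeta>))\<^sup>2"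
          unfolding E_def by (rule order_trans[OF norm_triangle_ineq4]) (simp add: norm_mult norm_power)
        also have "\<dots> \<le> 8 * t + 5 / 8 * (64 * t)"
        proof (intro add_mono mult_left_mono)
          have "norm (deriv (deriv \<Gamma>) \<zeta> / (2 * \<Gamma> \<zeta>)) \<le> (8 / (N - 1)) / 1"
            unfolding norm_divide norm_mult using half N12 by (intro frac_le b1) auto
          then show "norm (deriv (deriv \<Gamma>) \<zeta> / (2 * \<Gamma> \<zeta>)) \<le> 8 * t" by (simp add: t_def)
          have "norm (deriv \<Gamma> \<zeta> / \<Gamma> \<zeta>) \<le> (4 / (N - 1)) / (1 / 2)"
            unfolding norm_divide using half N12 by (intro frac_le b1) auto
          then have "norm (deriv \<Gamma> \<zeta> / \<Gamma> \<zeta>) \<le> 8 * t" by (simp add: t_def)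
          then have "(norm (deriv \<Gamma> \<zeta> / \<Gamma> \<zeta>))\<^sup>2 \<le> (8 * t)\<^sup>2" by (intro power_mono) auto
          also have "\<dots> \<le> 64 * t" using t by (simp add: power2_eq_square mult_left_le)
          finally show "(norm (deriv \<Gamma> \<zeta> / \<Gamma> \<zeta>))\<^sup>2 \<le> 64 * t" .
        qed auto
        finally have "norm E \<le> 48 / (N - 1)" by (simp add: t_def)
        also have "\<dots> \<le> 1 / (32 * C2)"
        proof -
          have "0 \<le> C * (32 * C2) ^ p" using C C2 by simp
          then have "48 * (32 * C2) \<le> N - 1" using C2(1) unfolding N_def by linarith
          then have "48 / (N - 1) \<le> 48 / (48 * (32 * C2))" using C2(1) by (intro divide_left_mono) auto
          then show ?thesis by simp
        qed
        finally have E: "norm E \<le> 1 / (32 * C2)" .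
        have "norm (poly q (f \<zeta>) / poly q4 (f \<zeta>)) \<le> C2" by (rule C2(2)) (use far in auto)
        then have "1 / C2 \<le> norm (poly q4 (f \<zeta>) / poly q (f \<zeta>))"
          using C2(1) qf Qf by (simp add: norm_divide field_simps)
        then have "(1 / 2) / 8 * (1 / C2) \<le> norm (\<Gamma> \<zeta>) / 8 * norm (poly q4 (f \<zeta>) / poly q (f \<zeta>))"
          using half C2(1) by (intro mult_mono) auto
        also have "\<dots> = norm ((\<Gamma> \<zeta> / 8) * (poly q4 (f \<zeta>) / poly q (f \<zeta>)))"
          by (simp add: norm_mult norm_divide)
        also have "\<dots> \<le> norm (schwarzian f \<zeta>) + norm E"
          unfolding Seq by (metis add.commute add_diff_cancel_left' minus_mult_left norm_minus_cancel norm_triangle_ineq4 diff_minus_eq_add)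
        finally have "1 / (32 * C2) \<le> norm (schwarzian f \<zeta>)"
          using E by simp
        then have "(1 / (32 * C2)) ^ p \<le> norm (schwarzian f \<zeta>) ^ p"
          using C2(1) by (intro power_mono) auto
        also have "\<dots> \<le> \<rho> ^ (2 * p) * C"
          unfolding S[OF nz Qf(1)] using C(2)[of "f \<zeta>"] far \<rho>(1) by (intro mult_left_mono) auto
        also have "\<dots> \<le> \<rho> ^ 1 * C"
        proof (intro mult_right_mono power_decreasing)
          have "\<rho> * 1 \<le> \<rho> * N" using \<rho> N12 by (intro mult_left_mono) auto
          then show "\<rho> \<le> 1" using \<rho> by linarith
        qed (use \<rho> C p_pos in auto)
        finally have "1 \<le> \<rho> * (C * (32 * C2) ^ p)"
          using C2(1) by (simp add: power_divide field_simps)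
        also have "\<dots> < \<rho> * N"
          using \<rho>(1) C2(1) by (intro mult_strict_left_mono) (simp_all add: N_def)
        finally show False using \<rho>(2) by simp
      qed
      have contf: "continuous_on A f" for A
        using f by (meson holomorphic_on_imp_continuous_on holomorphic_on_subset subset_UNIV)
      obtain w0 where w0: "\<And>\<zeta>. \<zeta> \<in> ball 0 1 \<Longrightarrow> dist w0 (f \<zeta>) < \<delta>"
      proof (rule connected_image_in_one_ball[of "ball (0::complex) 1" f Z \<delta>])
        show "2 * \<delta> \<le> dist x y" if "x \<in> Z" "y \<in> Z" "x \<noteq> y" for x y
          using e(2)[OF that] \<delta> by linarith
      qed (use contf \<open>finite Z\<close> near in auto)
      have cauchy: "norm ((deriv ^^ n) f 0) \<le> fact n * \<delta> / (1 / 2) ^ n" if "n > 0" for n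
        using that by (intro Cauchy_higher_deriv_bound[of f 0 "1/2" w0] contf holomorphic_on_subset[OF f]) (auto intro!: w0)
      have d1: "norm (deriv f 0) \<le> 2 * \<delta>" using cauchy[of 1] by simp
      have d2: "norm (deriv (deriv f) 0) \<le> 8 * \<delta>" using cauchy[of 2] by (simp add: eval_nat_numeral)
      define x where "x = (f 0 - a) * (f 0 - b)"
      define u where "u = 2 * f 0 - a - b"
      have "norm x = (norm (deriv f 0))\<^sup>2"
        using arg_cong[OF eq[of 0], of norm] \<Gamma>0 by (simp add: x_def norm_mult norm_power)
      then have x: "norm x \<le> 4 * \<delta>\<^sup>2"
        using power_mono[OF d1, of 2] by (simp add: power_mult_distrib)
      have "norm (deriv \<Gamma> 0) \<le> 4 / (N - 1)" using slow(1)[of 0] by simp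
      also have "\<dots> \<le> 4" using N12 by (simp add: divide_le_eq)
      finally have \<Gamma>': "norm (deriv \<Gamma> 0) \<le> 4" .
      have "norm u = norm (2 * \<Gamma> 0 * deriv (deriv f) 0 - deriv \<Gamma> 0 * deriv f 0)"
        unfolding quadratic_second_derivative[OF f \<Gamma> nc eq] u_def using \<Gamma>0
        by (simp add: norm_mult norm_power)
      also have "\<dots> \<le> 2 * norm (deriv (deriv f) 0) + norm (deriv \<Gamma> 0) * norm (deriv f 0)"
        by (rule order_trans[OF norm_triangle_ineq4]) (simp add: norm_mult \<Gamma>0)
      also have "\<dots> \<le> 2 * (8 * \<delta>) + 4 * (2 * \<delta>)"
        by (intro add_mono mult_mono d1 d2 \<Gamma>') auto
      finally have "norm u \<le> 24 * \<delta>" by simp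
      from power_mono[OF this, of 2] have u: "(norm u)\<^sup>2 \<le> 576 * \<delta>\<^sup>2" by (simp add: power_mult_distrib)
      have "D = u\<^sup>2 - 4 * x"
        by (simp add: D_def u_def x_def power2_eq_square algebra_simps)
      then have "norm D \<le> (norm u)\<^sup>2 + 4 * norm x"
        using norm_triangle_ineq4[of "u\<^sup>2" "4 * x"] by (simp add: norm_mult norm_power)
      then have "norm D \<le> 592 * \<delta>\<^sup>2" using u x by linarith
      with \<delta>D have "8 * \<delta>\<^sup>2 \<le> 0" by linarith
      then show False using \<delta>(1) by simp
    qed
  qed
qed

text \<open>
  If the quotient were unbounded, rescaling at a doubling point of the square root of its modulus would contradict
  the previous lemma; so it is constant by Liouville's theorem.
\<close>
theorem two_root_first_order:
  assumes sol: "entire_solution f" and deg: "degree P \<le> degree Q"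
    and ab: "poly Q a = 0" "poly Q b = 0" "a \<noteq> b"
  obtains k where "\<And>z. (deriv f z)\<^sup>2 = k * ((f z - a) * (f z - b))"
proof -
  have f: "f holomorphic_on UNIV" and nc: "\<not> f constant_on UNIV"
    using sol by (auto simp: entire_solution_def)
  obtain G where G: "G holomorphic_on UNIV" and eq: "\<And>z. (deriv f z)\<^sup>2 = G z * ((f z - a) * (f z - b))"
    using ramified_quotient[OF sol ab] by blast
  obtain N where N: "N > 0" and imp: "\<And>\<rho> f \<Gamma>. \<not> two_root_rescaling a b N \<rho> f \<Gamma>"
    using two_root_rescaling_impossible[OF deg ab] by blast
  have G_small: "sqrt (norm (G z)) < 2 * N" for z
  proof (rule ccontr)
    assume *: "\<not> sqrt (norm (G z)) < 2 * N"
    define \<mu> where "\<mu> = (\<lambda>z. sqrt (norm (G z)))"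
    have "continuous_on UNIV \<mu>"
      unfolding \<mu>_def using G by (intro continuous_intros holomorphic_on_imp_continuous_on)
    from doubling_point[OF this, of "2 * N" z] * N
    obtain z0 where z0: "2 * N \<le> \<mu> z0" "\<And>z. dist z0 z \<le> (2 * N) / (2 * \<mu> z0) \<Longrightarrow> \<mu> z \<le> 2 * \<mu> z0"
      by (auto simp: \<mu>_def)
    define \<rho> where "\<rho> = 1 / \<mu> z0"
    have \<mu>0: "\<mu> z0 > 0" using z0(1) N by linarith
    have \<rho>: "\<rho> > 0" "\<rho> * N \<le> 1" using z0(1) N \<mu>0 by (auto simp: \<rho>_def divide_le_eq)
    define c where "c = complex_of_real \<rho>"
    have c0: "c \<noteq> 0" "norm c = \<rho>" using \<rho> by (auto simp: c_def)
    have \<mu>2: "norm (G w) = (\<mu> w)\<^sup>2" for w by (simp add: \<mu>_def)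
    define \<Gamma> where "\<Gamma> = (\<lambda>\<zeta>. c\<^sup>2 * G (z0 + c * \<zeta>))"
    define g where "g = (\<lambda>\<zeta>. f (z0 + c * \<zeta>))"
    have dg: "deriv g = (\<lambda>\<zeta>. c * deriv f (z0 + c * \<zeta>))"
      unfolding g_def using deriv_rescale[OF f, of 1 z0 c] by simp
    have "two_root_rescaling a b N \<rho> g \<Gamma>"
      unfolding two_root_rescaling_def
    proof (intro conjI allI impI)
      show "g holomorphic_on UNIV" unfolding g_def using entire_rescale[OF f, of 1] by simp
      show "\<Gamma> holomorphic_on UNIV" unfolding \<Gamma>_def by (rule entire_rescale[OF G])
      show "\<not> g constant_on UNIV"
      proof
        assume "g constant_on UNIV"
        then obtain y where y: "\<And>\<zeta>. f (z0 + c * \<zeta>) = y" by (auto simp: constant_on_def g_def)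
        have "f w = y" for w using y[of "(w - z0) / c"] c0 by simp
        then show False using nc by (auto simp: constant_on_def)
      qed
      show "(deriv g z)\<^sup>2 = \<Gamma> z * ((g z - a) * (g z - b))" for z
        unfolding dg by (simp add: \<Gamma>_def g_def power_mult_distrib eq mult_ac)
      show "norm (\<Gamma> 0) = 1"
        using \<mu>0 by (simp add: \<Gamma>_def norm_mult norm_power c0 \<mu>2 \<rho>_def power_divide)
      show "norm (\<Gamma> \<zeta>) \<le> 4" if "norm \<zeta> \<le> N" for \<zeta>
      proof -
        have "dist z0 (z0 + c * \<zeta>) = \<rho> * norm \<zeta>" by (simp add: dist_norm norm_mult c0)
        also have "\<dots> \<le> (2 * N) / (2 * \<mu> z0)" using that \<mu>0 by (simp add: \<rho>_def divide_right_mono)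
        finally have "\<mu> (z0 + c * \<zeta>) \<le> 2 * \<mu> z0" by (rule z0(2))
        then have "(\<mu> (z0 + c * \<zeta>))\<^sup>2 \<le> (2 * \<mu> z0)\<^sup>2"
          by (intro power_mono) (auto simp: \<mu>_def)
        then show ?thesis
          using \<mu>0 by (simp add: \<Gamma>_def norm_mult norm_power c0 \<mu>2 \<rho>_def power_divide power_mult_distrib divide_le_eq)
      qed
      show "norm (schwarzian g z) ^ p = \<rho> ^ (2 * p) * norm (rhs (g z))"
        if "deriv g z \<noteq> 0" "poly Q (g z) \<noteq> 0" for z
      proof -
        have nz: "deriv f (z0 + c * z) \<noteq> 0" using that(1) by (simp add: dg)
        have "schwarzian g z = c\<^sup>2 * schwarzian f (z0 + c * z)"
          unfolding g_def by (rule schwarzian_rescale[OF f nz c0(1)])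
        then have "norm (schwarzian g z) ^ p = \<rho> ^ (2 * p) * norm (schwarzian f (z0 + c * z) ^ p)"
          by (simp add: norm_mult norm_power c0 power_mult_distrib power_mult)
        also have "schwarzian f (z0 + c * z) ^ p = rhs (g z)"
          using solution_at_regular_point[OF sol nz] that(2) by (simp add: g_def)
        finally show ?thesis .
      qed
    qed (use \<rho> in auto)
    then show False using imp by blast
  qed
  have "norm (G z) \<le> (2 * N)\<^sup>2" for z
    using power_mono[OF less_imp_le[OF G_small[of z]], of 2] by simp
  then have "bounded (range G)" by (auto simp: bounded_iff)
  then obtain k where "\<And>z. G z = k" using Liouville_theorem[OF G] by (auto simp: constant_on_def)
  then show ?thesis using that eq by metis
qed

end

section \<open>Roots of entire functions and growth estimates\<close>

text \<open>
  If all zeros have the same order \<open>m\<close> and there are no further critical points, then \<open>f'\<^sup>m / f ^ (m - 1)\<close> extends to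
  an entire function without zeros, which has an entire \<open>m\<close>-th root \<open>E\<close> (for \<open>f = F\<^sup>m\<close> it is \<open>m F'\<close>). The
  root of \<open>f\<close> is recovered as \<open>F = E f / f'\<close>.
\<close>
lemma entire_root:
  fixes f :: "complex \<Rightarrow> complex"
  assumes f: "f holomorphic_on UNIV" and nc: "\<not> f constant_on UNIV" and "m > 0"
    and reg: "\<And>z. f z \<noteq> 0 \<Longrightarrow> deriv f z \<noteq> 0"
    and zero: "\<And>z. f z = 0 \<Longrightarrow> \<exists>g h r. local_power_form f z m g h r"
  obtains F where "F holomorphic_on UNIV" "\<And>z. F z ^ m = f z" "\<And>z. deriv F z \<noteq> 0"
proof -
  note Df = entire_deriv[OF f]
  obtain z1 where z1: "deriv f z1 \<noteq> 0" using entire_deriv_nonzero[OF f nc] .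
  have "\<exists>z2. f z2 \<noteq> 0" using nc by (auto simp: constant_on_def)
  then obtain z2 where z2: "f z2 \<noteq> 0" by blast
  obtain n where n: "m = Suc n" using \<open>m > 0\<close> gr0_implies_Suc by blast
  have "\<exists>l. l \<noteq> 0 \<and> (\<lambda>w. deriv f w ^ m / f w ^ n) \<midarrow>z\<rightarrow> l" for z
  proof (cases "f z = 0")
    case True
    then obtain g h r where "local_power_form f z m g h r" using zero by blast
    note l = local_power_formD[OF this]
    have lim: "(\<lambda>w. h w ^ m / g w ^ n) \<midarrow>z\<rightarrow> h z ^ m / g z ^ n"
      using l(11) by (intro tendsto_intros isContD l(9,10)) auto
    from l(13) have "eventually (\<lambda>w. h w ^ m / g w ^ n = deriv f w ^ m / f w ^ n) (at z)"
    proof eventually_elim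
      case (elim w)
      then have e: "f w = (w - z) ^ m * g w" "deriv f w = (w - z) ^ n * h w"
        using l(5,6)[of w] True n by auto
      show ?case unfolding e using elim
        by (simp add: power_mult_distrib flip: power_mult) (simp add: mult.commute)
    qed
    from Lim_transform_eventually[OF lim this] show ?thesis
      using l(11,12) by (intro exI[of _ "h z ^ m / g z ^ n"]) simp
  next
    case False
    then have "(\<lambda>w. deriv f w ^ m / f w ^ n) \<midarrow>z\<rightarrow> deriv f z ^ m / f z ^ n"
      by (intro tendsto_intros isContD[OF entire_isCont] f Df) auto
    then show ?thesis using reg[OF False] False by (intro exI[of _ "deriv f z ^ m / f z ^ n"]) auto
  qed
  then obtain l where l0: "\<And>z. l z \<noteq> 0" and l: "\<And>z. (\<lambda>w. deriv f w ^ m / f w ^ n) \<midarrow>z\<rightarrow> l z"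
    by metis
  have "(\<lambda>w. deriv f w ^ m) holomorphic_on UNIV" "(\<lambda>w. f w ^ n) holomorphic_on UNIV" "f z2 ^ n \<noteq> 0"
    using z2 by (auto intro!: holomorphic_intros f Df)
  from entire_quotient[OF this(1,2) l this(3)]
  have lh: "l holomorphic_on UNIV" and l_eq: "\<And>z. deriv f z ^ m = f z ^ n * l z" by blast+
  obtain L where L: "L holomorphic_on UNIV" "\<And>z. l z = exp (L z)"
    using contractible_imp_holomorphic_log[OF lh contractible_UNIV] l0 by (metis UNIV_I)
  define E where "E = (\<lambda>z. exp (L z / of_nat m))"
  have E: "E holomorphic_on UNIV" unfolding E_def using \<open>m > 0\<close> by (intro holomorphic_intros L) auto
  have Em: "E z ^ m = l z" for z
    using \<open>m > 0\<close> by (simp add: E_def L(2) flip: exp_of_nat_mult)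
  have "\<exists>l. (\<lambda>w. (E w * f w) / deriv f w) \<midarrow>z\<rightarrow> l" for z
  proof (cases "f z = 0")
    case True
    then obtain g h r where "local_power_form f z m g h r" using zero by blast
    note l = local_power_formD[OF this]
    have lim: "(\<lambda>w. (E w * ((w - z) * g w)) / h w) \<midarrow>z\<rightarrow> (E z * ((z - z) * g z)) / h z"
      using l(12) by (intro tendsto_intros isContD[OF entire_isCont[OF E]] isContD l(9,10)) auto
    from l(13) have "eventually (\<lambda>w. (E w * ((w - z) * g w)) / h w = (E w * f w) / deriv f w) (at z)"
    proof eventually_elim
      case (elim w)
      then have e: "f w = (w - z) ^ m * g w" "deriv f w = (w - z) ^ n * h w"
        using l(5,6)[of w] True n by auto
      show ?case unfolding e using elim n by simp
    qed
    from Lim_transform_eventually[OF lim this] show ?thesis by blast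
  next
    case False
    then have "(\<lambda>w. (E w * f w) / deriv f w) \<midarrow>z\<rightarrow> (E z * f z) / deriv f z"
      by (intro tendsto_intros isContD[OF entire_isCont] f Df E reg)
    then show ?thesis by blast
  qed
  then obtain F where Fl: "\<And>z. (\<lambda>w. (E w * f w) / deriv f w) \<midarrow>z\<rightarrow> F z" by metis
  have "(\<lambda>w. E w * f w) holomorphic_on UNIV" by (intro holomorphic_intros E f)
  from entire_quotient[OF this Df Fl z1]
  have F: "F holomorphic_on UNIV" and F_eq: "\<And>z. E z * f z = deriv f z * F z" by blast+
  have Fm: "F z ^ m = f z" for z
  proof -
    have "(F w ^ m - f w) * deriv f w ^ m = 0" for w
    proof -
      have "deriv f w ^ m * F w ^ m = l w * f w ^ m"
        by (simp flip: Em power_mult_distrib F_eq)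
      also have "\<dots> = deriv f w ^ m * f w" unfolding l_eq by (simp add: n mult_ac)
      finally show ?thesis by (simp add: algebra_simps)
    qed
    then have "F z ^ m - f z = 0"
      by (intro entire_mult_eq_0_cancel[of "\<lambda>w. F w ^ m - f w" "\<lambda>w. deriv f w ^ m" z1])
        (use z1 in \<open>auto intro!: holomorphic_intros F f Df\<close>)
    then show ?thesis by simp
  qed
  have "deriv F z \<noteq> 0" for z
  proof (cases "f z = 0")
    case True
    then obtain g h r where "local_power_form f z m g h r" using zero by blast
    note l = local_power_formD[OF this]
    have Fz: "F z = 0" using Fm[of z] True \<open>m > 0\<close> by simp
    have "(\<lambda>w. (F w - F z) / (w - z)) \<midarrow>z\<rightarrow> deriv F z"
      using entire_DERIV[OF F, of z] by (simp add: has_field_derivative_iff)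
    then have A: "(\<lambda>w. ((F w - F z) / (w - z)) ^ m) \<midarrow>z\<rightarrow> deriv F z ^ m"
      by (intro tendsto_intros)
    from l(13) have "eventually (\<lambda>w. ((F w - F z) / (w - z)) ^ m = g w) (at z)"
      by (rule eventually_mono) (use l(5) True in \<open>auto simp: Fz power_divide Fm\<close>)
    from Lim_transform_eventually[OF A this] have "g \<midarrow>z\<rightarrow> deriv F z ^ m" .
    then have "deriv F z ^ m = g z" using isContD[OF l(9)] LIM_unique by blast
    then show ?thesis using l(11) \<open>m > 0\<close> by (auto simp: power_0_left)
  next
    case False
    have "((\<lambda>z. F z ^ m) has_field_derivative of_nat m * F z ^ (m - 1) * deriv F z) (at z)"
      by (auto intro!: derivative_eq_intros entire_DERIV[OF F])
    then have "deriv f z = of_nat m * F z ^ (m - 1) * deriv F z"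
      unfolding Fm by (rule DERIV_imp_deriv)
    then show ?thesis using reg[OF False] by auto
  qed
  with F Fm show ?thesis using that by blast
qed

text \<open>
  The chain rule for the Schwarzian of a power, written with the logarithmic derivatives \<open>F'' / F'\<close> and \<open>F' / F\<close>.
\<close>
lemma schwarzian_power:
  fixes F \<phi> :: "complex \<Rightarrow> complex"
  assumes F: "F holomorphic_on UNIV" and \<phi>: "\<phi> holomorphic_on UNIV"
    and F'': "\<And>z. deriv (deriv F) z = \<phi> z * deriv F z" and F': "\<And>z. deriv F z \<noteq> 0"
    and "m > 0" "F z \<noteq> 0"
  shows "schwarzian (\<lambda>z. a + F z ^ m) z =
     deriv \<phi> z - (\<phi> z)\<^sup>2 / 2 - (of_nat m ^ 2 - 1) / 2 * (deriv F z / F z)\<^sup>2"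
proof -
  define n where "n = m - 1"
  define f where "f = (\<lambda>z. a + F z ^ m)"
  have m: "m = Suc n" using \<open>m > 0\<close> by (simp add: n_def)
  note DF = entire_DERIV[OF F] and DF' = entire_DERIV[OF entire_deriv[OF F]] and D\<phi> = entire_DERIV[OF \<phi>]
  have df: "deriv f = (\<lambda>z. of_nat m * F z ^ n * deriv F z)"
    unfolding f_def n_def by (auto intro!: ext DERIV_imp_deriv derivative_eq_intros DF)
  have S: "open {w. F w \<noteq> 0}"
    using F by (intro open_Collect_neq continuous_intros holomorphic_on_imp_continuous_on)
  have dd: "of_nat n * (deriv F w / F w) + \<phi> w = deriv (deriv f) w / deriv f w" if "F w \<noteq> 0" for w
  proof -
    have pw: "of_nat n * F w ^ (n - Suc 0) = of_nat n * F w ^ n / F w"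
      using that by (cases n) auto
    have "((\<lambda>z. F z ^ n) has_field_derivative (of_nat n * F w ^ (n - Suc 0)) * deriv F w) (at w)"
      by (auto intro!: derivative_eq_intros DF)
    from DERIV_mult[OF this DF'] have "((\<lambda>z. F z ^ n * deriv F z) has_field_derivative
        (of_nat n * F w ^ n / F w * deriv F w * deriv F w + \<phi> w * deriv F w * F w ^ n)) (at w)"
      unfolding pw by (simp add: F'')
    from DERIV_cmult[OF this, of "of_nat m"]
    have "deriv (deriv f) w = of_nat m * (of_nat n * F w ^ n / F w * deriv F w * deriv F w + \<phi> w * deriv F w * F w ^ n)"
      unfolding df by (simp add: DERIV_imp_deriv mult.assoc)
    moreover have "(c * (b * x / y * d * d + u * d * x)) / (c * x * d) = b * (d / y) + u"
      if "c \<noteq> 0" "x \<noteq> 0" "d \<noteq> 0" "y \<noteq> 0" for b c d u x y :: complex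
      using that by (simp add: field_simps)
    moreover have "deriv f w = of_nat m * F w ^ n * deriv F w" by (simp add: df)
    ultimately show ?thesis
      using that F'[of w] \<open>m > 0\<close> by simp
  qed
  have "((\<lambda>w. of_nat n * (deriv F w / F w) + \<phi> w) has_field_derivative
      of_nat n * (deriv F z / F z * (\<phi> z - deriv F z / F z)) + deriv \<phi> z) (at z)"
  proof -
    have "(u * d * y - d * d) / (y * y) = d / y * (u - d / y)" if "y \<noteq> 0" for u d y :: complex
      using that by (simp add: field_simps)
    then show ?thesis
      using DERIV_add[OF DERIV_cmult[OF DERIV_divide[OF DF' DF \<open>F z \<noteq> 0\<close>], of "of_nat n"] D\<phi>] \<open>F z \<noteq> 0\<close>
      by (simp add: F'')
  qed
  then have "((\<lambda>w. deriv (deriv f) w / deriv f w) has_field_derivative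
      of_nat n * (deriv F z / F z * (\<phi> z - deriv F z / F z)) + deriv \<phi> z) (at z)"
    by (rule has_field_derivative_transform_within_open[OF _ S]) (use dd \<open>F z \<noteq> 0\<close> in auto)
  then have "schwarzian f z = of_nat n * (deriv F z / F z * (\<phi> z - deriv F z / F z)) + deriv \<phi> z
       - 1 / 2 * (of_nat n * (deriv F z / F z) + \<phi> z)\<^sup>2"
    unfolding schwarzian_def dd[OF \<open>F z \<noteq> 0\<close>, symmetric] by (simp add: DERIV_imp_deriv)
  also have "\<dots> = deriv \<phi> z - (\<phi> z)\<^sup>2 / 2 - (of_nat m ^ 2 - 1) / 2 * (deriv F z / F z)\<^sup>2"
  proof -
    have "c * (y * (u - y)) + d - 1 / 2 * (c * y + u)\<^sup>2 = d - u\<^sup>2 / 2 - ((1 + c)\<^sup>2 - 1) / 2 * y\<^sup>2"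
      for c y u d :: complex
      by (simp add: field_simps power2_eq_square)
    from this[of "of_nat n" "deriv F z / F z" "\<phi> z" "deriv \<phi> z"] show ?thesis
      by (simp only: m of_nat_Suc)
  qed
  finally show ?thesis by (simp add: f_def)
qed

text \<open>
  Schwarz's lemma applied to \<open>H / (2 A - H)\<close>, where \<open>H = h - h 0\<close>, followed by Cauchy's estimate.
\<close>
lemma Borel_Caratheodory_derivative:
  fixes h :: "complex \<Rightarrow> complex"
  assumes h: "h holomorphic_on UNIV" and R: "R > 0" and A: "A > 0"
    and le: "\<And>\<zeta>. norm \<zeta> < R \<Longrightarrow> Re (h \<zeta>) < Re (h 0) + A" and \<zeta>: "norm \<zeta> \<le> R / 2"
  shows "norm (deriv h \<zeta>) \<le> 24 * A / R"
proof -
  define H where "H = (\<lambda>z. h z - h 0)"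
  have H: "H holomorphic_on UNIV" unfolding H_def by (intro holomorphic_intros h)
  have lt: "norm (H z) < norm (2 * of_real A - H z)" if "norm z < R" for z
  proof -
    have "Re (H z) < A" using le[OF that] by (simp add: H_def)
    then have "A * Re (H z) < A * A" using A by simp
    then have "(norm (H z))\<^sup>2 < (norm (2 * of_real A - H z))\<^sup>2"
      unfolding cmod_power2 by (simp add: power2_eq_square algebra_simps)
    then show ?thesis by (rule power2_less_imp_less) simp
  qed
  have bound: "norm (H z) \<le> 6 * A" if z: "norm z \<le> 3 / 4 * R" for z
  proof -
    have zR: "norm z < R" using z R by linarith
    define G where "G = (\<lambda>\<xi>. H (of_real R * \<xi>) / (2 * of_real A - H (of_real R * \<xi>)))"
    have hR: "(\<lambda>\<xi>. H (of_real R * \<xi>)) holomorphic_on ball 0 1"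
      by (intro holomorphic_on_compose_gen[OF _ H, unfolded o_def] holomorphic_intros) auto
    have R1: "norm (of_real R * \<xi>) < R" if "norm \<xi> < 1" for \<xi> :: complex
      using that R by (simp add: norm_mult)
    have "G holomorphic_on ball 0 1"
      unfolding G_def using lt[OF R1] by (intro holomorphic_intros hR) fastforce
    moreover have "G 0 = 0" by (simp add: G_def H_def)
    moreover have "norm (G \<xi>) < 1" if "norm \<xi> < 1" for \<xi>
      using lt[OF R1[OF that]] by (simp add: G_def norm_divide divide_less_eq)
    moreover have "norm (z / of_real R) < 1" using zR R by (simp add: norm_divide)
    ultimately have "norm (G (z / of_real R)) \<le> norm (z / of_real R)"
      by (rule Schwarz_Lemma(1))
    also have "\<dots> \<le> 3 / 4" using z R by (simp add: norm_divide divide_le_eq)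
    finally have "norm (H z) \<le> 3 / 4 * norm (2 * of_real A - H z)"
      using lt[OF zR] R by (simp add: G_def norm_divide divide_le_eq split: if_splits)
    also have "\<dots> \<le> 3 / 4 * (2 * A + norm (H z))"
      using norm_triangle_ineq4[of "2 * of_real A" "H z"] A by (simp add: norm_mult)
    finally show ?thesis by simp
  qed
  have "norm ((deriv ^^ 1) H \<zeta>) \<le> fact 1 * (6 * A) / (R / 4) ^ 1"
  proof (rule Cauchy_inequality)
    show "norm (H x) \<le> 6 * A" if "norm (\<zeta> - x) = R / 4" for x
      using that \<zeta> norm_triangle_sub[of x \<zeta>] by (intro bound) (simp add: norm_minus_commute)
  qed (use R in \<open>auto intro!: holomorphic_on_imp_continuous_on holomorphic_on_subset[OF H]\<close>)
  moreover have "deriv H \<zeta> = deriv h \<zeta>"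
    unfolding H_def by (auto intro!: DERIV_imp_deriv derivative_eq_intros entire_DERIV[OF h])
  ultimately show ?thesis by simp
qed

text \<open>
  Along the segment from \<open>0\<close> to \<open>\<zeta>\<close> the derivative of \<open>u = 1 + \<bar>F\<bar>\<^sup>2\<close> is at most \<open>2 C \<bar>\<zeta>\<bar> u\<close>.
\<close>
lemma Gronwall_growth:
  fixes F :: "complex \<Rightarrow> complex"
  assumes F: "F holomorphic_on UNIV" and "C \<ge> 0"
    and le: "\<And>w. norm w \<le> norm \<zeta> \<Longrightarrow> (norm (deriv F w))\<^sup>2 \<le> C\<^sup>2 * (1 + (norm (F w))\<^sup>2)"
  shows "1 + (norm (F \<zeta>))\<^sup>2 \<le> (1 + (norm (F 0))\<^sup>2) * exp (2 * C * norm \<zeta>)"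
proof -
  define u where "u = (\<lambda>t. 1 + (norm (F (of_real t * \<zeta>)))\<^sup>2)"
  define u' where "u' = (\<lambda>t. 2 * (F (of_real t * \<zeta>) \<bullet> (deriv F (of_real t * \<zeta>) * \<zeta>)))"
  have du: "(u has_real_derivative u' t) (at t)" for t
  proof -
    have "((\<lambda>s. F (s * \<zeta>)) has_field_derivative deriv F (of_real t * \<zeta>) * \<zeta>) (at (of_real t))"
      by (rule entire_DERIV'[OF F]) (auto intro!: derivative_eq_intros)
    then have "((\<lambda>t. F (of_real t * \<zeta>)) has_vector_derivative deriv F (of_real t * \<zeta>) * \<zeta>) (at t)"
      by (rule has_vector_derivative_real_field)
    then have "((\<lambda>t. F (of_real t * \<zeta>)) has_derivative (\<lambda>h. h *\<^sub>R (deriv F (of_real t * \<zeta>) * \<zeta>))) (at t)"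
      by (simp add: has_vector_derivative_def)
    from has_derivative_inner[OF this this]
    have "((\<lambda>t. (norm (F (of_real t * \<zeta>)))\<^sup>2) has_derivative (\<lambda>h. h * u' t)) (at t)"
      by (simp add: u'_def power2_norm_eq_inner inner_commute algebra_simps)
    then have "((\<lambda>t. (norm (F (of_real t * \<zeta>)))\<^sup>2) has_real_derivative u' t) (at t)"
      by (rule has_derivative_imp_has_field_derivative) (rule refl)
    from DERIV_add[OF DERIV_const[of 1] this] show ?thesis unfolding u_def by simp
  qed
  have upos: "u t \<ge> 1" for t by (simp add: u_def)
  define v where "v = (\<lambda>t. u t * exp (- (2 * C * norm \<zeta>) * t))"
  have dv: "(v has_real_derivative (u' t - 2 * C * norm \<zeta> * u t) * exp (- (2 * C * norm \<zeta>) * t)) (at t)" for t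
    unfolding v_def by (auto intro!: derivative_eq_intros du simp: algebra_simps)
  have nonpos: "u' t \<le> 2 * C * norm \<zeta> * u t" if "0 \<le> t" "t \<le> 1" for t
  proof -
    define x where "x = norm (F (of_real t * \<zeta>))"
    define d where "d = norm (deriv F (of_real t * \<zeta>))"
    have "d\<^sup>2 \<le> C\<^sup>2 * (1 + x\<^sup>2)"
      unfolding x_def d_def using that by (intro le) (simp add: norm_mult mult_left_le_one_le)
    then have "(d * x)\<^sup>2 \<le> C\<^sup>2 * (1 + x\<^sup>2) * (1 + x\<^sup>2)"
      unfolding power_mult_distrib using \<open>C \<ge> 0\<close> by (intro mult_mono) auto
    then have "(d * x)\<^sup>2 \<le> (C * (1 + x\<^sup>2))\<^sup>2" by (simp add: power2_eq_square mult_ac)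
    then have dx: "d * x \<le> C * (1 + x\<^sup>2)"
      by (rule power2_le_imp_le) (use \<open>C \<ge> 0\<close> in simp)
    have "u' t \<le> 2 * (x * (d * norm \<zeta>))"
      unfolding u'_def x_def d_def using norm_cauchy_schwarz by (metis mult_left_mono norm_mult zero_le_numeral)
    also have "\<dots> = 2 * norm \<zeta> * (d * x)" by (simp add: mult_ac)
    also have "\<dots> \<le> 2 * norm \<zeta> * (C * (1 + x\<^sup>2))" by (intro mult_left_mono dx) auto
    finally show ?thesis by (simp add: u_def x_def mult_ac)
  qed
  have "v 1 \<le> v 0"
  proof (rule DERIV_nonpos_imp_nonincreasing[of 0 1 v])
    show "\<exists>y. (v has_real_derivative y) (at t) \<and> y \<le> 0" if "0 \<le> t" "t \<le> 1" for t
      using dv[of t] nonpos[OF that] by (intro exI[of _ "(u' t - 2 * C * norm \<zeta> * u t) * exp (- (2 * C * norm \<zeta>) * t)"])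
        (auto intro!: mult_nonpos_nonneg)
  qed simp
  then show ?thesis by (simp add: v_def u_def exp_minus field_simps)
qed

text \<open>
  The exact system \<open>k y\<^sup>2 + \<phi>\<^sup>2 / 2 = 0\<close>, \<open>y\<^sup>2 (\<phi> - y) = 0\<close> has only the solution with \<open>y = 0\<close>; this is
  the quantitative form needed after rescaling.
\<close>
lemma no_almost_solution:
  fixes k :: real
  assumes "k > 0"
  obtains \<epsilon> where "\<epsilon> > 0" "\<And>y \<phi> :: complex. 1 / 18 \<le> norm y \<Longrightarrow>
     norm (of_real k * y\<^sup>2 + \<phi>\<^sup>2 / 2) \<le> \<epsilon> \<Longrightarrow> norm (y\<^sup>2 * (\<phi> - y)) \<le> \<epsilon> \<Longrightarrow> False"
proof -
  \<comment> \<open>The two hypotheses force \<open>k \<le> 324 * 52507 * \<epsilon>\<close>, and \<open>324 * 52507 < 20000000\<close>.\<close>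
  define \<epsilon> where "\<epsilon> = min 1 (k / 20000000)"
  have \<epsilon>: "\<epsilon> > 0" "\<epsilon> \<le> 1" "\<epsilon> * 20000000 \<le> k" using assms by (auto simp: \<epsilon>_def)
  have False if y: "1 / 18 \<le> norm y" and a: "norm (of_real k * y\<^sup>2 + \<phi>\<^sup>2 / 2) \<le> \<epsilon>"
    and b: "norm (y\<^sup>2 * (\<phi> - y)) \<le> \<epsilon>" for y \<phi> :: complex
  proof -
    define e where "e = \<phi> - y"
    have b': "(norm y)\<^sup>2 * norm e \<le> \<epsilon>" using b by (simp add: e_def norm_mult norm_power)
    have y2: "(1 / 18)\<^sup>2 \<le> (norm y)\<^sup>2" using y by (intro power_mono) auto
    have "(1 / 18)\<^sup>2 * norm e \<le> (norm y)\<^sup>2 * norm e" by (intro mult_right_mono y2) auto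
    then have e: "norm e \<le> 324 * \<epsilon>" using b' by (simp add: power2_eq_square)
    have "1 / 18 * (norm y * norm e) \<le> norm y * (norm y * norm e)"
      using y by (intro mult_right_mono) auto
    then have ye: "norm y * norm e \<le> 18 * \<epsilon>" using b' by (simp add: power2_eq_square mult.assoc)
    have "(norm e)\<^sup>2 \<le> (324 * \<epsilon>)\<^sup>2" using e by (intro power_mono) auto
    also have "\<dots> = 104976 * (\<epsilon> * \<epsilon>)" by (simp add: power2_eq_square)
    also have "\<dots> \<le> 104976 * (\<epsilon> * 1)" using \<epsilon> by (intro mult_left_mono) auto
    finally have e2: "(norm e)\<^sup>2 \<le> 104976 * \<epsilon>" by simp
    have "of_real (k + 1 / 2) * y\<^sup>2 = (of_real k * y\<^sup>2 + \<phi>\<^sup>2 / 2) - (y * e + e\<^sup>2 / 2)"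
      by (simp add: e_def power2_eq_square field_simps)
    then have "norm (of_real (k + 1 / 2) * y\<^sup>2) \<le> norm (of_real k * y\<^sup>2 + \<phi>\<^sup>2 / 2) + (norm (y * e) + norm (e\<^sup>2 / 2))"
      by (simp only:) (rule order_trans[OF norm_triangle_ineq4 add_left_mono[OF norm_triangle_ineq]])
    also have "\<dots> \<le> \<epsilon> + (18 * \<epsilon> + 104976 * \<epsilon> / 2)"
      using a ye e2 by (intro add_mono) (auto simp: norm_mult norm_divide norm_power)
    also have "norm (of_real (k + 1 / 2) * y\<^sup>2) = (k + 1 / 2) * (norm y)\<^sup>2"
      using assms by (simp only: norm_mult norm_of_real norm_power)
    finally have "(k + 1 / 2) * (norm y)\<^sup>2 \<le> 52507 * \<epsilon>" by simp
    moreover have "k * (1 / 18)\<^sup>2 \<le> (k + 1 / 2) * (norm y)\<^sup>2"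
      using assms y2 by (intro mult_mono) auto
    ultimately have "k \<le> 324 * (52507 * \<epsilon>)" by (simp add: power2_eq_square)
    then show False using \<epsilon> by linarith
  qed
  with \<epsilon>(1) show ?thesis using that by blast
qed

section \<open>Rescaling with one root in the denominator\<close>

context autonomous_schwarzian
begin

text \<open>
  The rescaled situation when \<open>f = a + F\<^sup>m\<close> and \<open>F' = exp h\<close>, at a doubling point of
  \<open>\<bar>F'\<bar> / sqrt (1 + \<bar>F\<bar>\<^sup>2)\<close>. The expression inside the norm on the left-hand side of the last condition
  is the Schwarzian of \<open>a + F\<^sup>m\<close>.
\<close>
definition one_root_rescaling ::
    "complex \<Rightarrow> nat \<Rightarrow> real \<Rightarrow> real \<Rightarrow> (complex \<Rightarrow> complex) \<Rightarrow> (complex \<Rightarrow> complex) \<Rightarrow> bool" where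
  "one_root_rescaling a m N \<rho> F h \<longleftrightarrow>
     F holomorphic_on UNIV \<and> h holomorphic_on UNIV \<and> (\<forall>z. deriv F z = exp (h z)) \<and>
     (norm (deriv F 0))\<^sup>2 = 1 + (norm (F 0))\<^sup>2 \<and>
     (\<forall>z. norm z \<le> N \<longrightarrow> (norm (deriv F z))\<^sup>2 \<le> 4 * (1 + (norm (F z))\<^sup>2)) \<and>
     0 < \<rho> \<and> \<rho> * N \<le> 1 \<and>
     (\<forall>z. F z \<noteq> 0 \<longrightarrow>
        norm (deriv (deriv h) z - (deriv h z)\<^sup>2 / 2 - (of_nat m ^ 2 - 1) / 2 * (deriv F z / F z)\<^sup>2) ^ p
          = \<rho> ^ (2 * p) * norm (rhs (a + F z ^ m)))"

text \<open>
  Write \<open>\<phi> = F'' / F'\<close>, \<open>y = F' / F\<close> and \<open>k = (m\<^sup>2 - 1) / 2\<close>. The growth condition and the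
  Borel-Caratheodory inequality for \<open>h\<close> make \<open>\<phi>\<close> bounded and slowly varying near \<open>0\<close>. On a small disc where \<open>F\<close> is not
  small the right-hand side is negligible, hence so is \<open>k y\<^sup>2 + \<phi>\<^sup>2 / 2\<close>, and by Cauchy's estimate its
  derivative, which by \<open>y' = y (\<phi> - y)\<close> is \<open>2 k y\<^sup>2 (\<phi> - y)\<close> up to a small term. As \<open>\<bar>y\<bar>\<close> is bounded below, this is
  excluded by \<open>no_almost_solution\<close>.
\<close>
lemma one_root_rescaling_impossible:
  assumes deg: "degree P \<le> degree Q" and a: "\<And>w. poly Q w = 0 \<Longrightarrow> w = a" and m: "m \<ge> (2::nat)"
  obtains N where "N > 0" "\<And>\<rho> F h. \<not> one_root_rescaling a m N \<rho> F h"
proof -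
  define k where "k = ((real m)\<^sup>2 - 1) / 2"
  have "2\<^sup>2 \<le> (real m)\<^sup>2" using m by (intro power_mono) auto
  then have k: "k > 0" by (simp add: k_def)
  have kc: "(of_nat m ^ 2 - 1) / 2 = complex_of_real k" by (simp add: k_def)
  obtain \<epsilon> where \<epsilon>: "\<epsilon> > 0" "\<And>y \<phi> :: complex. 1 / 18 \<le> norm y \<Longrightarrow>
     norm (of_real k * y\<^sup>2 + \<phi>\<^sup>2 / 2) \<le> \<epsilon> \<Longrightarrow> norm (y\<^sup>2 * (\<phi> - y)) \<le> \<epsilon> \<Longrightarrow> False"
    using no_almost_solution[OF k] by metis
  \<comment> \<open>The derivative of \<open>F\<close> keeps at least half of its size at \<open>0\<close> on the disc of radius \<open>\<eta>\<close>, because the second derivative is at most \<open>1296 A\<close> there.\<close>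
  define \<eta> where "\<eta> = (1 / 2592 :: real)"
  define r where "r = \<eta> / 144"
  have \<eta>: "\<eta> > 0" "r > 0" by (auto simp: \<eta>_def r_def)
  have "(\<eta> / 8) ^ m > 0" using \<eta> by simp
  from rational_bounded[OF Q_nz deg this]
  obtain C where C: "C > 0" "\<And>w. (\<And>x. poly Q x = 0 \<Longrightarrow> (\<eta> / 8) ^ m \<le> dist w x) \<Longrightarrow> norm (rhs w) \<le> C"
    unfolding rhs_def by metis
  \<comment> \<open>\<open>K / N\<close> will bound \<open>k y\<^sup>2 + \<phi>\<^sup>2 / 2\<close>, and \<open>K2 / N\<close> will bound \<open>y\<^sup>2 (\<phi> - y)\<close>.\<close>
  define K where "K = 289 + C"
  define K2 where "K2 = (K / r + 72 * 288) / (2 * k)"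
  define N where "N = K / \<epsilon> + K2 / \<epsilon> + 4"
  have K: "K > 0" "K2 > 0" using C k \<eta> by (auto simp: K_def K2_def intro!: divide_pos_pos add_pos_pos)
  have N: "N \<ge> 4" "K / N \<le> \<epsilon>" "K2 / N \<le> \<epsilon>"
  proof -
    have "0 \<le> K / \<epsilon>" "0 \<le> K2 / \<epsilon>" using K \<epsilon>(1) by simp_all
    then have "4 \<le> N" "K / \<epsilon> \<le> N" "K2 / \<epsilon> \<le> N" unfolding N_def by linarith+
    then show "N \<ge> 4" "K / N \<le> \<epsilon>" "K2 / N \<le> \<epsilon>"
      using \<epsilon>(1) by (auto simp: divide_le_eq mult.commute)
  qed
  show ?thesis
  proof (rule that[of N])
    show "N > 0" using N by simp
    fix F h :: "complex \<Rightarrow> complex" and \<rho> :: real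
    show "\<not> one_root_rescaling a m N \<rho> F h"
    proof
      assume "one_root_rescaling a m N \<rho> F h"
      then have F: "F holomorphic_on UNIV" and h: "h holomorphic_on UNIV"
        and F': "\<And>z. deriv F z = exp (h z)" and F0: "(norm (deriv F 0))\<^sup>2 = 1 + (norm (F 0))\<^sup>2"
        and grow: "\<And>z. norm z \<le> N \<Longrightarrow> (norm (deriv F z))\<^sup>2 \<le> 4 * (1 + (norm (F z))\<^sup>2)"
        and \<rho>: "0 < \<rho>" "\<rho> * N \<le> 1"
        and eq: "\<And>z. F z \<noteq> 0 \<Longrightarrow>
            norm (deriv (deriv h) z - (deriv h z)\<^sup>2 / 2 - (of_nat m ^ 2 - 1) / 2 * (deriv F z / F z)\<^sup>2) ^ p
              = \<rho> ^ (2 * p) * norm (rhs (a + F z ^ m))"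
        unfolding one_root_rescaling_def by blast+
      define A where "A = norm (deriv F 0)"
      have A0: "A > 0" by (simp add: A_def F')
      have A2: "1 + (norm (F 0))\<^sup>2 = A\<^sup>2" unfolding A_def by (rule F0[symmetric])
      then have "1\<^sup>2 \<le> A\<^sup>2" by (metis le_add_same_cancel1 one_power2 zero_le_power2)
      then have A1: "1 \<le> A" by (rule power2_le_imp_le) (use A0 in simp)
      define \<phi> where "\<phi> = deriv h"
      have \<phi>: "\<phi> holomorphic_on UNIV" unfolding \<phi>_def by (rule entire_deriv[OF h])
      have F'': "deriv (deriv F) z = \<phi> z * deriv F z" for z
      proof -
        have "((\<lambda>z. exp (h z)) has_field_derivative exp (h z) * deriv h z) (at z)"
          by (auto intro!: derivative_eq_intros entire_DERIV[OF h])
        moreover have "deriv F = (\<lambda>z. exp (h z))" using F' by auto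
        ultimately show ?thesis by (simp add: DERIV_imp_deriv \<phi>_def mult.commute)
      qed
      have gw: "1 + (norm (F \<zeta>))\<^sup>2 \<le> (A * exp (2 * norm \<zeta>))\<^sup>2" if "norm \<zeta> \<le> N" for \<zeta>
      proof -
        have "1 + (norm (F \<zeta>))\<^sup>2 \<le> (1 + (norm (F 0))\<^sup>2) * exp (2 * 2 * norm \<zeta>)"
          by (rule Gronwall_growth[OF F]) (use grow that in auto)
        also have "\<dots> = (A * exp (2 * norm \<zeta>))\<^sup>2"
          unfolding A2 by (simp add: power_mult_distrib flip: exp_double)
        finally show ?thesis .
      qed
      have F_le: "norm (F \<zeta>) \<le> A * exp (2 * norm \<zeta>)" if "norm \<zeta> \<le> N" for \<zeta>
      proof (rule power2_le_imp_le)
        show "(norm (F \<zeta>))\<^sup>2 \<le> (A * exp (2 * norm \<zeta>))\<^sup>2" using gw[OF that] by linarith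
      qed (use A0 in simp)
      have F'_le: "norm (deriv F \<zeta>) \<le> 2 * (A * exp (2 * norm \<zeta>))" if "norm \<zeta> \<le> N" for \<zeta>
      proof (rule power2_le_imp_le)
        show "(norm (deriv F \<zeta>))\<^sup>2 \<le> (2 * (A * exp (2 * norm \<zeta>)))\<^sup>2"
          using grow[OF that] gw[OF that] power_mult_distrib[of 2 "A * exp (2 * norm \<zeta>)" 2] by simp
      qed (use A0 in simp)
      have \<phi>72: "norm (\<phi> \<zeta>) \<le> 72" if "norm \<zeta> \<le> N / 2" for \<zeta>
      proof -
        have "norm (deriv h \<zeta>) \<le> 24 * (2 * N + 2) / N"
        proof (rule Borel_Caratheodory_derivative[OF h])
          show "Re (h z) < Re (h 0) + (2 * N + 2)" if "norm z < N" for z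
          proof -
            have "exp (Re (h z)) = norm (deriv F z)" by (simp add: F')
            also have "\<dots> \<le> 2 * (A * exp (2 * norm z))" using that by (intro F'_le) simp
            also have "\<dots> \<le> 2 * (A * exp (2 * N))" using that A0 by simp
            also have "\<dots> < exp 2 * (A * exp (2 * N))"
              using A0 exp_ge_add_one_self[of "2 :: real"] by (intro mult_strict_right_mono) auto
            also have "\<dots> = exp (Re (h 0) + (2 * N + 2))"
              by (simp add: A_def F' exp_add)
            finally show ?thesis by simp
          qed
        qed (use N that in auto)
        also have "\<dots> \<le> 72" using N by (simp add: divide_le_eq)
        finally show ?thesis by (simp add: \<phi>_def)
      qed
      have \<phi>': "norm (deriv \<phi> \<zeta>) \<le> 288 / N" if "norm \<zeta> \<le> 1" for \<zeta>
      proof -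
        have "norm (deriv \<phi> \<zeta>) \<le> 72 / (N / 2 - 1)"
          by (rule slowly_varying(1)[OF \<phi> _ _ _ that]) (use N \<phi>72 in auto)
        also have "\<dots> \<le> 72 / (N / 4)" using N by (intro divide_left_mono) auto
        finally show ?thesis by simp
      qed
      have e9: "exp (2 * norm \<zeta>) \<le> 9" if "norm \<zeta> \<le> 1" for \<zeta> :: complex
      proof -
        have "exp (2 * norm \<zeta>) \<le> exp (2 * 1)" using that by simp
        also have "\<dots> = (exp 1)\<^sup>2" by (metis exp_double mult_1_right)
        also have "\<dots> \<le> 3\<^sup>2" using exp_le by (intro power_mono) auto
        finally show ?thesis by simp
      qed
      have F9: "norm (F \<zeta>) \<le> 9 * A" and F18: "norm (deriv F \<zeta>) \<le> 18 * A" if "norm \<zeta> \<le> 1" for \<zeta>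
      proof -
        have "A * exp (2 * norm \<zeta>) \<le> A * 9" using e9[OF that] A0 by (intro mult_left_mono) auto
        moreover have "norm \<zeta> \<le> N" using that N by linarith
        ultimately show "norm (F \<zeta>) \<le> 9 * A" "norm (deriv F \<zeta>) \<le> 18 * A"
          using F_le[of \<zeta>] F'_le[of \<zeta>] by linarith+
      qed
      have F'_ge: "A / 2 \<le> norm (deriv F \<zeta>)" if "norm \<zeta> \<le> \<eta>" for \<zeta>
      proof -
        have "norm (deriv F \<zeta> - deriv F 0) \<le> 1296 * A * norm (\<zeta> - 0)"
        proof (rule field_differentiable_bound[of "cball 0 \<eta>" _ "deriv (deriv F)"])
          show "norm (deriv (deriv F) z) \<le> 1296 * A" if "z \<in> cball 0 \<eta>" for z
          proof -
            have z: "norm z \<le> 1" "norm z \<le> N / 2" using that N by (auto simp: \<eta>_def)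
            have "norm (deriv (deriv F) z) = norm (\<phi> z) * norm (deriv F z)" by (simp add: F'' norm_mult)
            also have "\<dots> \<le> 72 * (18 * A)" by (intro mult_mono \<phi>72 F18 z) auto
            finally show ?thesis by simp
          qed
        qed (use that \<eta> in \<open>auto intro: has_field_derivative_at_within entire_DERIV[OF entire_deriv[OF F]]\<close>)
        also have "\<dots> \<le> 1296 * A * \<eta>" using that A0 by (intro mult_left_mono) auto
        also have "\<dots> = A / 2" by (simp add: \<eta>_def)
        finally show ?thesis
          using norm_triangle_ineq2[of "deriv F 0" "deriv F \<zeta>"] by (simp add: A_def norm_minus_commute)
      qed
      \<comment> \<open>Moving away from \<open>0\<close>, where \<open>F\<close> may be small, to a point where it is not.\<close>
      obtain \<zeta>1 where \<zeta>1: "norm \<zeta>1 = \<eta> / 2" "A * \<eta> / 4 < norm (F \<zeta>1)"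
      proof -
        have "\<exists>\<zeta>1. norm \<zeta>1 = \<eta> / 2 \<and> A * \<eta> / 4 < norm (F \<zeta>1)"
        proof (rule ccontr)
          assume "\<not> ?thesis"
          then have "norm (F x) \<le> A * \<eta> / 4" if "norm (0 - x) = \<eta> / 2" for x
            using that by (auto simp: not_less)
          then have "norm ((deriv ^^ 1) F 0) \<le> fact 1 * (A * \<eta> / 4) / (\<eta> / 2) ^ 1"
            by (intro Cauchy_inequality holomorphic_on_imp_continuous_on holomorphic_on_subset[OF F])
              (use \<eta> in auto)
          then have "A \<le> A / 2" using \<eta> by (simp add: A_def)
          then show False using A0 by simp
        qed
        then show ?thesis using that by blast
      qed
      have disc: "norm \<zeta> \<le> \<eta>" "\<eta> / 8 \<le> norm (F \<zeta>)" if "dist \<zeta>1 \<zeta> \<le> r" for \<zeta>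
      proof -
        have n: "norm \<zeta> \<le> \<eta>"
          using norm_triangle_sub[of \<zeta> \<zeta>1] that \<zeta>1(1) \<eta>(1) by (simp add: dist_norm norm_minus_commute r_def)
        then show "norm \<zeta> \<le> \<eta>" .
        have "norm (F \<zeta> - F \<zeta>1) \<le> 18 * A * norm (\<zeta> - \<zeta>1)"
        proof (rule field_differentiable_bound[of "cball 0 1" _ "deriv F"])
          show "\<zeta> \<in> cball 0 1" "\<zeta>1 \<in> cball 0 1" using n \<zeta>1(1) by (auto simp: \<eta>_def)
        qed (use F18 in \<open>auto intro: has_field_derivative_at_within entire_DERIV[OF F]\<close>)
        also have "\<dots> \<le> 18 * A * r"
          using that A0 by (intro mult_left_mono) (auto simp: dist_norm norm_minus_commute)
        also have "\<dots> = A * \<eta> / 8" by (simp add: r_def)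
        finally have "norm (F \<zeta>1) - norm (F \<zeta>) \<le> A * \<eta> / 8"
          using norm_triangle_ineq2[of "F \<zeta>1" "F \<zeta>"] by (simp add: norm_minus_commute)
        then have "A * \<eta> / 8 \<le> norm (F \<zeta>)" using \<zeta>1(2) by linarith
        moreover have "1 * (\<eta> / 8) \<le> A * (\<eta> / 8)" using A1 \<eta> by (intro mult_right_mono) auto
        ultimately show "\<eta> / 8 \<le> norm (F \<zeta>)" by simp
      qed
      define y where "y = (\<lambda>z. deriv F z / F z)"
      define \<Psi> where "\<Psi> = (\<lambda>z. of_real k * (y z)\<^sup>2 + (\<phi> z)\<^sup>2 / 2)"
      have \<Psi>_le: "norm (\<Psi> \<zeta>) \<le> K / N" if "dist \<zeta>1 \<zeta> \<le> r" for \<zeta>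
      proof -
        note d = disc[OF that]
        have nz: "F \<zeta> \<noteq> 0" using d(2) \<eta> by auto
        define S where "S = deriv \<phi> \<zeta> - (\<phi> \<zeta>)\<^sup>2 / 2 - of_real k * (y \<zeta>)\<^sup>2"
        have "(\<eta> / 8) ^ m \<le> norm (F \<zeta>) ^ m" using d(2) \<eta> by (intro power_mono) auto
        then have "norm (rhs (a + F \<zeta> ^ m)) \<le> C"
          using a by (intro C(2)) (auto simp: dist_norm norm_power)
        moreover have "norm S ^ p = \<rho> ^ (2 * p) * norm (rhs (a + F \<zeta> ^ m))"
          using eq[OF nz] unfolding kc by (simp add: S_def \<phi>_def y_def)
        ultimately have "norm S ^ p \<le> \<rho> ^ (2 * p) * C" using \<rho> by simp
        also have "\<dots> \<le> \<rho> ^ (2 * p) * (C + 1) ^ p"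
        proof (intro mult_left_mono)
          have "C + 1 \<le> (C + 1) ^ p" using C p_pos by (intro self_le_power) auto
          then show "C \<le> (C + 1) ^ p" by linarith
        qed (use \<rho> in auto)
        also have "\<dots> = (\<rho>\<^sup>2 * (C + 1)) ^ p" by (simp add: power_mult_distrib power_mult)
        finally have "norm S ^ Suc (p - 1) \<le> (\<rho>\<^sup>2 * (C + 1)) ^ Suc (p - 1)"
          using p_pos by simp
        then have "norm S \<le> \<rho>\<^sup>2 * (C + 1)"
          by (rule power_le_imp_le_base) (use C in simp)
        also have "\<dots> \<le> 1 / N * (C + 1)"
        proof (intro mult_right_mono)
          have \<rho>N: "\<rho> \<le> 1 / N" using \<rho> N by (simp add: le_divide_eq)
          also have "1 / N \<le> 1" using N by simp
          finally have "\<rho> * \<rho> \<le> \<rho> * 1" using \<rho> by (intro mult_left_mono) auto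
          then show "\<rho>\<^sup>2 \<le> 1 / N" using \<rho>N by (simp add: power2_eq_square)
        qed (use C in auto)
        finally have S: "norm S \<le> (C + 1) / N" by simp
        have "\<Psi> \<zeta> = deriv \<phi> \<zeta> - S" by (simp add: \<Psi>_def S_def)
        then have "norm (\<Psi> \<zeta>) \<le> norm (deriv \<phi> \<zeta>) + norm S" by (simp add: norm_triangle_ineq4)
        also have "\<dots> \<le> 288 / N + (C + 1) / N"
          using d(1) by (intro add_mono \<phi>' S) (simp add: \<eta>_def)
        also have "\<dots> = K / N" by (simp add: K_def add_divide_distrib)
        finally show ?thesis .
      qed
      define U where "U = {z. F z \<noteq> 0}"
      have "open U"
        unfolding U_def using F by (intro open_Collect_neq continuous_intros holomorphic_on_imp_continuous_on)
      moreover have "F x \<noteq> 0" if "x \<in> cball \<zeta>1 r" for x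
        using disc(2)[of x] that \<eta> by auto
      ultimately have U: "open U" "cball \<zeta>1 r \<subseteq> U" by (auto simp: U_def)
      have y_hol: "y holomorphic_on U"
        unfolding y_def U_def by (intro holomorphic_intros holomorphic_on_subset[OF F] holomorphic_on_subset[OF entire_deriv[OF F]]) auto
      have \<Psi>_hol: "\<Psi> holomorphic_on U"
        unfolding \<Psi>_def by (intro holomorphic_intros y_hol holomorphic_on_subset[OF \<phi>]) auto
      have c1: "\<zeta>1 \<in> U" using U(2) \<eta> by auto
      have "norm ((deriv ^^ 1) \<Psi> \<zeta>1) \<le> fact 1 * (K / N) / r ^ 1"
      proof (rule Cauchy_inequality)
        show "\<Psi> holomorphic_on ball \<zeta>1 r" by (rule holomorphic_on_subset[OF \<Psi>_hol]) (use U in auto)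
        show "continuous_on (cball \<zeta>1 r) \<Psi>"
          by (rule holomorphic_on_imp_continuous_on[OF holomorphic_on_subset[OF \<Psi>_hol U(2)]])
      qed (use \<eta> \<Psi>_le in \<open>auto simp: dist_norm\<close>)
      then have d\<Psi>: "norm (deriv \<Psi> \<zeta>1) \<le> K / N / r" by simp
      have dy: "(y has_field_derivative y \<zeta>1 * (\<phi> \<zeta>1 - y \<zeta>1)) (at \<zeta>1)"
      proof -
        have "(u * d * x - d * d) / (x * x) = d / x * (u - d / x)" if "x \<noteq> 0" for u d x :: complex
          using that by (simp add: field_simps)
        then show ?thesis
          using DERIV_divide[OF entire_DERIV[OF entire_deriv[OF F]] entire_DERIV[OF F], of \<zeta>1] c1
          by (simp add: F'' y_def U_def)
      qed
      have "deriv \<Psi> \<zeta>1 = of_real k * (2 * y \<zeta>1 * (y \<zeta>1 * (\<phi> \<zeta>1 - y \<zeta>1))) + \<phi> \<zeta>1 * deriv \<phi> \<zeta>1"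
        unfolding \<Psi>_def by (rule DERIV_imp_deriv)
          (auto intro!: derivative_eq_intros dy entire_DERIV[OF \<phi>])
      then have "of_real (2 * k) * ((y \<zeta>1)\<^sup>2 * (\<phi> \<zeta>1 - y \<zeta>1)) = deriv \<Psi> \<zeta>1 - \<phi> \<zeta>1 * deriv \<phi> \<zeta>1"
        by (simp add: power2_eq_square mult_ac)
      then have "norm (of_real (2 * k) * ((y \<zeta>1)\<^sup>2 * (\<phi> \<zeta>1 - y \<zeta>1))) \<le> norm (deriv \<Psi> \<zeta>1) + norm (\<phi> \<zeta>1) * norm (deriv \<phi> \<zeta>1)"
        by (metis norm_mult norm_triangle_ineq4)
      also have "\<dots> \<le> K / N / r + 72 * (288 / N)"
        using \<zeta>1(1) N by (intro add_mono d\<Psi> mult_mono \<phi>72 \<phi>') (auto simp: \<eta>_def)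
      also have "norm (of_real (2 * k) * ((y \<zeta>1)\<^sup>2 * (\<phi> \<zeta>1 - y \<zeta>1))) = 2 * k * norm ((y \<zeta>1)\<^sup>2 * (\<phi> \<zeta>1 - y \<zeta>1))"
        using k by (simp only: norm_mult norm_of_real)
      finally have "norm ((y \<zeta>1)\<^sup>2 * (\<phi> \<zeta>1 - y \<zeta>1)) \<le> (K / N / r + 72 * (288 / N)) / (2 * k)"
        using k by (simp add: le_divide_eq mult.commute)
      also have "\<dots> = K2 / N" by (simp add: K2_def add_divide_distrib divide_simps)
      finally have b: "norm ((y \<zeta>1)\<^sup>2 * (\<phi> \<zeta>1 - y \<zeta>1)) \<le> \<epsilon>" using N(3) by linarith
      have yn: "1 / 18 \<le> norm (y \<zeta>1)"
      proof -
        have "(A / 2) / (9 * A) \<le> norm (deriv F \<zeta>1) / norm (F \<zeta>1)"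
          using c1 \<zeta>1(1) A0 by (intro frac_le F'_ge F9) (auto simp: U_def \<eta>_def)
        then show ?thesis using A0 by (simp add: y_def norm_divide)
      qed
      have "norm (\<Psi> \<zeta>1) \<le> \<epsilon>" using \<Psi>_le[of \<zeta>1] \<eta> N(2) by simp
      then show False using \<epsilon>(2)[OF yn _ b] by (simp add: \<Psi>_def)
    qed
  qed
qed

end

section \<open>Reduction to exponentials\<close>

text \<open>
  The growth condition gives \<open>\<bar>F'\<bar>\<close> at most exponential growth around every point, at a rate independent of
  the point; the Borel-Caratheodory inequality on a large disc then bounds \<open>h'\<close> at its centre. The radius is
  taken so large that the point-dependent constant \<open>c\<close> is absorbed.
\<close>
lemma bounded_log_derivative:
  fixes F h :: "complex \<Rightarrow> complex"
  assumes F: "F holomorphic_on UNIV" and h: "h holomorphic_on UNIV"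
    and F': "\<And>z. deriv F z = exp (h z)" and "N > 0"
    and grow: "\<And>z. (norm (deriv F z))\<^sup>2 \<le> N\<^sup>2 * (1 + (norm (F z))\<^sup>2)"
  shows "norm (deriv h z0) \<le> 24 * (N + 2)"
proof -
  define G where "G = (\<lambda>\<zeta>. F (z0 + 1 * \<zeta>))"
  define g where "g = (\<lambda>\<zeta>. h (z0 + 1 * \<zeta>))"
  have G: "G holomorphic_on UNIV" unfolding G_def using entire_rescale[OF F, of 1 z0 1] by simp
  have g: "g holomorphic_on UNIV" unfolding g_def using entire_rescale[OF h, of 1 z0 1] by simp
  have dG: "deriv G \<zeta> = deriv F (z0 + \<zeta>)" for \<zeta>
    unfolding G_def using deriv_rescale[OF F, of 1 z0 1] by simp
  have dg: "deriv g 0 = deriv h z0"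
    unfolding g_def using deriv_rescale[OF h, of 1 z0 1] by simp
  define A where "A = sqrt (1 + (norm (F z0))\<^sup>2)"
  have A: "A \<ge> 1" "A\<^sup>2 = 1 + (norm (F z0))\<^sup>2" by (simp_all add: A_def)
  define c where "c = ln (N * A) - Re (h z0)"
  define R where "R = \<bar>c\<bar> + 1"
  have "norm (deriv g 0) \<le> 24 * (N * R + \<bar>c\<bar> + 1) / R"
  proof (rule Borel_Caratheodory_derivative[OF g])
    show "R > 0" by (simp add: R_def)
    show "0 < N * R + \<bar>c\<bar> + 1" using \<open>N > 0\<close> by (simp add: R_def add_nonneg_pos)
    show "Re (g \<zeta>) < Re (g 0) + (N * R + \<bar>c\<bar> + 1)" if "norm \<zeta> < R" for \<zeta>
    proof -
      have "1 + (norm (G \<zeta>))\<^sup>2 \<le> (1 + (norm (G 0))\<^sup>2) * exp (2 * N * norm \<zeta>)"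
        by (rule Gronwall_growth[OF G]) (use \<open>N > 0\<close> grow in \<open>simp_all add: dG, simp add: G_def\<close>)
      also have "\<dots> = (A * exp (N * norm \<zeta>))\<^sup>2"
        by (simp add: power_mult_distrib A G_def mult.assoc flip: exp_double)
      finally have gw: "1 + (norm (G \<zeta>))\<^sup>2 \<le> (A * exp (N * norm \<zeta>))\<^sup>2" .
      have "(norm (deriv G \<zeta>))\<^sup>2 \<le> N\<^sup>2 * (1 + (norm (G \<zeta>))\<^sup>2)"
        unfolding dG using grow[of "z0 + \<zeta>"] by (simp add: G_def)
      also have "\<dots> \<le> N\<^sup>2 * (A * exp (N * norm \<zeta>))\<^sup>2" by (intro mult_left_mono gw) simp
      also have "\<dots> = (N * A * exp (N * norm \<zeta>))\<^sup>2" by (simp add: power_mult_distrib)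
      finally have "norm (deriv G \<zeta>) \<le> N * A * exp (N * norm \<zeta>)"
        by (rule power2_le_imp_le) (use A \<open>N > 0\<close> in simp)
      moreover have "norm (deriv G \<zeta>) = exp (Re (g \<zeta>))" by (simp add: dG F' g_def)
      moreover have "N * A * exp (N * norm \<zeta>) = exp (ln (N * A) + N * norm \<zeta>)"
        using A(1) \<open>N > 0\<close> by (simp add: exp_add)
      ultimately have "exp (Re (g \<zeta>)) \<le> exp (ln (N * A) + N * norm \<zeta>)" by simp
      then have "Re (g \<zeta>) \<le> ln (N * A) + N * norm \<zeta>" by simp
      also have "\<dots> \<le> ln (N * A) + N * R" using that \<open>N > 0\<close> by simp
      finally show ?thesis by (simp add: c_def g_def)
    qed
  qed (simp add: R_def)
  also have "\<dots> = 24 * (N + 1)"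
    by (simp add: R_def divide_simps) (simp add: algebra_simps add_eq_0_iff)
  also have "\<dots> \<le> 24 * (N + 2)" by simp
  finally show ?thesis by (simp add: dg)
qed

lemma affine_exp_if_log_derivative_const:
  fixes F :: "complex \<Rightarrow> complex"
  assumes F: "F holomorphic_on UNIV" and F'': "\<And>z. deriv (deriv F) z = \<alpha> * deriv F z"
  obtains \<beta> where "\<And>z. deriv F z = \<alpha> * F z + \<beta>"
proof -
  have "\<exists>\<beta>. \<forall>z\<in>UNIV. deriv F z - \<alpha> * F z = \<beta>"
    by (rule has_field_derivative_zero_constant)
      (auto intro!: derivative_eq_intros entire_DERIV[OF F] entire_DERIV[OF entire_deriv[OF F]] simp: F'')
  then obtain \<beta> where "\<And>z. deriv F z - \<alpha> * F z = \<beta>" by auto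
  then show ?thesis using that[of \<beta>] by (simp add: diff_eq_eq add.commute)
qed

lemma entire_infinite_range:
  fixes F :: "complex \<Rightarrow> complex"
  assumes F: "F holomorphic_on UNIV" and nz: "deriv F z \<noteq> 0"
  shows "infinite (range F)"
proof
  assume "finite (range F)"
  then have "F constant_on UNIV"
    using continuous_finite_range_constant[OF connected_UNIV holomorphic_on_imp_continuous_on[OF F]] by simp
  then obtain c where "F = (\<lambda>_. c)" by (auto simp: constant_on_def)
  then show False using nz by simp
qed

text \<open>
  This is the equation for \<open>F = A exp (\<alpha> z) + B\<close> with denominators cleared, read as a polynomial
  identity in the value \<open>x\<close> of \<open>F\<close>. For \<open>B = 0\<close> the right-hand side is a monomial and \<open>P a\<close> would vanish.
  Otherwise comparing the orders at \<open>x = 0\<close> reduces it to \<open>P (a + x\<^sup>m) = \<kappa> S\<^sup>p\<close> with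
  \<open>S = x\<^sup>2 + 2 k (x - B)\<^sup>2\<close>; the derivative of the left-hand side vanishes at \<open>0\<close>, that of the right-hand
  side does not.
\<close>
lemma no_power_substitution_identity:
  fixes P :: "complex poly" and k B \<kappa> :: complex
  assumes m: "m \<ge> 2" and p: "p > 0" and q: "q > 0" and Pa: "poly P a \<noteq> 0" and k: "k \<noteq> 0" "1 + 2 * k \<noteq> 0"
    and "infinite X"
    and id: "\<And>x. x \<in> X \<Longrightarrow> poly P (a + x ^ m) * x ^ (2 * p) = \<kappa> * x ^ (m * q) * (x\<^sup>2 + 2 * k * (x - B)\<^sup>2) ^ p"
  shows False
proof -
  define L where "L = P \<circ>\<^sub>p ([:a:] + monom 1 m)"
  define S where "S = monom 1 2 + smult (2 * k) ([:- B, 1:]\<^sup>2)"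
  have L: "poly L x = poly P (a + x ^ m)" for x by (simp add: L_def poly_pcompose poly_monom)
  have S: "poly S x = x\<^sup>2 + 2 * k * (x - B)\<^sup>2" for x by (simp add: S_def poly_monom)
  have L0: "poly L 0 \<noteq> 0" using Pa m by (simp add: L power_0_left)
  define E where "E = L * monom 1 (2 * p) - smult \<kappa> (monom 1 (m * q) * S ^ p)"
  have "X \<subseteq> {x. poly E x = 0}"
    using id by (auto simp: E_def L S poly_monom mult_ac)
  then have "E = 0" using \<open>infinite X\<close> poly_roots_finite finite_subset by blast
  then have eq: "L * monom 1 (2 * p) = smult \<kappa> (monom 1 (m * q) * S ^ p)"
    by (simp add: E_def)
  have mono: "monom 1 (i + j) = monom 1 i * (monom 1 j :: complex poly)" for i j by (simp add: mult_monom)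
  have mz: "monom 1 i \<noteq> (0 :: complex poly)" for i by simp
  show False
  proof (cases "B = 0")
    case True
    have "S = smult (1 + 2 * k) (monom 1 2)"
      by (rule poly_ext) (simp add: S True poly_monom algebra_simps)
    then have "S ^ p = smult ((1 + 2 * k) ^ p) (monom 1 (2 * p))"
      by (simp add: smult_power monom_power)
    then have "monom 1 (2 * p) * L = monom 1 (2 * p) * smult (\<kappa> * (1 + 2 * k) ^ p) (monom 1 (m * q))"
      using eq by (simp add: mult_ac)
    then have "L = smult (\<kappa> * (1 + 2 * k) ^ p) (monom 1 (m * q))"
      using mz by (metis mult_cancel_left)
    then show False using L0 m q by (simp add: poly_monom)
  next
    case False
    have S0: "poly S 0 \<noteq> 0" using False k by (simp add: S)
    consider "2 * p < m * q" | "m * q < 2 * p" | "m * q = 2 * p" by linarith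
    then show False
    proof cases
      case 1
      then obtain j where j: "m * q = 2 * p + j" "j > 0" by (metis less_imp_add_positive)
      have "monom 1 (2 * p) * L = monom 1 (2 * p) * smult \<kappa> (monom 1 j * S ^ p)"
        using eq unfolding j(1) mono by (simp add: mult_ac)
      then have "L = smult \<kappa> (monom 1 j * S ^ p)" using mz by (metis mult_cancel_left)
      then show False using L0 j by (simp add: poly_monom)
    next
      case 2
      then obtain j where j: "2 * p = m * q + j" "j > 0" by (metis less_imp_add_positive)
      have "monom 1 (m * q) * (L * monom 1 j) = monom 1 (m * q) * smult \<kappa> (S ^ p)"
        using eq unfolding j(1) mono by (simp add: mult_ac)
      then have "L * monom 1 j = smult \<kappa> (S ^ p)" using mz by (metis mult_cancel_left)
      from arg_cong[OF this, of "\<lambda>p. poly p 0"] have "\<kappa> = 0"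
        using S0 j by (simp add: poly_monom power_0_left)
      then have "L * monom 1 (2 * p) = 0" using eq by simp
      then show False using L0 mz by auto
    next
      case 3
      have "monom 1 (2 * p) * L = monom 1 (2 * p) * smult \<kappa> (S ^ p)"
        using eq unfolding 3 by (simp add: mult_ac)
      then have LS: "L = smult \<kappa> (S ^ p)" using mz by (metis mult_cancel_left)
      then have \<kappa>0: "\<kappa> \<noteq> 0" using L0 by auto
      have "poly (pderiv L) 0 = 0"
        using m by (simp add: L_def pderiv_pcompose pderiv_add pderiv_monom poly_monom)
      moreover have "poly (pderiv S) 0 = - 4 * k * B"
        by (simp add: S_def pderiv_add pderiv_monom pderiv_smult poly_monom power2_eq_square pderiv_mult pderiv_pCons)
      then have "poly (pderiv L) 0 = \<kappa> * (of_nat p * poly S 0 ^ (p - 1) * (- 4 * k * B))"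
        using p by (cases p) (simp_all add: LS pderiv_smult pderiv_power_Suc del: power_Suc)
      ultimately show False using \<kappa>0 p S0 k False by simp
    qed
  qed
qed

context autonomous_schwarzian
begin

lemma critical_value_is_pole:
  assumes sol: "entire_solution f" and "deriv f z = 0"
  shows "poly Q (f z) = 0"
proof -
  have f: "f holomorphic_on UNIV" "\<not> f constant_on UNIV" using sol by (auto simp: entire_solution_def)
  obtain m g h r where lpf: "local_power_form f z m g h r" using entire_local_form[OF f] .
  note l = local_power_formD[OF lpf]
  have "m \<noteq> 1" using l(2,12) l(6)[of z] assms(2) by auto
  then have "m * order (f z) Q = 2 * p" using l(1) ramification(2)[OF sol lpf] by simp
  then have "order (f z) Q \<noteq> 0" using p_pos by (cases "order (f z) Q = 0") simp_all
  then show ?thesis by (simp add: order_root)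
qed

text \<open>
  All points where \<open>f\<close> takes the value \<open>a\<close> have the same multiplicity \<open>2 * p div order a Q\<close>. If there are none, any exponent
  \<open>m \<ge> 2\<close> will do; the default value \<open>2\<close> ensures this bound.
\<close>
lemma one_root_power:
  assumes sol: "entire_solution f" and a: "\<And>w. poly Q w = 0 \<longleftrightarrow> w = a"
  obtains m F where "m \<ge> 2" "F holomorphic_on UNIV" "\<And>z. a + F z ^ m = f z" "\<And>z. deriv F z \<noteq> 0"
proof -
  have f: "f holomorphic_on UNIV" and nc: "\<not> f constant_on UNIV" using sol by (auto simp: entire_solution_def)
  have q: "order a Q > 0" using a[of a] Q_nz by (simp add: order_root)
  define m where "m = (if 2 * p div order a Q \<ge> 2 then 2 * p div order a Q else 2)"
  have m: "m \<ge> 2" by (simp add: m_def)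
  have df: "deriv (\<lambda>z. f z - a) = deriv f"
    by (auto intro!: ext DERIV_imp_deriv derivative_eq_intros entire_DERIV[OF f])
  have "\<exists>F. F holomorphic_on UNIV \<and> (\<forall>z. F z ^ m = f z - a) \<and> (\<forall>z. deriv F z \<noteq> 0)"
  proof (rule entire_root[of "\<lambda>z. f z - a" m])
    show "(\<lambda>z. f z - a) holomorphic_on UNIV" by (intro holomorphic_intros f)
    show "\<not> (\<lambda>z. f z - a) constant_on UNIV"
      using nc by (auto simp: constant_on_def) (metis diff_add_cancel)
    show "deriv (\<lambda>z. f z - a) z \<noteq> 0" if "f z - a \<noteq> 0" for z
      using critical_value_is_pole[OF sol, of z] a[of "f z"] that unfolding df by auto
    show "\<exists>g h r. local_power_form (\<lambda>z. f z - a) z m g h r" if fz: "f z - a = 0" for z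
    proof -
      obtain n g h r where lpf: "local_power_form f z n g h r" using entire_local_form[OF f nc] .
      have fa: "f z = a" using fz by simp
      have n2: "n \<ge> 2" using ramification(1)[OF sol lpf] a[of a] fa by simp
      have "2 * p div order a Q = n"
        using ramification(2)[OF sol lpf n2] fa q by (metis nonzero_mult_div_cancel_right not_less_zero)
      then have nm: "n = m" using n2 by (simp add: m_def)
      note l = local_power_formD[OF lpf, unfolded nm]
      have "local_power_form (\<lambda>z. f z - a) z m g h r"
        unfolding local_power_form_def df
      proof (intro conjI ballI l(1-4,6-8))
        show "f w - a = f z - a + (w - z) ^ m * g w" if "w \<in> ball z r" for w
          using l(5)[OF that] by (simp only: diff_add_eq)
      qed
      then show ?thesis by blast
    qed
  qed (use m in auto)
  then show ?thesis using that[OF m] by (auto simp: algebra_simps)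
qed

end

section \<open>One root in the denominator is impossible\<close>

context autonomous_schwarzian
begin

text \<open>
  Rescaling bounds \<open>\<bar>F'\<bar> / sqrt (1 + \<bar>F\<bar>\<^sup>2)\<close> for the root \<open>F\<close> of \<open>f - a\<close>. Therefore
  \<open>F'' / F'\<close> is bounded, hence a constant \<open>\<alpha>\<close>. For \<open>\<alpha> = 0\<close> the function \<open>f\<close> would be a polynomial; otherwise
  \<open>F' = \<alpha> (F - B)\<close>, and the equation becomes the impossible polynomial identity above.
\<close>
theorem one_root_impossible:
  assumes sol: "entire_solution f" and deg: "degree P \<le> degree Q"
    and a: "\<And>w. poly Q w = 0 \<longleftrightarrow> w = a" and trans: "\<not> (\<exists>q. f = poly q)"
  shows False
proof -
  obtain m F where m: "m \<ge> 2" and F: "F holomorphic_on UNIV" and f_eq: "\<And>z. a + F z ^ m = f z"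
    and F'nz: "\<And>z. deriv F z \<noteq> 0"
    by (rule one_root_power[OF sol a]) (rule that; assumption)
  have f_fun: "f = (\<lambda>z. a + F z ^ m)" using f_eq by auto
  obtain h where h: "h holomorphic_on UNIV" and F': "\<And>z. deriv F z = exp (h z)"
    using contractible_imp_holomorphic_log[OF entire_deriv[OF F] contractible_UNIV] F'nz by (metis UNIV_I)
  define \<phi> where "\<phi> = deriv h"
  have \<phi>: "\<phi> holomorphic_on UNIV" unfolding \<phi>_def by (rule entire_deriv[OF h])
  have F'': "deriv (deriv F) z = \<phi> z * deriv F z" for z
  proof -
    have "((\<lambda>z. exp (h z)) has_field_derivative exp (h z) * deriv h z) (at z)"
      by (auto intro!: derivative_eq_intros entire_DERIV[OF h])
    moreover have "deriv F = (\<lambda>z. exp (h z))" using F' by auto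
    ultimately show ?thesis by (simp add: DERIV_imp_deriv \<phi>_def mult.commute)
  qed
  have S: "(deriv \<phi> z - (\<phi> z)\<^sup>2 / 2 - (of_nat m ^ 2 - 1) / 2 * (deriv F z / F z)\<^sup>2) ^ p = rhs (a + F z ^ m)"
    if "F z \<noteq> 0" for z
  proof -
    have "deriv f z \<noteq> 0" "poly Q (f z) \<noteq> 0"
      using critical_value_is_pole[OF sol, of z] a[of "f z"] f_eq[of z] that by auto
    from solution_at_regular_point[OF sol this] show ?thesis
      unfolding f_fun using schwarzian_power[OF F \<phi> F'' F'nz _ that, of m a] m by simp
  qed
  have "\<And>w. poly Q w = 0 \<Longrightarrow> w = a" using a by blast
  then obtain N where N: "N > 0" and imp: "\<And>\<rho> F h. \<not> one_root_rescaling a m N \<rho> F h"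
    using one_root_rescaling_impossible[OF deg _ m, of a] by blast
  define \<mu> where "\<mu> = (\<lambda>z. norm (deriv F z) / sqrt (1 + (norm (F z))\<^sup>2))"
  have sq: "1 + (norm (F z))\<^sup>2 > 0" for z by (simp add: add_pos_nonneg)
  have \<mu>2: "(norm (deriv F z))\<^sup>2 = (\<mu> z)\<^sup>2 * (1 + (norm (F z))\<^sup>2)" for z
    using sq[of z] by (simp add: \<mu>_def power_divide)
  have \<mu>0: "\<mu> z \<ge> 0" for z by (simp add: \<mu>_def)
  have \<mu>_small: "\<mu> z < 2 * N" for z
  proof (rule ccontr)
    assume *: "\<not> \<mu> z < 2 * N"
    have "continuous_on UNIV \<mu>"
      unfolding \<mu>_def using sq by (intro continuous_intros holomorphic_on_imp_continuous_on F entire_deriv)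
        (simp add: less_imp_neq[symmetric])
    from doubling_point[OF this \<mu>0, of "2 * N" z] * N
    obtain z0 where z0: "2 * N \<le> \<mu> z0" "\<And>z. dist z0 z \<le> (2 * N) / (2 * \<mu> z0) \<Longrightarrow> \<mu> z \<le> 2 * \<mu> z0"
      by auto
    define \<rho> where "\<rho> = 1 / \<mu> z0"
    have \<mu>z0: "\<mu> z0 > 0" using z0(1) N by linarith
    have \<rho>: "\<rho> > 0" "\<rho> * N \<le> 1" using z0(1) N \<mu>z0 by (auto simp: \<rho>_def divide_le_eq)
    define c where "c = complex_of_real \<rho>"
    have c: "c \<noteq> 0" "norm c = \<rho>" using \<rho> by (auto simp: c_def)
    define G where "G = (\<lambda>\<zeta>. F (z0 + c * \<zeta>))"
    define g where "g = (\<lambda>\<zeta>. h (z0 + c * \<zeta>) + of_real (ln \<rho>))"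
    have dG: "deriv G = (\<lambda>\<zeta>. c * deriv F (z0 + c * \<zeta>))"
      unfolding G_def using deriv_rescale[OF F, of 1 z0 c] by simp
    have h1: "(\<lambda>\<zeta>. h (z0 + c * \<zeta>)) holomorphic_on UNIV" using entire_rescale[OF h, of 1 z0 c] by simp
    have dg: "deriv g = (\<lambda>\<zeta>. c * \<phi> (z0 + c * \<zeta>))"
    proof
      fix \<zeta>
      have "deriv (\<lambda>\<zeta>. h (z0 + c * \<zeta>)) = (\<lambda>\<zeta>. c * \<phi> (z0 + c * \<zeta>))"
        using deriv_rescale[OF h, of 1 z0 c] by (simp add: \<phi>_def)
      then have "((\<lambda>\<zeta>. h (z0 + c * \<zeta>)) has_field_derivative c * \<phi> (z0 + c * \<zeta>)) (at \<zeta>)"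
        using entire_DERIV[OF h1, of \<zeta>] by simp
      from DERIV_add[OF this DERIV_const[of "of_real (ln \<rho>)"]]
      show "deriv g \<zeta> = c * \<phi> (z0 + c * \<zeta>)" unfolding g_def by (simp add: DERIV_imp_deriv)
    qed
    have ddg: "deriv (deriv g) = (\<lambda>\<zeta>. c\<^sup>2 * deriv \<phi> (z0 + c * \<zeta>))"
      unfolding dg using deriv_rescale[OF \<phi>, of c z0 c] by (simp add: power2_eq_square)
    have "one_root_rescaling a m N \<rho> G g"
      unfolding one_root_rescaling_def
    proof (intro conjI allI impI)
      show "G holomorphic_on UNIV" unfolding G_def using entire_rescale[OF F, of 1] by simp
      show "g holomorphic_on UNIV" unfolding g_def by (intro holomorphic_intros h1)
      show "deriv G z = exp (g z)" for z
        using \<rho> by (simp add: dG g_def F' exp_add c_def exp_of_real)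
      show "(norm (deriv G 0))\<^sup>2 = 1 + (norm (G 0))\<^sup>2"
        unfolding dG using \<mu>z0 by (simp add: G_def norm_mult power_mult_distrib c \<mu>2 \<rho>_def power_divide)
      show "(norm (deriv G \<zeta>))\<^sup>2 \<le> 4 * (1 + (norm (G \<zeta>))\<^sup>2)" if "norm \<zeta> \<le> N" for \<zeta>
      proof -
        have "dist z0 (z0 + c * \<zeta>) = \<rho> * norm \<zeta>" by (simp add: dist_norm norm_mult c)
        also have "\<dots> \<le> (2 * N) / (2 * \<mu> z0)" using that \<mu>z0 by (simp add: \<rho>_def divide_right_mono)
        finally have "\<mu> (z0 + c * \<zeta>) \<le> 2 * \<mu> z0" by (rule z0(2))
        then have "\<rho> * \<mu> (z0 + c * \<zeta>) \<le> 2" using \<mu>z0 by (simp add: \<rho>_def divide_le_eq)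
        then have "(\<rho> * \<mu> (z0 + c * \<zeta>))\<^sup>2 \<le> 2\<^sup>2" using \<rho> \<mu>0 by (intro power_mono) auto
        then have "(\<rho> * \<mu> (z0 + c * \<zeta>))\<^sup>2 * (1 + (norm (G \<zeta>))\<^sup>2) \<le> 4 * (1 + (norm (G \<zeta>))\<^sup>2)"
          by (intro mult_right_mono) auto
        then show ?thesis
          unfolding dG by (simp add: norm_mult c power_mult_distrib \<mu>2 G_def mult.assoc)
      qed
      show "norm (deriv (deriv g) z - (deriv g z)\<^sup>2 / 2 - (of_nat m ^ 2 - 1) / 2 * (deriv G z / G z)\<^sup>2) ^ p
            = \<rho> ^ (2 * p) * norm (rhs (a + G z ^ m))" if "G z \<noteq> 0" for z
      proof -
        have Fz: "F (z0 + c * z) \<noteq> 0" using that by (simp add: G_def)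
        have Gz: "G z = F (z0 + c * z)" by (simp add: G_def)
        have "deriv (deriv g) z - (deriv g z)\<^sup>2 / 2 - (of_nat m ^ 2 - 1) / 2 * (deriv G z / G z)\<^sup>2
          = c\<^sup>2 * (deriv \<phi> (z0 + c * z) - (\<phi> (z0 + c * z))\<^sup>2 / 2
              - (of_nat m ^ 2 - 1) / 2 * (deriv F (z0 + c * z) / F (z0 + c * z))\<^sup>2)"
          unfolding ddg unfolding dg dG Gz by (simp add: power_mult_distrib power_divide right_diff_distrib)
        moreover have "norm (c\<^sup>2 * X) ^ p = \<rho> ^ (2 * p) * norm (X ^ p)" for X
          by (simp add: norm_mult norm_power c power_mult_distrib power_mult)
        ultimately show ?thesis
          unfolding Gz S[OF Fz, symmetric] by (simp only:)
      qed
    qed (use \<rho> in auto)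
    then show False using imp by blast
  qed
  have "(norm (deriv F z))\<^sup>2 \<le> (2 * N)\<^sup>2 * (1 + (norm (F z))\<^sup>2)" for z
    unfolding \<mu>2 using \<mu>_small[of z] \<mu>0[of z] N by (intro mult_right_mono power_mono) auto
  then have "norm (\<phi> z) \<le> 24 * (2 * N + 2)" for z
    unfolding \<phi>_def using N by (intro bounded_log_derivative[OF F h F']) auto
  then have "bounded (range \<phi>)" by (auto simp: bounded_iff)
  then obtain \<alpha> where \<alpha>: "\<And>z. \<phi> z = \<alpha>" using Liouville_theorem[OF \<phi>] by (auto simp: constant_on_def)
  have \<phi>_fun: "\<phi> = (\<lambda>_. \<alpha>)" using \<alpha> by auto
  have "deriv (deriv F) z = \<alpha> * deriv F z" for z using F'' \<alpha> by simp
  then obtain \<beta> where \<beta>: "\<And>z. deriv F z = \<alpha> * F z + \<beta>"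
    using affine_exp_if_log_derivative_const[OF F] by metis
  show False
  proof (cases "\<alpha> = 0")
    case True
    have "\<exists>\<gamma>. \<forall>z\<in>UNIV. F z - \<beta> * z = \<gamma>"
      by (rule has_field_derivative_zero_constant)
        (auto intro!: derivative_eq_intros entire_DERIV[OF F] simp: \<beta> True)
    then obtain \<gamma> where "\<And>z. F z - \<beta> * z = \<gamma>" by auto
    then have "F z = \<gamma> + \<beta> * z" for z by (metis diff_eq_eq)
    then have "f = poly ([:a:] + [:\<gamma>, \<beta>:] ^ m)" by (auto simp: f_fun fun_eq_iff mult.commute)
    then show False using trans by blast
  next
    case False
    define B where "B = - \<beta> / \<alpha>"
    have F'B: "deriv F z = \<alpha> * (F z - B)" for z using \<beta> False by (simp add: B_def algebra_simps)
    define k :: complex where "k = (of_nat m ^ 2 - 1) / 2"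
    have k1: "1 + 2 * k = of_nat (m ^ 2)" by (simp add: k_def field_simps)
    have k: "k \<noteq> 0" "1 + 2 * k \<noteq> 0"
    proof -
      show "1 + 2 * k \<noteq> 0" unfolding k1 of_nat_eq_0_iff using m by simp
      show "k \<noteq> 0"
      proof
        assume "k = 0"
        then have "(of_nat (m ^ 2) :: complex) = of_nat 1" using k1 by simp
        then have "m ^ 2 = 1" unfolding of_nat_eq_iff .
        then show False using m by simp
      qed
    qed
    have Qeq: "poly Q w = lead_coeff Q * (w - a) ^ order a Q" for w
    proof -
      have "poly Q w = poly (smult (lead_coeff Q) (\<Prod>z|poly Q z = 0. [:-z, 1:] ^ order z Q)) w"
        by (simp only: complex_poly_decompose)
      also have "{z. poly Q z = 0} = {a}" using a by auto
      finally show ?thesis by (simp add: algebra_simps)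
    qed
    have qpos: "order a Q > 0" using a[of a] Q_nz by (simp add: order_root)
    have lc: "lead_coeff Q \<noteq> 0" using Q_nz by simp
    have "infinite (range F - {0})" using entire_infinite_range[OF F F'nz] by simp
    then show False
    proof (rule no_power_substitution_identity[OF m p_pos qpos no_common_root[OF iffD2[OF a refl]] k])
      fix x assume "x \<in> range F - {0}"
      then obtain z where z: "x = F z" and x0: "x \<noteq> 0" by auto
      have "poly P (a + x ^ m) / (lead_coeff Q * x ^ (m * order a Q)) = (- \<alpha>\<^sup>2 / 2 - k * (\<alpha> * (x - B) / x)\<^sup>2) ^ p"
        using S[of z] x0 unfolding z \<phi>_fun F'B k_def rhs_def Qeq by (simp add: power_mult)
      also have "- \<alpha>\<^sup>2 / 2 - k * (\<alpha> * (x - B) / x)\<^sup>2 = - \<alpha>\<^sup>2 / 2 * (x\<^sup>2 + 2 * k * (x - B)\<^sup>2) / x\<^sup>2"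
      proof -
        have "- A / 2 - k * (A * Y / X) = - A / 2 * (X + 2 * k * Y) / X" if "X \<noteq> 0" for A X Y
          using that by (simp add: field_simps)
        from this[of "x\<^sup>2" "\<alpha>\<^sup>2" "(x - B)\<^sup>2"] show ?thesis
          using x0 by (simp add: power_mult_distrib power_divide)
      qed
      also have "\<dots> ^ p = (- \<alpha>\<^sup>2 / 2) ^ p * (x\<^sup>2 + 2 * k * (x - B)\<^sup>2) ^ p / x ^ (2 * p)"
        by (simp only: power_mult_distrib power_divide power_mult)
      finally show "poly P (a + x ^ m) * x ^ (2 * p) =
          (lead_coeff Q * (- \<alpha>\<^sup>2 / 2) ^ p) * x ^ (m * order a Q) * (x\<^sup>2 + 2 * k * (x - B)\<^sup>2) ^ p"
        using x0 lc by (simp add: divide_eq_eq eq_divide_eq mult_ac)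
    qed
  qed
qed

end

section \<open>Differential equations for the exponential and the sine\<close>

text \<open>
  Uniqueness for \<open>X' = A X\<close>, by means of the integrating factor.
\<close>
lemma linear_ode_zero:
  fixes X A :: "complex \<Rightarrow> complex"
  assumes X: "X holomorphic_on UNIV" and A: "A holomorphic_on UNIV"
    and ode: "\<And>z. deriv X z = A z * X z" and "X z0 = 0"
  shows "X z = 0"
proof -
  obtain B where B: "\<And>z. (B has_field_derivative A z) (at z)"
    using holomorphic_convex_primitive'[OF convex_UNIV open_UNIV A] by auto
  have "((\<lambda>z. X z * exp (- B z)) has_field_derivative 0) (at z)" for z
    by (auto intro!: derivative_eq_intros B entire_DERIV[OF X] simp: ode)
  then have "\<exists>c. \<forall>z\<in>UNIV. X z * exp (- B z) = c"
    by (intro has_field_derivative_zero_constant) auto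
  then obtain c where c: "\<And>z. X z * exp (- B z) = c" by auto
  have "c = 0" using c[of z0] assms(4) by simp
  then show ?thesis using c[of z] by simp
qed

lemma entire_eq_exp_if_log_derivative_const:
  fixes X :: "complex \<Rightarrow> complex"
  assumes X: "\<And>z. (X has_field_derivative \<beta> * X z) (at z)"
  shows "X z = X 0 * exp (\<beta> * z)"
proof -
  have "((\<lambda>z. X z * exp (- \<beta> * z)) has_field_derivative 0) (at z)" for z
    by (auto intro!: derivative_eq_intros X)
  then have "\<exists>c. \<forall>z\<in>UNIV. X z * exp (- \<beta> * z) = c"
    by (intro has_field_derivative_zero_constant) auto
  then obtain c where c: "\<And>z. X z * exp (- \<beta> * z) = c" by auto
  show ?thesis using c[of z] c[of 0] by (simp add: exp_minus field_simps)
qed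

text \<open>
  With \<open>\<beta>\<^sup>2 = - 2 c\<close> the equation reads \<open>\<phi>' = (\<phi> - \<beta>) (\<phi> + \<beta>) / 2\<close>, so a solution that takes one
  of the values \<open>\<beta>\<close>, \<open>- \<beta>\<close> is constant. If both are omitted, then \<open>(\<phi> - \<beta>) / (\<phi> + \<beta>)\<close> is a multiple of
  \<open>exp (\<beta> z)\<close> and takes the value one, which is absurd; for \<open>\<beta> = 0\<close> the function \<open>1 / \<phi> + z / 2\<close> is constant,
  which is absurd too.
\<close>
lemma entire_Riccati_constant:
  fixes \<phi> :: "complex \<Rightarrow> complex"
  assumes \<phi>: "\<phi> holomorphic_on UNIV" and ode: "\<And>z. deriv \<phi> z - (\<phi> z)\<^sup>2 / 2 = c"
  obtains \<alpha> where "\<And>z. \<phi> z = \<alpha>" "\<alpha>\<^sup>2 = - 2 * c"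
proof -
  define \<beta> where "\<beta> = csqrt (- 2 * c)"
  have \<beta>2: "\<beta>\<^sup>2 = - 2 * c" by (simp add: \<beta>_def)
  note D = entire_DERIV[OF \<phi>]
  have d: "deriv \<phi> z = (\<phi> z - \<beta>) * (\<phi> z + \<beta>) / 2" for z
  proof -
    have "deriv \<phi> z = ((\<phi> z)\<^sup>2 - (- 2 * c)) / 2" using ode[of z] by (simp add: field_simps)
    moreover have "(\<phi> z - \<beta>) * (\<phi> z + \<beta>) = (\<phi> z)\<^sup>2 - \<beta>\<^sup>2"
      by (simp add: power2_eq_square algebra_simps)
    ultimately show ?thesis by (simp only: \<beta>2)
  qed
  have const: "\<phi> z = s" if s: "\<phi> z0 = s" "s = \<beta> \<or> s = - \<beta>" for z z0 s
  proof -
    have "\<phi> z - s = 0"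
    proof (rule linear_ode_zero[of "\<lambda>z. \<phi> z - s" "\<lambda>z. (\<phi> z + s) / 2" z0])
      show "deriv (\<lambda>z. \<phi> z - s) z = (\<phi> z + s) / 2 * (\<phi> z - s)" for z
        using s(2) by (intro DERIV_imp_deriv) (auto intro!: derivative_eq_intros D simp: d)
    qed (auto intro!: holomorphic_intros \<phi> simp: s(1))
    then show ?thesis by simp
  qed
  have "\<exists>z0. \<phi> z0 = \<beta> \<or> \<phi> z0 = - \<beta>"
  proof (rule ccontr)
    assume "\<not> ?thesis"
    then have nz: "\<phi> z - \<beta> \<noteq> 0" "\<phi> z + \<beta> \<noteq> 0" for z by (auto simp: add_eq_0_iff2)
    show False
    proof (cases "\<beta> = 0")
      case True
      have "((\<lambda>z. 1 / \<phi> z + z / 2) has_field_derivative 0) (at z)" for z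
      proof -
        have "((\<lambda>z. 1 / \<phi> z + z / 2) has_field_derivative
            (0 * \<phi> z - 1 * deriv \<phi> z) / (\<phi> z * \<phi> z) + 1 / 2) (at z)"
          using nz[of z] True by (auto intro!: derivative_eq_intros D)
        moreover have "(0 * \<phi> z - 1 * deriv \<phi> z) / (\<phi> z * \<phi> z) + 1 / 2 = 0"
          using nz[of z] True by (simp add: d)
        ultimately show ?thesis by (simp only:)
      qed
      then have "\<exists>K. \<forall>z\<in>UNIV. 1 / \<phi> z + z / 2 = K"
        by (intro has_field_derivative_zero_constant) auto
      then obtain K where "\<And>z. 1 / \<phi> z + z / 2 = K" by auto
      from this[of "2 * K"] show False using nz(1)[of "2 * K"] True by simp
    next
      case False
      define \<eta> where "\<eta> = (\<lambda>z. (\<phi> z - \<beta>) / (\<phi> z + \<beta>))"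
      have "(\<eta> has_field_derivative \<beta> * \<eta> z) (at z)" for z
      proof -
        have "(\<eta> has_field_derivative
            (deriv \<phi> z * (\<phi> z + \<beta>) - (\<phi> z - \<beta>) * deriv \<phi> z) / ((\<phi> z + \<beta>) * (\<phi> z + \<beta>))) (at z)"
          unfolding \<eta>_def using nz[of z] by (auto intro!: derivative_eq_intros D)
        moreover have "((x - \<beta>) * y / 2 * y - (x - \<beta>) * ((x - \<beta>) * y / 2)) / (y * y) = \<beta> * ((x - \<beta>) / y)"
          if "y \<noteq> 0" "y = x + \<beta>" for x y
        proof -
          have "(x - \<beta>) * y / 2 * y - (x - \<beta>) * ((x - \<beta>) * y / 2) = (\<beta> * (x - \<beta>)) * y"
            unfolding that(2) by (simp add: field_simps)
          then show ?thesis using that(1) by simp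
        qed
        ultimately show ?thesis unfolding \<eta>_def d using nz(2)[of z] by simp
      qed
      from entire_eq_exp_if_log_derivative_const[OF this]
      have \<eta>: "\<eta> z = \<eta> 0 * exp (\<beta> * z)" for z .
      have \<eta>0: "\<eta> 0 \<noteq> 0" using nz[of 0] by (simp add: \<eta>_def)
      define z where "z = Ln (1 / \<eta> 0) / \<beta>"
      have "\<eta> z = 1" unfolding \<eta>[of z] using False \<eta>0 by (simp add: z_def)
      then have "\<phi> z - \<beta> = \<phi> z + \<beta>" using nz(2)[of z] by (simp add: \<eta>_def)
      then show False using False by (simp add: eq_neg_iff_add_eq_0)
    qed
  qed
  then obtain z0 where z0: "\<phi> z0 = \<beta> \<or> \<phi> z0 = - \<beta>" by blast
  show ?thesis
    by (rule that[of "\<phi> z0"]) (use const[OF refl z0] z0 \<beta>2 in auto)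
qed

text \<open>
  Put \<open>v = u' / \<alpha>\<close>. Then \<open>u' = \<alpha> v\<close>, \<open>v' = - \<alpha> u\<close>, so \<open>v + \<i> u\<close> and \<open>v - \<i> u\<close> are exponentials, whose product is
  \<open>v\<^sup>2 + u\<^sup>2 = 1\<close>.
\<close>
lemma sine_if_quadratic_first_order:
  fixes u :: "complex \<Rightarrow> complex"
  assumes u: "u holomorphic_on UNIV" and nc: "\<not> u constant_on UNIV"
    and eq: "\<And>z. (deriv u z)\<^sup>2 = - \<alpha>\<^sup>2 * ((u z - 1) * (u z + 1))"
  obtains \<beta> where "u = (\<lambda>z. sin (\<alpha> * z + \<beta>))"
proof -
  obtain z1 where z1: "deriv u z1 \<noteq> 0" using entire_deriv_nonzero[OF u nc] .
  have \<alpha>: "\<alpha> \<noteq> 0"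
  proof
    assume "\<alpha> = 0"
    then have "(deriv u z1)\<^sup>2 = 0" using eq[of z1] by simp
    then show False using z1 by simp
  qed
  have ode: "2 * (- \<alpha>\<^sup>2) * deriv (deriv u) z = deriv (\<lambda>_. - \<alpha>\<^sup>2) z * deriv u z + (- \<alpha>\<^sup>2)\<^sup>2 * (2 * u z - 1 - (- 1))" for z
    by (rule quadratic_second_derivative[OF u _ nc, of "\<lambda>_. - \<alpha>\<^sup>2" 1 "- 1"]) (auto simp: eq)
  have u2: "deriv (deriv u) z = - \<alpha>\<^sup>2 * u z" for z
  proof -
    have "2 * (- \<alpha>\<^sup>2) * deriv (deriv u) z = (- \<alpha>\<^sup>2)\<^sup>2 * (2 * u z)"
      using ode[of z] by simp
    then have "\<alpha>\<^sup>2 * (deriv (deriv u) z + \<alpha>\<^sup>2 * u z) = 0" by algebra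
    then show ?thesis using \<alpha> by (simp add: eq_neg_iff_add_eq_0)
  qed
  define v where "v = (\<lambda>z. deriv u z / \<alpha>)"
  have dv: "(v has_field_derivative - \<alpha> * u z) (at z)" for z
    unfolding v_def using \<alpha>
    by (auto intro!: derivative_eq_intros entire_DERIV[OF entire_deriv[OF u]] simp: u2 power2_eq_square)
  have du: "(u has_field_derivative \<alpha> * v z) (at z)" for z
    using entire_DERIV[OF u, of z] \<alpha> by (simp add: v_def)
  have pyth: "(v z)\<^sup>2 + (u z)\<^sup>2 = 1" for z
    using \<alpha> eq[of z] by (simp add: v_def power_divide field_simps power2_eq_square)
  define K where "K = v 0 + \<i> * u 0"
  define K' where "K' = v 0 - \<i> * u 0"
  have "((\<lambda>z. v z + \<i> * u z) has_field_derivative (\<i> * \<alpha>) * (v z + \<i> * u z)) (at z)" for z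
    by (auto intro!: derivative_eq_intros du dv simp: algebra_simps)
  from entire_eq_exp_if_log_derivative_const[OF this]
  have e1: "v z + \<i> * u z = K * exp (\<i> * \<alpha> * z)" for z unfolding K_def .
  have "((\<lambda>z. v z - \<i> * u z) has_field_derivative (- \<i> * \<alpha>) * (v z - \<i> * u z)) (at z)" for z
    by (auto intro!: derivative_eq_intros du dv simp: algebra_simps)
  from entire_eq_exp_if_log_derivative_const[OF this]
  have e2: "v z - \<i> * u z = K' * exp (- \<i> * \<alpha> * z)" for z unfolding K'_def .
  have KK: "K * K' = 1" using pyth[of 0] by (simp add: K_def K'_def power2_eq_square algebra_simps)
  then have K0: "K \<noteq> 0" by auto
  define \<beta> where "\<beta> = Ln K / \<i>"
  have K: "K = exp (\<i> * \<beta>)" "K' = exp (- (\<i> * \<beta>))"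
    using K0 KK by (auto simp: \<beta>_def exp_minus field_simps)
  have "u z = sin (\<alpha> * z + \<beta>)" for z
  proof -
    have "2 * \<i> * u z = K * exp (\<i> * \<alpha> * z) - K' * exp (- \<i> * \<alpha> * z)"
      unfolding e1[symmetric] e2[symmetric] by simp
    also have "\<dots> = exp (\<i> * (\<alpha> * z + \<beta>)) - exp (- (\<i> * (\<alpha> * z + \<beta>)))"
      unfolding K by (simp add: algebra_simps flip: exp_add)
    finally show ?thesis
      by (simp add: sin_exp_eq field_simps)
  qed
  then show ?thesis using that by blast
qed

text \<open>
  The rational function with \<open>S(sin, z) = sine_rhs (sin z) / 2\<close>.
\<close>
definition sine_rhs :: "complex \<Rightarrow> complex" where
  "sine_rhs w = ((w - of_real (sqrt 2) * \<i>) * (w + of_real (sqrt 2) * \<i>)) / ((w - 1) * (w + 1))"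

lemma sine_rhs_eq: "sine_rhs w = (w\<^sup>2 + 2) / (w\<^sup>2 - 1)"
proof -
  have "(of_real (sqrt 2))\<^sup>2 = (2 :: complex)"
    by (metis of_real_numeral of_real_power real_sqrt_pow2 zero_le_numeral)
  then have "(w - of_real (sqrt 2) * \<i>) * (w + of_real (sqrt 2) * \<i>) = w\<^sup>2 + 2"
    by (simp add: power2_eq_square algebra_simps)
  then show ?thesis
    unfolding sine_rhs_def by (simp add: power2_eq_square algebra_simps)
qed

lemma schwarzian_quadratic_first_order:
  fixes u :: "complex \<Rightarrow> complex"
  assumes u: "u holomorphic_on UNIV" and nz: "deriv u z \<noteq> 0"
    and eq: "\<And>z. (deriv u z)\<^sup>2 = k * ((u z - 1) * (u z + 1))"
  shows "schwarzian u z = - (k / 2) * sine_rhs (u z)"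
proof -
  have nc: "\<not> u constant_on UNIV"
  proof
    assume "u constant_on UNIV"
    then obtain c where "u = (\<lambda>_. c)" by (auto simp: constant_on_def)
    then show False using nz by simp
  qed
  have q0: "(u z)\<^sup>2 - 1 \<noteq> 0"
    using nz eq[of z] by (auto simp: power2_eq_square algebra_simps)
  have "schwarzian u z = - (k / 2) * (1 + 3 * (1 - (- 1))\<^sup>2 / (4 * ((u z - 1) * (u z - (- 1)))))
           + (deriv (deriv (\<lambda>_. k)) z / (2 * k) - 5 / 8 * (deriv (\<lambda>_. k) z / k)\<^sup>2)"
    by (rule quadratic_schwarzian[OF u _ nc]) (use eq nz in auto)
  also have "\<dots> = - (k / 2) * (1 + 3 / ((u z)\<^sup>2 - 1))"
  proof -
    have d: "deriv (\<lambda>_. k) = (\<lambda>_. 0)" by (auto simp: fun_eq_iff)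
    have e: "(u z - 1) * (u z - (- 1)) = (u z)\<^sup>2 - 1"
      by (simp add: power2_eq_square algebra_simps)
    have g: "3 * (1 - (- 1))\<^sup>2 / (4 * X) = 3 / X" for X :: complex by simp
    show ?thesis unfolding d e g by simp
  qed
  also have "1 + 3 / ((u z)\<^sup>2 - 1) = sine_rhs (u z)"
    using q0 by (simp add: sine_rhs_eq divide_simps)
  finally show ?thesis .
qed

section \<open>Linear substitutions in meromorphic solutions\<close>

lemma schwarzian_linear_compose:
  assumes u: "u analytic_on {z}" and "a \<noteq> 0"
  shows "schwarzian (\<lambda>z. a * u z + b) z = schwarzian u z"
proof -
  obtain S where S: "open S" "z \<in> S" "u holomorphic_on S"
    using u analytic_at by blast
  define f where "f = (\<lambda>z. a * u z + b)"
  have f: "f holomorphic_on S" unfolding f_def by (intro holomorphic_intros S)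
  have du: "(u has_field_derivative deriv u w) (at w)" if "w \<in> S" for w
    using S that by (intro holomorphic_derivI)
  have df: "deriv f w = a * deriv u w" if "w \<in> S" for w
    unfolding f_def by (rule DERIV_imp_deriv) (auto intro!: derivative_eq_intros du that)
  have ddf: "deriv (deriv f) w = a * deriv (deriv u) w" if "w \<in> S" for w
  proof -
    have "(deriv u has_field_derivative deriv (deriv u) w) (at w)"
      using S that by (intro holomorphic_derivI holomorphic_deriv)
    then have "((\<lambda>w. a * deriv u w) has_field_derivative a * deriv (deriv u) w) (at w)"
      by (rule DERIV_cmult)
    then have "(deriv f has_field_derivative a * deriv (deriv u) w) (at w)"
      by (rule has_field_derivative_transform_within_open[OF _ S(1) that]) (simp add: df)
    then show ?thesis by (rule DERIV_imp_deriv)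
  qed
  have q: "deriv (deriv f) w / deriv f w = deriv (deriv u) w / deriv u w" if "w \<in> S" for w
    using df[OF that] ddf[OF that] \<open>a \<noteq> 0\<close> by simp
  have "deriv (\<lambda>w. deriv (deriv f) w / deriv f w) z = deriv (\<lambda>w. deriv (deriv u) w / deriv u w) z"
  proof (rule deriv_cong_ev)
    show "eventually (\<lambda>w. deriv (deriv f) w / deriv f w = deriv (deriv u) w / deriv u w) (nhds z)"
      using S q by (intro eventually_nhds_in_open[THEN eventually_mono]) auto
  qed simp
  then show ?thesis
    unfolding schwarzian_def f_def[symmetric] q[OF S(2)] by simp
qed

lemma meromorphic_on_poly_compose:
  assumes "u meromorphic_on A"
  shows "(\<lambda>z. poly q (u z)) meromorphic_on A"
  by (induction q) (auto intro!: meromorphic_intros assms)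

lemma meromorphic_avoids_finite:
  assumes u: "u meromorphic_on UNIV" and nc: "\<not> (\<exists>k. eventually (\<lambda>z. u z = k) (cosparse UNIV))"
    and "finite Z"
  shows "eventually (\<lambda>z. u z \<notin> Z) (cosparse UNIV)"
proof -
  have "eventually (\<lambda>z. u z \<noteq> k) (cosparse UNIV)" for k
    using meromorphic_imp_constant_or_avoid[OF u open_UNIV connected_UNIV, of k] nc by blast
  then have "eventually (\<lambda>z. \<forall>k\<in>Z. u z \<noteq> k) (cosparse UNIV)"
    using \<open>finite Z\<close> by (simp add: eventually_ball_finite_distrib)
  then show ?thesis by (rule eventually_mono) auto
qed

lemma nonconstant_linear_iff:
  assumes "a \<noteq> (0 :: complex)"
  shows "(\<exists>k. eventually (\<lambda>z. a * u z + b = k) F) \<longleftrightarrow> (\<exists>k. eventually (\<lambda>z. u z = k) F)"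
proof
  assume "\<exists>k. eventually (\<lambda>z. a * u z + b = k) F"
  then obtain k where k: "eventually (\<lambda>z. a * u z + b = k) F" by blast
  have "eventually (\<lambda>z. u z = (k - b) / a) F"
    using k by (rule eventually_mono) (use assms in \<open>auto simp: field_simps\<close>)
  then show "\<exists>k. eventually (\<lambda>z. u z = k) F" by blast
next
  assume "\<exists>k. eventually (\<lambda>z. u z = k) F"
  then obtain k where k: "eventually (\<lambda>z. u z = k) F" by blast
  have "eventually (\<lambda>z. a * u z + b = a * k + b) F"
    using k by (rule eventually_mono) simp
  then show "\<exists>k. eventually (\<lambda>z. a * u z + b = k) F" by blast
qed

text \<open>
  At a point where \<open>u\<close> is analytic the Schwarzians of \<open>u\<close> and \<open>a u + b\<close> agree. The \<open>p\<close>-th root can be extracted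
  globally because the quotient of the two candidates is meromorphic with values among the finitely many \<open>p\<close>-th roots
  of unity, hence constant off a sparse set.
\<close>
lemma schwarzian_reducesI:
  fixes A B :: "complex poly"
  assumes "p > 0" and a: "a \<noteq> 0" and AB: "A \<noteq> 0" "B \<noteq> 0"
    and RT: "eventually (\<lambda>w. R (a * w + b) = (poly A w / poly B w) ^ p) cofinite"
  shows "schwarzian_reduces p R (\<lambda>w. a * w + b) (\<lambda>w. poly A w / poly B w)"
  unfolding schwarzian_reduces_def
proof (intro conjI RT allI)
  fix u :: "complex \<Rightarrow> complex"
  define T where "T = (\<lambda>w. poly A w / poly B w)"
  have mero_iff: "(\<lambda>z. a * u z + b) meromorphic_on UNIV \<longleftrightarrow> u meromorphic_on UNIV"
  proof
    assume *: "(\<lambda>z. a * u z + b) meromorphic_on UNIV"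
    have "(\<lambda>z. ((a * u z + b) - b) / a) meromorphic_on UNIV" by (intro meromorphic_intros *)
    then show "u meromorphic_on UNIV" using a by simp
  qed (intro meromorphic_intros)
  have core: "(eventually (\<lambda>z. schwarzian (\<lambda>z. a * u z + b) z ^ p = R (a * u z + b)) (cosparse UNIV)) \<longleftrightarrow>
      (\<exists>\<omega>. \<omega> ^ p = 1 \<and> eventually (\<lambda>z. schwarzian u z = \<omega> * T (u z)) (cosparse UNIV))"
    if u: "u meromorphic_on UNIV" and nc: "\<not> (\<exists>k. eventually (\<lambda>z. u z = k) (cosparse UNIV))"
  proof -
    have S: "eventually (\<lambda>z. schwarzian (\<lambda>z. a * u z + b) z = schwarzian u z) (cosparse UNIV)"
      using meromorphic_on_imp_analytic_cosparse[OF u]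
      by (rule eventually_mono) (rule schwarzian_linear_compose[OF _ a])
    have "finite {w. R (a * w + b) \<noteq> T w ^ p}"
      using RT by (simp add: eventually_cofinite T_def)
    from meromorphic_avoids_finite[OF u nc this]
    have RT': "eventually (\<lambda>z. R (a * u z + b) = T (u z) ^ p) (cosparse UNIV)"
      by (rule eventually_mono) simp
    have "finite {w. poly (A * B) w = 0}" using AB by (intro poly_roots_finite) auto
    from meromorphic_avoids_finite[OF u nc this]
    have T0: "eventually (\<lambda>z. T (u z) \<noteq> 0) (cosparse UNIV)"
      by (rule eventually_mono) (auto simp: T_def)
    show ?thesis
    proof
      assume L: "eventually (\<lambda>z. schwarzian (\<lambda>z. a * u z + b) z ^ p = R (a * u z + b)) (cosparse UNIV)"
      define g where "g = (\<lambda>z. schwarzian u z / T (u z))"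
      have g: "g meromorphic_on UNIV"
        unfolding g_def T_def schwarzian_def by (intro meromorphic_intros meromorphic_on_poly_compose u)
      have gp: "eventually (\<lambda>z. g z ^ p = 1) (cosparse UNIV)"
        using L S RT' T0 by eventually_elim (simp add: g_def power_divide)
      have "\<exists>\<omega>. \<omega> ^ p = 1 \<and> eventually (\<lambda>z. g z = \<omega>) (cosparse UNIV)"
      proof (rule ccontr)
        assume *: "\<not> ?thesis"
        have "finite {\<omega> :: complex. \<omega> ^ p = 1}" using \<open>p > 0\<close> by (intro finite_roots_unity) auto
        moreover have "\<forall>\<omega>\<in>{\<omega>. \<omega> ^ p = 1}. eventually (\<lambda>z. g z \<noteq> \<omega>) (cosparse UNIV)"
          using meromorphic_imp_constant_or_avoid[OF g open_UNIV connected_UNIV] * by blast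
        ultimately have "eventually (\<lambda>z. \<forall>\<omega>\<in>{\<omega>. \<omega> ^ p = 1}. g z \<noteq> \<omega>) (cosparse UNIV)"
          by (rule eventually_ball_finite)
        with gp have "eventually (\<lambda>z. False) (cosparse (UNIV :: complex set))"
          by eventually_elim auto
        then show False by simp
      qed
      then obtain \<omega> where \<omega>: "\<omega> ^ p = 1" "eventually (\<lambda>z. g z = \<omega>) (cosparse UNIV)" by blast
      have "eventually (\<lambda>z. schwarzian u z = \<omega> * T (u z)) (cosparse UNIV)"
        using \<omega>(2) T0 by eventually_elim (auto simp: g_def)
      with \<omega>(1) show "\<exists>\<omega>. \<omega> ^ p = 1 \<and> eventually (\<lambda>z. schwarzian u z = \<omega> * T (u z)) (cosparse UNIV)" by blast
    next
      assume "\<exists>\<omega>. \<omega> ^ p = 1 \<and> eventually (\<lambda>z. schwarzian u z = \<omega> * T (u z)) (cosparse UNIV)"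
      then obtain \<omega> where \<omega>: "\<omega> ^ p = 1" "eventually (\<lambda>z. schwarzian u z = \<omega> * T (u z)) (cosparse UNIV)" by blast
      show "eventually (\<lambda>z. schwarzian (\<lambda>z. a * u z + b) z ^ p = R (a * u z + b)) (cosparse UNIV)"
        using \<omega>(2) S RT' by eventually_elim (simp add: power_mult_distrib \<omega>(1))
    qed
  qed
  show "schwarzian_solution p R (\<lambda>z. a * u z + b) \<longleftrightarrow>
     (\<exists>\<omega>. \<omega> ^ p = 1 \<and> schwarzian_solution 1 (\<lambda>w. \<omega> * (poly A w / poly B w)) u)"
    using core unfolding schwarzian_solution_def mero_iff nonconstant_linear_iff[OF a] T_def power_one_right
    by blast
qed

lemma eventually_constant_entire:
  assumes f: "f holomorphic_on UNIV" and ev: "eventually (\<lambda>z. f z = k) (cosparse UNIV)"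
  shows "f constant_on UNIV"
proof -
  have "eventually (\<lambda>z. f z = k) (at 0)"
    using ev by (rule eventually_cosparse_imp_eventually_at) simp
  then obtain r where r: "r > 0" "\<And>z. z \<in> ball 0 r - {0} \<Longrightarrow> f z = k"
    unfolding eventually_at by (auto simp: dist_commute)
  have "f z = k" for z
  proof (rule analytic_continuation_open[of "ball 0 r - {0}" UNIV f "\<lambda>_. k"])
    show "ball 0 r - {0} \<noteq> ({} :: complex set)"
    proof -
      have "of_real (r / 2) \<in> ball (0 :: complex) r - {0}" using r(1) by simp
      then show ?thesis by blast
    qed
  qed (use f r(2) in auto)
  then show ?thesis by (auto simp: constant_on_def)
qed

lemma schwarzian_solution_entire_iff:
  assumes f: "f holomorphic_on UNIV"
  shows "schwarzian_solution p R f \<longleftrightarrow>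
    \<not> f constant_on UNIV \<and> (\<forall>z. eventually (\<lambda>w. schwarzian f w ^ p = R (f w)) (at z))"
proof -
  have "f meromorphic_on UNIV"
    using f by (intro analytic_on_imp_meromorphic_on) (simp add: analytic_on_open)
  moreover have "(\<exists>k. eventually (\<lambda>z. f z = k) (cosparse UNIV)) \<longleftrightarrow> f constant_on UNIV"
    using eventually_constant_entire[OF f] by (auto simp: constant_on_def)
  ultimately show ?thesis
    by (simp add: schwarzian_solution_def eventually_cosparse_open_eq)
qed

lemma eventually_deriv_nonzero:
  assumes f: "f holomorphic_on UNIV" and nc: "\<not> f constant_on UNIV"
  shows "eventually (\<lambda>w. deriv f w \<noteq> 0) (at z)"
proof -
  obtain z1 where "deriv f z1 \<noteq> 0" using entire_deriv_nonzero[OF f nc] .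
  then show ?thesis
    using non_zero_neighbour_alt[of "deriv f" UNIV z z1] entire_deriv[OF f] by auto
qed

section \<open>Classification with two roots in the denominator\<close>

context autonomous_schwarzian
begin

lemma entire_solution_iff:
  assumes "f holomorphic_on UNIV"
  shows "schwarzian_solution p rhs f \<longleftrightarrow> entire_solution f"
  using assms by (simp add: schwarzian_solution_entire_iff entire_solution_def)

text \<open>
  In the coordinate \<open>u\<close> that moves the two roots to \<open>1\<close> and \<open>-1\<close> every entire solution satisfies
  \<open>u'\<^sup>2 = k (u - 1) (u + 1)\<close>, hence \<open>S(u) = - (k / 2) (u\<^sup>2 + 2) / (u\<^sup>2 - 1)\<close>. Since the given solution
  takes infinitely many values, this determines \<open>R\<close>, and then the constant \<open>k\<close> of every other entire solution up to
  a root of unity.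
\<close>
lemma two_root_classification:
  assumes sol: "entire_solution f" and deg: "degree P \<le> degree Q"
    and ab: "poly Q a = 0" "poly Q b = 0" "a \<noteq> b"
    and L_def: "L = (\<lambda>w. (a - b) / 2 * w + (a + b) / 2)"
  shows "\<exists>c. schwarzian_reduces p rhs L (\<lambda>w. c * sine_rhs w) \<and>
     (\<exists>u. f = (\<lambda>z. L (u z)) \<and> schwarzian_solution 1 (\<lambda>w. c * sine_rhs w) u) \<and>
     {g. g holomorphic_on UNIV \<and> schwarzian_solution p rhs g} =
       {\<lambda>z. L (sin (csqrt (2 * (\<omega> * c)) * z + \<beta>)) | \<omega> \<beta>. \<omega> ^ p = 1}"
proof -
  have A0: "(a - b) / 2 \<noteq> 0" using ab by simp
  have normal: "\<exists>u k. g = (\<lambda>z. L (u z)) \<and> u holomorphic_on UNIV \<and> \<not> u constant_on UNIV \<and>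
      (\<forall>z. (deriv u z)\<^sup>2 = k * ((u z - 1) * (u z + 1)))" if g: "entire_solution g" for g
  proof -
    have gh: "g holomorphic_on UNIV" and gnc: "\<not> g constant_on UNIV" using g by (auto simp: entire_solution_def)
    obtain k where k: "\<And>z. (deriv g z)\<^sup>2 = k * ((g z - a) * (g z - b))"
      using two_root_first_order[OF g deg ab] by metis
    define A where "A = (a - b) / 2"
    have A: "A \<noteq> 0" using A0 by (simp add: A_def)
    define u where "u = (\<lambda>z. (g z - (a + b) / 2) / A)"
    have gu: "g z = A * u z + (a + b) / 2" for z using A by (simp add: u_def)
    have "u holomorphic_on UNIV" unfolding u_def using A by (intro holomorphic_intros gh) auto
    moreover have "\<not> u constant_on UNIV"
    proof
      assume "u constant_on UNIV"
      then obtain c where "\<And>z. u z = c" by (auto simp: constant_on_def)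
      then have "g z = A * c + (a + b) / 2" for z using gu by simp
      then show False using gnc by (auto simp: constant_on_def)
    qed
    moreover have "(deriv u z)\<^sup>2 = k * ((u z - 1) * (u z + 1))" for z
    proof -
      have "deriv u z = deriv g z / A"
        unfolding u_def using A by (intro DERIV_imp_deriv) (auto intro!: derivative_eq_intros entire_DERIV[OF gh])
      then have "(deriv u z)\<^sup>2 = k * ((g z - a) * (g z - b)) / A\<^sup>2" by (simp add: power_divide k)
      moreover have "g z - a = A * (u z - 1)" "g z - b = A * (u z + 1)"
        by (simp_all add: gu A_def field_simps)
      ultimately show ?thesis using A by (simp add: power2_eq_square)
    qed
    ultimately show ?thesis using gu unfolding L_def A_def by blast
  qed
  have deriv0: "k \<noteq> 0" if "u holomorphic_on UNIV" "\<not> u constant_on UNIV"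
      "\<forall>z. (deriv u z)\<^sup>2 = k * ((u z - 1) * (u z + 1))" for u k
  proof
    assume "k = 0"
    then have "(deriv u z)\<^sup>2 = 0" for z using that(3) by simp
    then show False using entire_deriv_nonzero[OF that(1,2)] by auto
  qed
  have sol_u: "schwarzian_solution 1 (\<lambda>w. - (k / 2) * sine_rhs w) u"
    if "u holomorphic_on UNIV" "\<not> u constant_on UNIV"
      "\<forall>z. (deriv u z)\<^sup>2 = k * ((u z - 1) * (u z + 1))" for u k
    unfolding schwarzian_solution_entire_iff[OF that(1)]
  proof (intro conjI allI that(2))
    fix z
    show "eventually (\<lambda>w. schwarzian u w ^ 1 = - (k / 2) * sine_rhs (u w)) (at z)"
      using eventually_deriv_nonzero[OF that(1,2)]
      by (rule eventually_mono) (use schwarzian_quadratic_first_order[OF that(1)] that(3) in simp)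
  qed
  obtain u k where fu: "f = (\<lambda>z. L (u z))" and u: "u holomorphic_on UNIV" "\<not> u constant_on UNIV"
    and uk: "\<forall>z. (deriv u z)\<^sup>2 = k * ((u z - 1) * (u z + 1))"
    using normal[OF sol] by blast
  define c where "c = - (k / 2)"
  have c0: "c \<noteq> 0" using deriv0[OF u uk] by (simp add: c_def)
  define N where "N = smult c ([:2:] + monom 1 2)"
  define M where "M = monom 1 2 - ([:1:] :: complex poly)"
  have NM: "poly N w = c * (w\<^sup>2 + 2)" "poly M w = w\<^sup>2 - 1" for w
    by (simp_all add: N_def M_def poly_monom)
  have T: "(\<lambda>w. c * sine_rhs w) = (\<lambda>w. poly N w / poly M w)"
    by (simp add: fun_eq_iff sine_rhs_eq NM)
  have NM0: "N \<noteq> 0" "M \<noteq> 0"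
  proof -
    have "poly N 0 \<noteq> 0" "poly M 0 \<noteq> 0" using c0 by (simp_all add: NM)
    then show "N \<noteq> 0" "M \<noteq> 0" by auto
  qed
  define \<Lambda> where "\<Lambda> = [:(a + b) / 2, (a - b) / 2:]"
  have \<Lambda>: "poly \<Lambda> w = L w" for w by (simp add: \<Lambda>_def L_def mult.commute)
  have QL0: "pcompose Q \<Lambda> \<noteq> 0"
    using Q_nz A0 by (simp add: pcompose_eq_0_iff \<Lambda>_def)
  \<comment> \<open>The equation between \<open>R \<circ> L\<close> and \<open>T\<^sup>p\<close> with denominators cleared.\<close>
  define E where "E = pcompose P \<Lambda> * M ^ p - N ^ p * pcompose Q \<Lambda>"
  have zero: "poly E (u z) = 0" if "deriv u z \<noteq> 0" "poly Q (L (u z)) \<noteq> 0" for z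
  proof -
    have M0: "poly M (u z) \<noteq> 0"
      using uk[rule_format, of z] that(1) by (auto simp: NM power2_eq_square algebra_simps)
    have "deriv f z = (a - b) / 2 * deriv u z"
      unfolding fu L_def by (intro DERIV_imp_deriv) (auto intro!: derivative_eq_intros entire_DERIV[OF u(1)])
    then have "schwarzian f z ^ p = rhs (f z)"
      using that A0 by (intro solution_at_regular_point[OF sol]) (auto simp: fu)
    moreover have "schwarzian f z = schwarzian u z"
      unfolding fu L_def using A0 u(1)
      by (intro schwarzian_linear_compose) (meson UNIV_I analytic_on_analytic_at analytic_on_open open_UNIV, simp)
    moreover have "schwarzian u z = poly N (u z) / poly M (u z)"
      using schwarzian_quadratic_first_order[OF u(1) that(1), of k] uk fun_cong[OF T, of "u z"] by (simp add: c_def)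
    ultimately have "(poly N (u z) / poly M (u z)) ^ p = poly P (L (u z)) / poly Q (L (u z))"
      by (simp add: rhs_def fu)
    then show ?thesis
      using M0 that(2) by (simp add: E_def poly_pcompose \<Lambda> power_divide field_simps)
  qed
  have "E = 0"
  proof (rule ccontr)
    assume "E \<noteq> 0"
    then have fin: "finite {w. poly (E * pcompose Q \<Lambda>) w = 0}" using QL0 by (intro poly_roots_finite) auto
    have um: "u meromorphic_on UNIV"
      using u by (intro analytic_on_imp_meromorphic_on) (simp add: analytic_on_open)
    have unc: "\<not> (\<exists>k. eventually (\<lambda>z. u z = k) (cosparse UNIV))"
      using eventually_constant_entire[OF u(1)] u(2) by blast
    have "eventually (\<lambda>z. u z \<notin> {w. poly (E * pcompose Q \<Lambda>) w = 0}) (at 0)"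
      using meromorphic_avoids_finite[OF um unc fin] by (rule eventually_cosparse_imp_eventually_at) simp
    with eventually_deriv_nonzero[OF u, of 0] have "eventually (\<lambda>z. False) (at (0::complex))"
      by eventually_elim (use zero in \<open>auto simp: poly_pcompose \<Lambda>\<close>)
    then show False by simp
  qed
  have "eventually (\<lambda>w. rhs (L w) = (poly N w / poly M w) ^ p) cofinite"
  proof -
    have "finite {w. poly (M * pcompose Q \<Lambda>) w = 0}" using QL0 NM0 by (intro poly_roots_finite) auto
    then have "eventually (\<lambda>w. poly (M * pcompose Q \<Lambda>) w \<noteq> 0) cofinite" by (simp add: eventually_cofinite)
    then show ?thesis
    proof (rule eventually_mono)
      fix w assume w: "poly (M * pcompose Q \<Lambda>) w \<noteq> 0"
      have "poly E w = 0" using \<open>E = 0\<close> by simp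
      then show "rhs (L w) = (poly N w / poly M w) ^ p"
        using w by (simp add: E_def rhs_def poly_pcompose \<Lambda> power_divide field_simps)
    qed
  qed
  then have red: "schwarzian_reduces p rhs L (\<lambda>w. c * sine_rhs w)"
    unfolding T L_def by (intro schwarzian_reducesI p_pos A0 NM0)
  then have red_iff: "schwarzian_solution p rhs (\<lambda>z. L (v z)) \<longleftrightarrow>
      (\<exists>\<omega>. \<omega> ^ p = 1 \<and> schwarzian_solution 1 (\<lambda>w. \<omega> * (c * sine_rhs w)) v)" for v
    by (simp add: schwarzian_reduces_def)
  have "{g. g holomorphic_on UNIV \<and> schwarzian_solution p rhs g} =
       {\<lambda>z. L (sin (csqrt (2 * (\<omega> * c)) * z + \<beta>)) | \<omega> \<beta>. \<omega> ^ p = 1}" (is "?X = ?Y")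
  proof (intro subset_antisym subsetI)
    fix g assume "g \<in> ?X"
    then have g: "g holomorphic_on UNIV" "schwarzian_solution p rhs g" by auto
    obtain v l where gv: "g = (\<lambda>z. L (v z))" and v: "v holomorphic_on UNIV" "\<not> v constant_on UNIV"
      and vl: "\<forall>z. (deriv v z)\<^sup>2 = l * ((v z - 1) * (v z + 1))"
      using normal g entire_solution_iff by blast
    obtain \<omega> where \<omega>: "\<omega> ^ p = 1" "schwarzian_solution 1 (\<lambda>w. \<omega> * (c * sine_rhs w)) v"
      using g(2) red_iff unfolding gv by blast
    have e1: "eventually (\<lambda>z. schwarzian v z = \<omega> * (c * sine_rhs (v z))) (at 0)"
      using \<omega>(2) unfolding schwarzian_solution_entire_iff[OF v(1)] by simp
    have e2: "eventually (\<lambda>z. schwarzian v z = - (l / 2) * sine_rhs (v z)) (at 0)"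
      using sol_u[OF v vl] unfolding schwarzian_solution_entire_iff[OF v(1)] by simp
    have fin: "finite {w. poly (N * M) w = 0}" using NM0 by (intro poly_roots_finite) auto
    have vm: "v meromorphic_on UNIV"
      using v by (intro analytic_on_imp_meromorphic_on) (simp add: analytic_on_open)
    have vnc: "\<not> (\<exists>k. eventually (\<lambda>z. v z = k) (cosparse UNIV))"
      using eventually_constant_entire[OF v(1)] v(2) by blast
    have e3: "eventually (\<lambda>z. v z \<notin> {w. poly (N * M) w = 0}) (at 0)"
      using meromorphic_avoids_finite[OF vm vnc fin] by (rule eventually_cosparse_imp_eventually_at) simp
    have "eventually (\<lambda>z. \<omega> * c = - (l / 2)) (at (0::complex))"
      using e1 e2 e3
    proof eventually_elim
      case (elim z)
      have "sine_rhs (v z) \<noteq> 0" using elim(3) c0 by (auto simp: sine_rhs_eq NM)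
      moreover have "(\<omega> * c) * sine_rhs (v z) = - (l / 2) * sine_rhs (v z)"
        using elim(1,2) by (simp only: mult.assoc)
      ultimately show ?case by (simp only: mult_cancel_right) simp
    qed
    then have l: "\<omega> * c = - (l / 2)" by simp
    define \<alpha> where "\<alpha> = csqrt (2 * (\<omega> * c))"
    have "\<alpha>\<^sup>2 = 2 * (\<omega> * c)" unfolding \<alpha>_def by (rule power2_csqrt)
    then have "l = - \<alpha>\<^sup>2" by (simp add: l)
    then have "\<And>z. (deriv v z)\<^sup>2 = - \<alpha>\<^sup>2 * ((v z - 1) * (v z + 1))" using vl by simp
    from sine_if_quadratic_first_order[OF v this] obtain \<beta> where "v = (\<lambda>z. sin (\<alpha> * z + \<beta>))" .
    then show "g \<in> ?Y" using \<omega>(1) by (auto simp: gv \<alpha>_def)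
  next
    fix g assume "g \<in> ?Y"
    then obtain \<omega> \<beta> where \<omega>: "\<omega> ^ p = 1" and g: "g = (\<lambda>z. L (sin (csqrt (2 * (\<omega> * c)) * z + \<beta>)))" by blast
    define \<alpha> where "\<alpha> = csqrt (2 * (\<omega> * c))"
    have \<alpha>2: "\<alpha>\<^sup>2 = 2 * (\<omega> * c)" unfolding \<alpha>_def by (rule power2_csqrt)
    have "\<omega> \<noteq> 0" using \<omega> p_pos by (auto simp: power_0_left)
    then have \<alpha>0: "\<alpha> \<noteq> 0" using \<alpha>2 c0 by auto
    define v where "v = (\<lambda>z. sin (\<alpha> * z + \<beta>))"
    have v: "v holomorphic_on UNIV" unfolding v_def by (intro holomorphic_intros)
    have dv: "deriv v z = \<alpha> * cos (\<alpha> * z + \<beta>)" for z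
      unfolding v_def by (intro DERIV_imp_deriv) (auto intro!: derivative_eq_intros)
    have "(deriv v z)\<^sup>2 = - \<alpha>\<^sup>2 * ((v z - 1) * (v z + 1))" for z
    proof -
      have "(cos (\<alpha> * z + \<beta>))\<^sup>2 = - ((v z - 1) * (v z + 1))"
        using sin_cos_squared_add[of "\<alpha> * z + \<beta>"] by (simp add: v_def power2_eq_square algebra_simps)
      then show ?thesis by (simp add: dv power_mult_distrib)
    qed
    then have eq: "\<forall>z. (deriv v z)\<^sup>2 = (- \<alpha>\<^sup>2) * ((v z - 1) * (v z + 1))" by blast
    have nc: "\<not> v constant_on UNIV"
    proof
      assume "v constant_on UNIV"
      then obtain d where "v = (\<lambda>_. d)" by (auto simp: constant_on_def)
      then have "deriv v (- \<beta> / \<alpha>) = 0" by simp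
      then show False using \<alpha>0 by (simp add: dv)
    qed
    have "schwarzian_solution 1 (\<lambda>w. \<omega> * (c * sine_rhs w)) v"
      using sol_u[OF v nc eq] \<alpha>2 by (simp add: mult.assoc)
    then have "schwarzian_solution p rhs (\<lambda>z. L (v z))" using \<omega> red_iff by blast
    moreover have "(\<lambda>z. L (v z)) holomorphic_on UNIV" unfolding L_def by (intro holomorphic_intros v)
    ultimately show "g \<in> ?X" by (simp add: g v_def \<alpha>_def)
  qed
  moreover have "schwarzian_solution 1 (\<lambda>w. c * sine_rhs w) u"
    using sol_u[OF u uk] by (simp only: c_def)
  ultimately show ?thesis using red fu by blast
qed

end

section \<open>Constant right-hand side and the classification\<close>

lemma schwarzian_exp_affine:
  fixes g :: "complex \<Rightarrow> complex"
  assumes g: "g = (\<lambda>z. A * exp (\<alpha> * z) + B)" and "A \<noteq> 0" "\<alpha> \<noteq> 0"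
  shows "schwarzian g z = - \<alpha>\<^sup>2 / 2"
proof -
  have d1: "deriv g = (\<lambda>z. A * \<alpha> * exp (\<alpha> * z))"
    unfolding g by (intro ext DERIV_imp_deriv) (auto intro!: derivative_eq_intros)
  have d: "deriv (\<lambda>z. C * exp (\<alpha> * z)) = (\<lambda>z. C * \<alpha> * exp (\<alpha> * z))" for C
    by (intro ext DERIV_imp_deriv) (auto intro!: derivative_eq_intros)
  have "g holomorphic_on UNIV" unfolding g by (intro holomorphic_intros)
  then have "schwarzian g z = deriv (deriv (deriv g)) z / deriv g z - 3 / 2 * (deriv (deriv g) z / deriv g z)\<^sup>2"
    by (rule schwarzian_entire) (use assms(2,3) in \<open>simp add: d1\<close>)
  also have "\<dots> = - \<alpha>\<^sup>2 / 2"
    unfolding d1 d using assms(2,3) by (simp add: power2_eq_square)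
  finally show ?thesis .
qed

text \<open>
  The Schwarzian is entire with finitely many values, so it is constant, and \<open>f'' / f'\<close> solves a Riccati equation
  with constant coefficients.
\<close>
lemma entire_constant_schwarzian:
  fixes f :: "complex \<Rightarrow> complex"
  assumes f: "f holomorphic_on UNIV" and nz: "\<And>z. deriv f z \<noteq> 0"
    and S: "\<And>z. schwarzian f z ^ p = r" and "p > 0"
  obtains c \<alpha> where "c ^ p = r" "\<And>z. schwarzian f z = c" "\<alpha>\<^sup>2 = - 2 * c"
    "\<And>z. deriv (deriv f) z = \<alpha> * deriv f z"
proof -
  define \<phi> where "\<phi> = (\<lambda>z. deriv (deriv f) z / deriv f z)"
  have \<phi>: "\<phi> holomorphic_on UNIV"
    unfolding \<phi>_def by (intro holomorphic_intros entire_deriv f nz)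
  have S_eq: "schwarzian f z = deriv \<phi> z - (\<phi> z)\<^sup>2 / 2" for z
    by (simp add: schwarzian_def \<phi>_def)
  have Sh: "schwarzian f holomorphic_on UNIV"
    unfolding S_eq[abs_def] by (intro holomorphic_intros \<phi> entire_deriv) auto
  have "range (schwarzian f) \<subseteq> {w. w ^ p = r}" using S by auto
  moreover have "finite {w. w ^ p = r}" using \<open>p > 0\<close> by (rule finite_nth_roots)
  ultimately have "finite (range (schwarzian f))" by (rule finite_subset)
  then have "schwarzian f constant_on UNIV"
    using continuous_finite_range_constant[OF connected_UNIV holomorphic_on_imp_continuous_on[OF Sh]] by simp
  then obtain c where c: "\<And>z. schwarzian f z = c" by (auto simp: constant_on_def)
  have "deriv \<phi> z - (\<phi> z)\<^sup>2 / 2 = c" for z using c S_eq by simp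
  from entire_Riccati_constant[OF \<phi> this] obtain \<alpha> where \<alpha>: "\<And>z. \<phi> z = \<alpha>" "\<alpha>\<^sup>2 = - 2 * c" by blast
  show ?thesis
  proof (rule that[of c \<alpha>])
    show "c ^ p = r" using S[of 0] c by simp
    show "deriv (deriv f) z = \<alpha> * deriv f z" for z
      using \<alpha>(1)[of z] nz[of z] by (simp add: \<phi>_def field_simps)
  qed (use c \<alpha> in auto)
qed

lemma linear_of_exp_iff:
  "(\<exists>L. linear_transformation L \<and> g = (\<lambda>z. L (exp (\<alpha> * z)))) \<longleftrightarrow>
   (\<exists>A B. A \<noteq> 0 \<and> g = (\<lambda>z. A * exp (\<alpha> * z) + B))"
  by (auto simp: linear_transformation_def)

context autonomous_schwarzian
begin

text \<open>
  Every entire solution \<open>g\<close> has a constant Schwarzian \<open>\<omega> c\<close> with \<open>\<omega>\<^sup>p = 1\<close> and satisfies \<open>g'' = \<alpha> g'\<close> with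
  \<open>\<alpha>\<^sup>2 = - 2 \<omega> c\<close>; the sign \<open>s\<close> accounts for the two square roots. If \<open>c\<close> were zero, the given solution
  would be a linear polynomial.
\<close>
lemma constant_rhs_classification:
  assumes sol: "entire_solution f" and trans: "\<not> (\<exists>q. f = poly q)" and R: "\<And>w. rhs w = r"
    and Q: "\<And>w. poly Q w \<noteq> 0"
  shows "\<exists>c. schwarzian_reduces p rhs (\<lambda>w. 1 * w + 0) (\<lambda>_. c) \<and> schwarzian_solution 1 (\<lambda>_. c) f \<and>
     {g. g holomorphic_on UNIV \<and> schwarzian_solution p rhs g} =
       {\<lambda>z. L (exp (s * csqrt (- 2 * (\<omega> * c)) * z)) | L s \<omega>.
          linear_transformation L \<and> s \<in> {1, - 1} \<and> \<omega> ^ p = 1}"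
proof -
  have const: "\<exists>c \<alpha>. c ^ p = r \<and> (\<forall>z. schwarzian g z = c) \<and> \<alpha>\<^sup>2 = - 2 * c \<and>
      (\<forall>z. deriv (deriv g) z = \<alpha> * deriv g z)" if g: "entire_solution g" for g
  proof -
    have gh: "g holomorphic_on UNIV" using g by (simp add: entire_solution_def)
    have nz: "deriv g z \<noteq> 0" for z using critical_value_is_pole[OF g] Q by blast
    have S: "schwarzian g z ^ p = r" for z
      using solution_at_regular_point[OF g nz Q] R by simp
    show ?thesis using entire_constant_schwarzian[OF gh nz S p_pos] by metis
  qed
  have f: "f holomorphic_on UNIV" "\<not> f constant_on UNIV" using sol by (auto simp: entire_solution_def)
  obtain c \<alpha>f where c: "c ^ p = r" "\<And>z. schwarzian f z = c" and \<alpha>f: "\<alpha>f\<^sup>2 = - 2 * c"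
      "\<And>z. deriv (deriv f) z = \<alpha>f * deriv f z"
    using const[OF sol] by blast
  have c0: "c \<noteq> 0"
  proof
    assume "c = 0"
    then have "(deriv f has_field_derivative 0) (at z)" for z
      using entire_DERIV[OF entire_deriv[OF f(1)], of z] \<alpha>f by simp
    then have "\<exists>\<beta>. \<forall>z\<in>UNIV. deriv f z = \<beta>"
      by (intro has_field_derivative_zero_constant) auto
    then obtain \<beta> where \<beta>: "\<And>z. deriv f z = \<beta>" by auto
    have "\<exists>\<gamma>. \<forall>z\<in>UNIV. f z - \<beta> * z = \<gamma>"
      by (rule has_field_derivative_zero_constant)
        (auto intro!: derivative_eq_intros entire_DERIV[OF f(1)] simp: \<beta>)
    then obtain \<gamma> where "\<And>z. f z - \<beta> * z = \<gamma>" by auto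
    then have "f z = \<gamma> + \<beta> * z" for z by (metis diff_eq_eq)
    then have "f = poly [:\<gamma>, \<beta>:]" by (auto simp: fun_eq_iff mult.commute)
    then show False using trans by blast
  qed
  have "eventually (\<lambda>w. rhs (1 * w + 0) = (poly [:c:] w / poly 1 w) ^ p) cofinite"
    by (simp add: R c)
  from schwarzian_reducesI[OF p_pos _ _ _ this]
  have red: "schwarzian_reduces p rhs (\<lambda>w. 1 * w + 0) (\<lambda>_. c)"
    using c0 by simp
  have solf: "schwarzian_solution 1 (\<lambda>_. c) f"
    unfolding schwarzian_solution_entire_iff[OF f(1)] using f(2) c(2) by simp
  have "{g. g holomorphic_on UNIV \<and> schwarzian_solution p rhs g} =
       {\<lambda>z. L (exp (s * csqrt (- 2 * (\<omega> * c)) * z)) | L s \<omega>.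
          linear_transformation L \<and> s \<in> {1, - 1} \<and> \<omega> ^ p = 1}" (is "?X = ?Y")
  proof (intro subset_antisym subsetI)
    fix g assume "g \<in> ?X"
    then have g: "g holomorphic_on UNIV" "entire_solution g" using entire_solution_iff by auto
    obtain c' \<alpha> where c': "c' ^ p = r" and \<alpha>: "\<alpha>\<^sup>2 = - 2 * c'" "\<And>z. deriv (deriv g) z = \<alpha> * deriv g z"
      using const[OF g(2)] by blast
    define \<omega> where "\<omega> = c' / c"
    have r0: "r \<noteq> 0" using c(1) c0 by auto
    have \<omega>: "\<omega> ^ p = 1" "\<omega> * c = c'" using c' c(1) c0 r0 by (auto simp: \<omega>_def power_divide)
    have c'0: "c' \<noteq> 0" using c' r0 p_pos by (auto simp: power_0_left)
    have \<alpha>0: "\<alpha> \<noteq> 0" using \<alpha>(1) c'0 by auto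
    have "(deriv g has_field_derivative \<alpha> * deriv g z) (at z)" for z
      using entire_DERIV[OF entire_deriv[OF g(1)], of z] \<alpha>(2) by simp
    from entire_eq_exp_if_log_derivative_const[OF this]
    have g': "deriv g z = deriv g 0 * exp (\<alpha> * z)" for z .
    have A0: "deriv g 0 \<noteq> 0" using critical_value_is_pole[OF g(2)] Q by blast
    have "((\<lambda>z. g z - deriv g 0 / \<alpha> * exp (\<alpha> * z)) has_field_derivative 0) (at z)" for z
    proof -
      have "(g has_field_derivative deriv g 0 * exp (\<alpha> * z)) (at z)"
        using entire_DERIV[OF g(1), of z] unfolding g'[of z] .
      then show ?thesis using \<alpha>0 by (auto intro!: derivative_eq_intros)
    qed
    then have "\<exists>B. \<forall>z\<in>UNIV. g z - deriv g 0 / \<alpha> * exp (\<alpha> * z) = B"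
      by (intro has_field_derivative_zero_constant) auto
    then obtain B where "\<And>z. g z - deriv g 0 / \<alpha> * exp (\<alpha> * z) = B" by auto
    then have "g = (\<lambda>z. deriv g 0 / \<alpha> * exp (\<alpha> * z) + B)" by (simp add: fun_eq_iff diff_eq_eq add.commute)
    then obtain L where L: "linear_transformation L" "g = (\<lambda>z. L (exp (\<alpha> * z)))"
      using linear_of_exp_iff[of g \<alpha>] A0 \<alpha>0 by (metis divide_eq_0_iff)
    have "\<alpha>\<^sup>2 = (csqrt (- 2 * (\<omega> * c)))\<^sup>2" unfolding \<omega>(2) power2_csqrt by (rule \<alpha>(1))
    then have "\<alpha> = csqrt (- 2 * (\<omega> * c)) \<or> \<alpha> = - csqrt (- 2 * (\<omega> * c))"
      by (simp only: power2_eq_iff)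
    then obtain s where "s \<in> {1, - 1}" "\<alpha> = s * csqrt (- 2 * (\<omega> * c))"
      by (metis insertI1 insertI2 mult_1 mult_minus1 singletonI)
    then show "g \<in> ?Y" using L \<omega>(1) by blast
  next
    fix g assume "g \<in> ?Y"
    then obtain L s \<omega> where L: "linear_transformation L" and s: "s \<in> {1, - 1}" and \<omega>: "\<omega> ^ p = 1"
      and g: "g = (\<lambda>z. L (exp (s * csqrt (- 2 * (\<omega> * c)) * z)))" by blast
    define \<alpha> where "\<alpha> = s * csqrt (- 2 * (\<omega> * c))"
    have "s\<^sup>2 = 1" using s by auto
    then have \<alpha>2: "\<alpha>\<^sup>2 = - 2 * (\<omega> * c)" unfolding \<alpha>_def power_mult_distrib power2_csqrt by simp
    have "\<omega> \<noteq> 0" using \<omega> p_pos by (auto simp: power_0_left)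
    then have \<alpha>0: "\<alpha> \<noteq> 0" using \<alpha>2 c0 by auto
    obtain A B where A: "A \<noteq> 0" and gAB: "g = (\<lambda>z. A * exp (\<alpha> * z) + B)"
      using linear_of_exp_iff[of g \<alpha>] L g unfolding \<alpha>_def by blast
    have gh: "g holomorphic_on UNIV" unfolding gAB by (intro holomorphic_intros)
    have "\<not> g constant_on UNIV"
    proof
      assume "g constant_on UNIV"
      then obtain d where "g = (\<lambda>_. d)" by (auto simp: constant_on_def)
      then have "deriv g 0 = 0" by simp
      moreover have "deriv g 0 = A * \<alpha>"
        unfolding gAB by (intro DERIV_imp_deriv) (auto intro!: derivative_eq_intros)
      ultimately show False using A \<alpha>0 by simp
    qed
    moreover have "schwarzian g z ^ p = rhs (g z)" for z
      unfolding schwarzian_exp_affine[OF gAB A \<alpha>0] \<alpha>2 R by (simp add: power_mult_distrib \<omega> c(1))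
    ultimately show "g \<in> ?X" using gh by (simp add: schwarzian_solution_entire_iff[OF gh])
  qed
  with red solf show ?thesis by blast
qed

end

theorem corollary1:
  fixes p :: nat and P Q :: "complex poly" and R f :: "complex \<Rightarrow> complex"
  assumes "p > 0"
    and "coprime P Q" and "Q \<noteq> 0"
    and R: "R = (\<lambda>w. poly P w / poly Q w)"
    and "transcendental_entire f" and "schwarzian_solution p R f"
  shows
    "\<exists>L1 c. linear_transformation L1 \<and>
       ((let T = (\<lambda>w. c * ((w - of_real (sqrt 2) * \<i>) * (w + of_real (sqrt 2) * \<i>))
                          / ((w - 1) * (w + 1)))
         in schwarzian_reduces p R L1 T \<and>
            (\<exists>u. f = (\<lambda>z. L1 (u z)) \<and> schwarzian_solution 1 T u) \<and>
            {g. g holomorphic_on UNIV \<and> schwarzian_solution p R g} =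
              {\<lambda>z. L1 (sin (csqrt (2 * (\<omega> * c)) * z + \<beta>)) | \<omega> \<beta>. \<omega> ^ p = 1})
        \<or>
        (let T = (\<lambda>w. c)
         in schwarzian_reduces p R L1 T \<and>
            (\<exists>u. f = (\<lambda>z. L1 (u z)) \<and> schwarzian_solution 1 T u) \<and>
            {g. g holomorphic_on UNIV \<and> schwarzian_solution p R g} =
              {\<lambda>z. L2 (exp (s * csqrt (- 2 * (\<omega> * c)) * z)) | L2 s \<omega>.
                 linear_transformation L2 \<and> s \<in> {1, - 1} \<and> \<omega> ^ p = 1}))"
proof -
  interpret autonomous_schwarzian p P Q
    by standard fact+
  have R_rhs: "R = rhs" by (simp add: R rhs_def[abs_def])
  have f: "f holomorphic_on UNIV" and trans: "\<not> (\<exists>q. f = poly q)"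
    using \<open>transcendental_entire f\<close> by (auto simp: transcendental_entire_def)
  have sol: "entire_solution f"
    using \<open>schwarzian_solution p R f\<close> entire_solution_iff[OF f] by (simp add: R_rhs)
  have deg: "degree P \<le> degree Q" by (rule degree_le[OF sol trans])
  consider (two) a b where "poly Q a = 0" "poly Q b = 0" "a \<noteq> b"
    | (one) a where "\<And>w. poly Q w = 0 \<longleftrightarrow> w = a" | (none) "\<And>w. poly Q w \<noteq> 0"
    by blast
  then show ?thesis
  proof cases
    case two
    define L where "L = (\<lambda>w. (a - b) / 2 * w + (a + b) / 2)"
    have L: "linear_transformation L"
      unfolding L_def linear_transformation_def using two(3) by (intro exI[of _ "(a - b) / 2"] exI[of _ "(a + b) / 2"]) auto
    have T: "(\<lambda>w. c * ((w - of_real (sqrt 2) * \<i>) * (w + of_real (sqrt 2) * \<i>)) / ((w - 1) * (w + 1)))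
        = (\<lambda>w. c * sine_rhs w)" for c
      by (simp add: sine_rhs_def)
    from two_root_classification[OF sol deg two L_def, folded R_rhs]
    obtain c where "schwarzian_reduces p R L (\<lambda>w. c * sine_rhs w) \<and>
       (\<exists>u. f = (\<lambda>z. L (u z)) \<and> schwarzian_solution 1 (\<lambda>w. c * sine_rhs w) u) \<and>
       {g. g holomorphic_on UNIV \<and> schwarzian_solution p R g} =
         {\<lambda>z. L (sin (csqrt (2 * (\<omega> * c)) * z + \<beta>)) | \<omega> \<beta>. \<omega> ^ p = 1}" by (rule exE)
    then show ?thesis
      unfolding Let_def by (intro exI[of _ L] exI[of _ c] conjI[OF L] disjI1) (simp only: T)
  next
    case one
    then show ?thesis using one_root_impossible[OF sol deg _ trans] by blast
  next
    case none
    have "constant (poly Q)" using none fundamental_theorem_of_algebra by blast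
    then have "degree Q = 0" by (simp add: constant_degree)
    with deg obtain p0 q0 where PQ: "P = [:p0:]" "Q = [:q0:]"
      by (metis degree_eq_zeroE le_zero_eq)
    have "rhs w = p0 / q0" for w using rhs_def[of w] by (simp only: PQ poly_pCons poly_0) simp
    from constant_rhs_classification[OF sol trans this none]
    obtain c where "schwarzian_reduces p R (\<lambda>w. 1 * w + 0) (\<lambda>_. c)" "schwarzian_solution 1 (\<lambda>_. c) f"
      "{g. g holomorphic_on UNIV \<and> schwarzian_solution p R g} =
       {\<lambda>z. L (exp (s * csqrt (- 2 * (\<omega> * c)) * z)) | L s \<omega>.
          linear_transformation L \<and> s \<in> {1, - 1} \<and> \<omega> ^ p = 1}"
      unfolding R_rhs by blast
    moreover have "linear_transformation (\<lambda>w. 1 * w + 0)"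
      unfolding linear_transformation_def by (intro exI[of _ 1] exI[of _ 0]) simp
    moreover have "f = (\<lambda>z. 1 * f z + 0)" by simp
    ultimately show ?thesis unfolding Let_def by (intro exI[of _ "\<lambda>w. 1 * w + 0"] exI[of _ c]) blast
  qed
qed

end
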